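(* Let $(\Omega,\mathcal A,\lambda)$ be a finite measure space such that $E=L^2(\Omega,\lambda)$ is separable, with norm $|\cdot|$ and inner product $\langle\cdot,\cdot\rangle$, and let $\tilde\mu$ be a non-degenerate, mean-zero Gaussian measure on $E$. Let $(V_N)_{N\in\mathbb N}$ be an increasing sequence of closed subspaces of $E$ whose union is dense in $E$, and let $P_N:E\to V_N$ be the orthogonal projection. Let $f:\mathbb R\to\mathbb R$ be of bounded variation such that for every point $a\in\mathbb R$ at which $f$ is discontinuous one has $\lambda(\{h=a\})=0$ for $\tilde\mu$-a.e. $h\in E$. Put $Q_f(h)=\int_\Omega f(h(\omega))\,d\lambda(\omega)$, $h\in E$. For $N\in\mathbb N$ let $(\tilde{\mathcal E}^N,\mathcal D(\tilde{\mathcal E}^N))$ be the smallest closed extension on $L^2(V_N,e^{-Q_f}\,\tilde\mu\circ P_N^{-1})$ of $$\tilde{\mathcal E}^N(u,v)=\int_{V_N}\langle\nabla\tilde u,\nabla\tilde v\rangle\,e^{-Q_f}\,d(\tilde\mu\circ P_N^{-1}),$$ defined for $u,v$ having representatives $\tilde u,\tilde v\in\mathscr FC_b^\infty(V_N)$, and let $(\mathcal E^\infty,\mathcal D(\mathcal E^\infty))$ be the smallest closed extension on $L^2(E,e^{-Q_f}\tilde\mu)$ of $$\mathcal E^\infty(u,v)=\int_E\langle\nabla\tilde u,\nabla\tilde v\rangle\,e^{-Q_f}\,d\tilde\mu,$$ defined for $u,v$ having representatives $\tilde u,\tilde v\in\mathscr FC_b^\infty(E)$. Then $(\tilde{\mathcal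 E}^N,\mathcal D(\tilde{\mathcal E}^N))_N$ converges to $(\mathcal E^\infty,\mathcal D(\mathcal E^\infty))$ in the sense of Mosco, with respect to the converging Hilbert spaces $L^2(V_N,e^{-Q_f}\tilde\mu\circ P_N^{-1})$, $N\in\mathbb N$, with limit $L^2(E,e^{-Q_f}\tilde\mu)$.
   Context: For a closed subspace $V\subseteq E$, $\mathscr FC_b^\infty(V)$ is the space of functions $F=g\circ(\langle l_1,\cdot\rangle,\dots,\langle l_m,\cdot\rangle)$ with $m\in\mathbb N$, $g\in C_b^\infty(\mathbb R^m)$, $l_1,\dots,l_m\in V$; its gradient is $\nabla F(z)=\sum_{i=1}^m\partial_ig(\langle l_1,z\rangle,\dots,\langle l_m,z\rangle)\,l_i$. Non-degenerate means that the covariance operator of $\tilde\mu$ is injective. Write $\mu'_N=e^{-Q_f}\,\tilde\mu\circ P_N^{-1}$ (on $V_N$) for $N\in\mathbb N$ and $\mu'_\infty=e^{-Q_f}\tilde\mu$ (on $V_\infty=E$). $u_N\in L^2(V_N,\mu'_N)$, $N\in\mathbb N\cup\{\infty\}$, converge strongly to $u_\infty$ if $\int_{V_N}u_N\varphi\,d\mu'_N\to\int_Eu_\infty\varphi\,d\mu'_\infty$ for every $\varphi\in C_b(E)$ and $\|u_N\|_{L^2(\mu'_N)}\to\|u_\infty\|_{L^2(\mu'_\infty)}$; they converge weakly to $u_\infty$ if $\int u_Nv_N\,d\mu'_N\to\int u_\infty v_\infty\,d\mu'_\infty$ whenever $v_N\to v_\infty$ strongly. Mosco convergence of closed forms $\tilde{\mathcal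 E}^N\to\mathcal E^\infty$ means (value $+\infty$ outside the domain): (M1) $u_N\to u$ weakly implies $\mathcal E^\infty(u,u)\le\liminf_N\tilde{\mathcal E}^N(u_N,u_N)$; (M2) for every $u\in\mathcal D(\mathcal E^\infty)$ there are $u_N\in\mathcal D(\tilde{\mathcal E}^N)$ with $u_N\to u$ strongly and $\tilde{\mathcal E}^N(u_N,u_N)\to\mathcal E^\infty(u,u)$. *)

theory Defs
  imports "HOL-Probability.Probability"
begin

section \<open>The Hilbert space \<open>E = L\<^sup>2(\<Omega>, \<lambda>)\<close>\<close>

definition L2 :: "'a measure \<Rightarrow> ('a \<Rightarrow> real) set" where
  "L2 M = {u \<in> borel_measurable M. integrable M (\<lambda>x. (u x)\<^sup>2)}"

definition L2norm :: "'a measure \<Rightarrow> ('a \<Rightarrow> real) \<Rightarrow> real" where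
  "L2norm M u = sqrt (\<integral>x. (u x)\<^sup>2 \<partial>M)"

text \<open>Functions in \<open>L2 M\<close> are not quotiented by a.e. equality; all notions below only depend
  on a.e. classes.

  The quotient of \<open>L2 L\<close> by a.e. equality depends on the measure \<open>L\<close>, so it is not a HOL type.
  The space \<open>E\<close> is therefore a type \<open>'e\<close> of elements \<open>h\<close> together with a choice \<open>rep h\<close> of a
  representative of each: \<open>h \<mapsto> [rep h]\<close> is linear, isometric (hence injective) and onto, i.e. an
  identification of the Hilbert space \<open>'e\<close> with \<open>L\<^sup>2(L)\<close>.\<close>

definition is_L2_space :: "'w measure \<Rightarrow> ('e::real_inner \<Rightarrow> 'w \<Rightarrow> real) \<Rightarrow> bool" where
  "is_L2_space L rep \<longleftrightarrow>
     (\<forall>h. rep h \<in> L2 L) \<and>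
     (\<forall>g\<in>L2 L. \<exists>h. AE \<omega> in L. rep h \<omega> = g \<omega>) \<and>
     (\<forall>h k. AE \<omega> in L. rep (h + k) \<omega> = rep h \<omega> + rep k \<omega>) \<and>
     (\<forall>c h. AE \<omega> in L. rep (c *\<^sub>R h) \<omega> = c * rep h \<omega>) \<and>
     (\<forall>h k. inner h k = (\<integral>\<omega>. rep h \<omega> * rep k \<omega> \<partial>L))"

definition is_orthogonal_projection :: "'e::real_inner set \<Rightarrow> ('e \<Rightarrow> 'e) \<Rightarrow> bool" where
  "is_orthogonal_projection V P \<longleftrightarrow> (\<forall>x. P x \<in> V \<and> (\<forall>v\<in>V. inner (x - P x) v = 0))"


section \<open>Gaussian measures\<close>

definition gaussian_measure :: "'e::{real_inner,banach,polish_space} measure \<Rightarrow> bool" where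
  "gaussian_measure \<mu> \<longleftrightarrow> sets \<mu> = sets borel \<and> prob_space \<mu> \<and>
     (\<forall>l. (\<exists>m. distr \<mu> borel (\<lambda>x. inner l x) = return borel m) \<or>
          (\<exists>m \<sigma>. \<sigma> > 0 \<and> distr \<mu> borel (\<lambda>x. inner l x) = density lborel (normal_density m \<sigma>)))"

definition mean_zero :: "'e::{real_inner,banach,polish_space} measure \<Rightarrow> bool" where
  "mean_zero \<mu> \<longleftrightarrow> (\<forall>l. (\<integral>x. inner l x \<partial>\<mu>) = 0)"

text \<open>The covariance operator of a mean-zero measure (no centering).\<close>

definition covariance_operator :: "'e::{real_inner,banach,polish_space} measure \<Rightarrow> 'e \<Rightarrow> 'e" where
  "covariance_operator \<mu> k = (\<integral>x. inner k x *\<^sub>R x \<partial>\<mu>)"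

definition nondegenerate :: "'e::{real_inner,banach,polish_space} measure \<Rightarrow> bool" where
  "nondegenerate \<mu> \<longleftrightarrow> inj (covariance_operator \<mu>)"


section \<open>The density\<close>

text \<open>Finite total variation over the whole real line.\<close>

definition bounded_variation :: "(real \<Rightarrow> real) \<Rightarrow> bool" where
  "bounded_variation f \<longleftrightarrow>
     (\<exists>B. \<forall>n (x :: nat \<Rightarrow> real). mono x \<longrightarrow> (\<Sum>i<n. \<bar>f (x (Suc i)) - f (x i)\<bar>) \<le> B)"

definition Q_functional ::
    "'w measure \<Rightarrow> ('e \<Rightarrow> 'w \<Rightarrow> real) \<Rightarrow> (real \<Rightarrow> real) \<Rightarrow> 'e \<Rightarrow> real" where
  "Q_functional L rep f h = (\<integral>\<omega>. f (rep h \<omega>) \<partial>L)"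

definition weighted :: "('e \<Rightarrow> real) \<Rightarrow> 'e measure \<Rightarrow> 'e measure" where
  "weighted Q \<mu> = density \<mu> (\<lambda>h. ennreal (exp (- Q h)))"

text \<open>The image measure \<open>\<mu> \<circ> P\<^sup>-\<^sup>1\<close> as a measure with underlying space \<open>V\<close>.\<close>

definition projected ::
    "'e::topological_space measure \<Rightarrow> 'e set \<Rightarrow> ('e \<Rightarrow> 'e) \<Rightarrow> 'e measure" where
  "projected \<mu> V P = distr \<mu> (restrict_space borel V) P"


section \<open>Smooth cylinder functions and their gradients\<close>

text \<open>A function on \<open>\<real>\<^sup>m\<close> is encoded as a function of sequences depending only on the coordinates
  with index below \<open>m\<close>.\<close>

definition partial_deriv :: "nat \<Rightarrow> ((nat \<Rightarrow> real) \<Rightarrow> real) \<Rightarrow> (nat \<Rightarrow> real) \<Rightarrow> real" where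
  "partial_deriv i g x = deriv (\<lambda>t. g (x(i := t))) (x i)"

definition Cb_infinity :: "nat \<Rightarrow> ((nat \<Rightarrow> real) \<Rightarrow> real) set" where
  "Cb_infinity m = {g.
     (\<forall>x y. (\<forall>i<m. x i = y i) \<longrightarrow> g x = g y) \<and>
     (\<forall>is. set is \<subseteq> {..<m} \<longrightarrow>
        foldr partial_deriv is g \<in> bcontfun \<and>
        (\<forall>i<m. \<forall>x. (\<lambda>t. foldr partial_deriv is g (x(i := t))) differentiable (at (x i))))}"

text \<open>\<open>cylinder V F G\<close>: \<open>F\<close> is a smooth cylinder function based on vectors of \<open>V\<close>, with gradient
  field \<open>G\<close>. Only the values of \<open>F\<close> and \<open>G\<close> on \<open>V\<close> matter when integrating over a measure
  with underlying space \<open>V\<close>.\<close>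

definition cylinder ::
    "'e::real_inner set \<Rightarrow> ('e \<Rightarrow> real) \<Rightarrow> ('e \<Rightarrow> 'e) \<Rightarrow> bool" where
  "cylinder V F G \<longleftrightarrow>
     (\<exists>m g (l :: nat \<Rightarrow> 'e). g \<in> Cb_infinity m \<and> (\<forall>i<m. l i \<in> V) \<and>
        F = (\<lambda>z. g (\<lambda>i. inner (l i) z)) \<and>
        G = (\<lambda>z. \<Sum>i<m. partial_deriv i g (\<lambda>j. inner (l j) z) *\<^sub>R l i))"

text \<open>The pre-form as a relation: \<open>u\<close> and \<open>v\<close> have smooth cylinder representatives, and \<open>e\<close> is
  the gradient integral of these. For the measures of interest, which charge every nonempty
  relatively open subset of \<open>V\<close>, the number \<open>e\<close> is determined by \<open>u\<close> and \<open>v\<close>.\<close>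

definition gradient_preform ::
    "'e::real_inner set \<Rightarrow> 'e measure \<Rightarrow> ('e \<Rightarrow> real) \<Rightarrow> ('e \<Rightarrow> real) \<Rightarrow> real \<Rightarrow> bool" where
  "gradient_preform V M u v e \<longleftrightarrow> u \<in> L2 M \<and> v \<in> L2 M \<and>
     (\<exists>F G F' G'. cylinder V F G \<and> cylinder V F' G' \<and>
        (AE z in M. u z = F z) \<and> (AE z in M. v z = F' z) \<and>
        e = (\<integral>z. inner (G z) (G' z) \<partial>M))"


section \<open>Closed forms\<close>

definition symmetric_form ::
    "'a measure \<Rightarrow> ('a \<Rightarrow> real) set \<Rightarrow> (('a \<Rightarrow> real) \<Rightarrow> ('a \<Rightarrow> real) \<Rightarrow> real) \<Rightarrow> bool" where
  "symmetric_form M D \<E> \<longleftrightarrow>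
     D \<subseteq> L2 M \<and> (\<lambda>x. 0) \<in> D \<and>
     (\<forall>u\<in>D. \<forall>v\<in>D. (\<lambda>x. u x + v x) \<in> D) \<and>
     (\<forall>c. \<forall>u\<in>D. (\<lambda>x. c * u x) \<in> D) \<and>
     (\<forall>u\<in>D. \<forall>v\<in>L2 M. (AE x in M. u x = v x) \<longrightarrow> v \<in> D \<and> (\<forall>w\<in>D. \<E> u w = \<E> v w)) \<and>
     (\<forall>u\<in>D. \<forall>v\<in>D. \<forall>w\<in>D. \<E> (\<lambda>x. u x + v x) w = \<E> u w + \<E> v w) \<and>
     (\<forall>c. \<forall>u\<in>D. \<forall>w\<in>D. \<E> (\<lambda>x. c * u x) w = c * \<E> u w) \<and>
     (\<forall>u\<in>D. \<forall>v\<in>D. \<E> u v = \<E> v u) \<and>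
     (\<forall>u\<in>D. 0 \<le> \<E> u u)"

text \<open>The squared form norm \<open>\<E>\<^sub>1(u,u) = \<E>(u,u) + \<parallel>u\<parallel>\<^sup>2\<close>.\<close>

definition form_norm_sq ::
    "'a measure \<Rightarrow> (('a \<Rightarrow> real) \<Rightarrow> ('a \<Rightarrow> real) \<Rightarrow> real) \<Rightarrow> ('a \<Rightarrow> real) \<Rightarrow> real" where
  "form_norm_sq M \<E> u = \<E> u u + (\<integral>x. (u x)\<^sup>2 \<partial>M)"

definition closed_form ::
    "'a measure \<Rightarrow> ('a \<Rightarrow> real) set \<Rightarrow> (('a \<Rightarrow> real) \<Rightarrow> ('a \<Rightarrow> real) \<Rightarrow> real) \<Rightarrow> bool" where
  "closed_form M D \<E> \<longleftrightarrow> symmetric_form M D \<E> \<and>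
     (\<forall>u :: nat \<Rightarrow> 'a \<Rightarrow> real.
        (\<forall>n. u n \<in> D) \<and>
        (\<forall>\<epsilon>>0. \<exists>n0. \<forall>m\<ge>n0. \<forall>n\<ge>n0. form_norm_sq M \<E> (\<lambda>x. u m x - u n x) < \<epsilon>) \<longrightarrow>
        (\<exists>w\<in>D. (\<lambda>n. form_norm_sq M \<E> (\<lambda>x. u n x - w x)) \<longlonglongrightarrow> 0))"

definition extends_preform ::
    "(('a \<Rightarrow> real) \<Rightarrow> ('a \<Rightarrow> real) \<Rightarrow> real \<Rightarrow> bool) \<Rightarrow>
     ('a \<Rightarrow> real) set \<Rightarrow> (('a \<Rightarrow> real) \<Rightarrow> ('a \<Rightarrow> real) \<Rightarrow> real) \<Rightarrow> bool" where
  "extends_preform B D \<E> \<longleftrightarrow> (\<forall>u v e. B u v e \<longrightarrow> u \<in> D \<and> v \<in> D \<and> \<E> u v = e)"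

definition smallest_closed_extension ::
    "'a measure \<Rightarrow> (('a \<Rightarrow> real) \<Rightarrow> ('a \<Rightarrow> real) \<Rightarrow> real \<Rightarrow> bool) \<Rightarrow>
     ('a \<Rightarrow> real) set \<Rightarrow> (('a \<Rightarrow> real) \<Rightarrow> ('a \<Rightarrow> real) \<Rightarrow> real) \<Rightarrow> bool" where
  "smallest_closed_extension M B D \<E> \<longleftrightarrow>
     closed_form M D \<E> \<and> extends_preform B D \<E> \<and>
     (\<forall>D' \<E>'. closed_form M D' \<E>' \<and> extends_preform B D' \<E>' \<longrightarrow>
        D \<subseteq> D' \<and> (\<forall>u\<in>D. \<forall>v\<in>D. \<E>' u v = \<E> u v))"


section \<open>Convergence along varying Hilbert spaces\<close>

text \<open>Convergence of the Hilbert spaces \<open>L\<^sup>2(M N)\<close> to \<open>L\<^sup>2(M\<infinity>)\<close> via the dense subspace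
  \<open>C\<^sub>b(E)\<close> of the limit space, whose elements are restricted to the space of \<open>M N\<close>.\<close>

definition converging_L2_spaces ::
    "(nat \<Rightarrow> 'e::topological_space measure) \<Rightarrow> 'e measure \<Rightarrow> bool" where
  "converging_L2_spaces M Minf \<longleftrightarrow>
     (\<forall>\<phi>::'e \<Rightarrow> real. \<phi> \<in> bcontfun \<longrightarrow> (\<lambda>N. L2norm (M N) \<phi>) \<longlonglongrightarrow> L2norm Minf \<phi>)"

definition strongly_converges ::
    "(nat \<Rightarrow> 'e::topological_space measure) \<Rightarrow> 'e measure \<Rightarrow>
     (nat \<Rightarrow> 'e \<Rightarrow> real) \<Rightarrow> ('e \<Rightarrow> real) \<Rightarrow> bool" where
  "strongly_converges M Minf u uinf \<longleftrightarrow>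
     (\<forall>N. u N \<in> L2 (M N)) \<and> uinf \<in> L2 Minf \<and>
     (\<forall>\<phi>\<in>bcontfun. (\<lambda>N. \<integral>z. u N z * \<phi> z \<partial>M N) \<longlonglongrightarrow> (\<integral>z. uinf z * \<phi> z \<partial>Minf)) \<and>
     (\<lambda>N. L2norm (M N) (u N)) \<longlonglongrightarrow> L2norm Minf uinf"

definition weakly_converges ::
    "(nat \<Rightarrow> 'e::topological_space measure) \<Rightarrow> 'e measure \<Rightarrow>
     (nat \<Rightarrow> 'e \<Rightarrow> real) \<Rightarrow> ('e \<Rightarrow> real) \<Rightarrow> bool" where
  "weakly_converges M Minf u uinf \<longleftrightarrow>
     (\<forall>N. u N \<in> L2 (M N)) \<and> uinf \<in> L2 Minf \<and>
     (\<forall>v vinf. strongly_converges M Minf v vinf \<longrightarrow>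
        (\<lambda>N. \<integral>z. u N z * v N z \<partial>M N) \<longlonglongrightarrow> (\<integral>z. uinf z * vinf z \<partial>Minf))"

definition form_value ::
    "('a \<Rightarrow> real) set \<Rightarrow> (('a \<Rightarrow> real) \<Rightarrow> ('a \<Rightarrow> real) \<Rightarrow> real) \<Rightarrow> ('a \<Rightarrow> real) \<Rightarrow> ereal" where
  "form_value D \<E> u = (if u \<in> D then ereal (\<E> u u) else \<infinity>)"

definition mosco_converges ::
    "(nat \<Rightarrow> 'e::topological_space measure) \<Rightarrow> 'e measure \<Rightarrow>
     (nat \<Rightarrow> ('e \<Rightarrow> real) set) \<Rightarrow> (nat \<Rightarrow> ('e \<Rightarrow> real) \<Rightarrow> ('e \<Rightarrow> real) \<Rightarrow> real) \<Rightarrow>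
     ('e \<Rightarrow> real) set \<Rightarrow> (('e \<Rightarrow> real) \<Rightarrow> ('e \<Rightarrow> real) \<Rightarrow> real) \<Rightarrow> bool" where
  "mosco_converges M Minf D \<E> Dinf \<E>inf \<longleftrightarrow>
     (\<forall>u uinf. weakly_converges M Minf u uinf \<longrightarrow>
        form_value Dinf \<E>inf uinf \<le> liminf (\<lambda>N. form_value (D N) (\<E> N) (u N))) \<and>
     (\<forall>w\<in>Dinf. \<exists>u. (\<forall>N. u N \<in> D N) \<and> strongly_converges M Minf u w \<and>
        (\<lambda>N. \<E> N (u N) (u N)) \<longlonglongrightarrow> \<E>inf w w)"

end

theory Submission
  imports Defs
begin

text \<open>The weight \<open>W = exp (- Q)\<close> lies between two positive constants, and \<open>W (P N z)\<close> tends to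
  \<open>W z\<close> almost surely, because a function of bounded variation has only countably many
  discontinuities. Cylinder functions based on \<open>V N\<close> are invariant under composition with \<open>P N\<close>,
  so every form can be read as a gradient integral over the fixed measure \<open>\<mu>\<close> with a varying
  weight, and cylinder functions of bounded energy are bounded in the form norm of the limit.

  For (M1), minimising the form norm over midpoint-convex sets of cylinder functions that inherit
  the energy bound and the weak limit yields a Cauchy sequence, and closedness puts the weak limit
  into the domain. The energy bound survives the limit since it holds for the weights
  \<open>inf m\<ge>n. W (P m z)\<close>, which increase to \<open>W\<close>. For (M2), cylinder functions approximating a given
  element of the limit domain are composed with \<open>P N\<close> along a diagonal sequence.\<close>

section \<open>Functions of bounded variation and the density\<close>

text \<open>The measures for different \<open>N\<close> live on different spaces and may be mutually
  singular, so they are compared only after being pulled back along \<open>P N\<close> to \<mu>.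
  Jumps of \<open>f\<close> can make \<open>W\<close> discontinuous in norm, so
  \<open>W (P N z)\<close> converges merely almost surely. Against functions bounded in L2 this is
  enough: a bounded weight times a fixed bounded test function converges in L2(\<mu>). Energy
  densities are bounded only in L1, where an almost surely convergent factor cannot be moved through
  the limit. A lower envelope of the weights that does not move with the sequence avoids this
  product of two moving quantities. The bounds \<open>c \<le> W \<le> C\<close> make the norms of a
  cylinder function comparable with constants independent of \<open>N\<close>. The forms are known
  only as smallest closed extensions: closedness of the limit form produces elements of its domain,
  and minimality gives density of cylinder functions in every domain.\<close>

lemma bounded_variation_imp_bounded:
  assumes "bounded_variation f"
  shows "bounded (range f)"
proof -
  obtain B where B: "\<And>n (x::nat\<Rightarrow>real). mono x \<Longrightarrow> (\<Sum>i<n. \<bar>f (x (Suc i)) - f (x i)\<bar>) \<le> B"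
    using assms unfolding bounded_variation_def by blast
  have "\<bar>f t\<bar> \<le> \<bar>f 0\<bar> + B" for t
  proof -
    \<comment> \<open>A partition with the two points 0 and t, in increasing order; one summand
      already bounds the oscillation between them.\<close>
    let ?x = "\<lambda>i::nat. if i = 0 then min 0 t else max 0 t"
    have "mono ?x" by (auto simp: mono_def)
    from B[OF this, of 1] have "\<bar>f (max 0 t) - f (min 0 t)\<bar> \<le> B" by simp
    then show ?thesis by (auto simp: min_def max_def split: if_splits)
  qed
  then show ?thesis unfolding bounded_iff by auto
qed

text \<open>Jordan decomposition: \<open>f = v - (v - f)\<close> for the variation function \<open>v\<close> of \<open>f\<close>.\<close>

lemma bounded_variation_countable_discontinuities:
  assumes "bounded_variation f"
  shows "countable {a. \<not> isCont f a}"
proof -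
  obtain B where B: "\<And>n (x::nat\<Rightarrow>real). mono x \<Longrightarrow> (\<Sum>i<n. \<bar>f (x (Suc i)) - f (x i)\<bar>) \<le> B"
    using assms unfolding bounded_variation_def by blast
  \<comment> \<open>\<open>v x\<close> is the variation of \<open>f\<close> on the half-line up to
    x. Terms of \<open>s\<close> beyond index n do not enter the sum, so capping the whole sequence
    by x costs nothing.\<close>
  define S where "S x = {\<Sum>i<n. \<bar>f (s (Suc i)) - f (s i)\<bar> | n (s::nat\<Rightarrow>real). mono s \<and> (\<forall>i. s i \<le> x)}" for x
  define v where "v x = Sup (S x)" for x
  have bdd: "bdd_above (S x)" for x
    using B unfolding S_def bdd_above_def by blast
  have ne: "S x \<noteq> {}" for x
    unfolding S_def by (auto intro!: exI[of _ "\<lambda>_. x"] simp: mono_def)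
  have step: "v x + \<bar>f y - f x\<bar> \<le> v y" if "x \<le> y" for x y
  proof -
    have "a \<le> v y - \<bar>f y - f x\<bar>" if "a \<in> S x" for a
    proof -
      obtain n s where a: "a = (\<Sum>i<n. \<bar>f (s (Suc i)) - f (s i)\<bar>)" and s: "mono s" "\<And>i. s i \<le> x"
        using \<open>a \<in> S x\<close> unfolding S_def by blast
      \<comment> \<open>The partition is prolonged by x and then y. The summand from
        \<open>s n\<close> to x is nonnegative and gets dropped; the last one is the increment from
        x to y.\<close>
      define t where "t i = (if i \<le> n then s i else if i = Suc n then x else y)" for i
      have t: "mono t" "\<And>i. t i \<le> y"
        using s \<open>x \<le> y\<close> order_trans[OF s(2) \<open>x \<le> y\<close>] unfolding t_def mono_def by auto
      have "(\<Sum>i<Suc (Suc n). \<bar>f (t (Suc i)) - f (t i)\<bar>) \<in> S y"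
        unfolding S_def using t by blast
      then have "(\<Sum>i<Suc (Suc n). \<bar>f (t (Suc i)) - f (t i)\<bar>) \<le> v y"
        unfolding v_def by (rule cSup_upper[OF _ bdd])
      moreover have "(\<Sum>i<n. \<bar>f (t (Suc i)) - f (t i)\<bar>) = a"
        unfolding a by (intro sum.cong) (auto simp: t_def)
      ultimately show ?thesis by (simp add: t_def)
    qed
    then have "v x \<le> v y - \<bar>f y - f x\<bar>"
      unfolding v_def[of x] by (intro cSup_least[OF ne])
    then show ?thesis by simp
  qed
  have mv: "mono v"
    by (rule monoI) (use step in \<open>smt (verit)\<close>)
  have mw: "mono (\<lambda>x. v x - f x)"
    by (rule monoI) (use step in \<open>smt (verit)\<close>)
  have "isCont f a" if "isCont v a" "isCont (\<lambda>x. v x - f x) a" for a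
    using continuous_diff[OF that] by simp
  then have "{a. \<not> isCont f a} \<subseteq> {a. \<not> isCont v a} \<union> {a. \<not> isCont (\<lambda>x. v x - f x) a}"
    by auto
  then show ?thesis
    by (rule countable_subset) (intro countable_Un mono_ctble_discont mv mw)
qed

lemma bounded_variation_borel_measurable:
  assumes "bounded_variation f"
  shows "f \<in> borel_measurable borel"
  by (rule borel_measurable_continuous_countable_exceptions
        [OF bounded_variation_countable_discontinuities[OF assms]])
     (auto intro!: continuous_at_imp_continuous_on)

text \<open>Convergence in L2 gives almost sure convergence only along a subsequence; this criterion
  leads back to the full sequence. If a neighbourhood of l were missed infinitely often, the bad
  indices would form a subsequence without a convergent refinement.\<close>

lemma LIMSEQ_if_subsubseq:
  fixes x :: "nat \<Rightarrow> 'a::topological_space"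
  assumes "\<And>r :: nat \<Rightarrow> nat. strict_mono r \<Longrightarrow> \<exists>s :: nat \<Rightarrow> nat. strict_mono s \<and> (\<lambda>n. x (r (s n))) \<longlonglongrightarrow> l"
  shows "x \<longlonglongrightarrow> l"
proof (rule topological_tendstoI, rule ccontr)
  fix S assume S: "open S" "l \<in> S" "\<not> (\<forall>\<^sub>F n in sequentially. x n \<in> S)"
  then have "infinite {n. x n \<notin> S}"
    by (simp add: eventually_sequentially infinite_nat_iff_unbounded_le)
  then obtain r :: "nat \<Rightarrow> nat" where r: "strict_mono r" "\<And>n. r n \<in> {n. x n \<notin> S}"
    using infinite_enumerate[of "{n. x n \<notin> S}"] by blast
  obtain s where "(\<lambda>n. x (r (s n))) \<longlonglongrightarrow> l"
    using assms[OF r(1)] by blast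
  from topological_tendstoD[OF this S(1,2)] r(2) show False
    by (auto simp: eventually_sequentially)
qed

text \<open>Bridge from bounded continuous functions to the closed sets, which are stable under
  intersection and generate the Borel sets. The functions fall off linearly with slope n in the
  distance to \<open>C\<close>. The empty set is excluded because \<open>infdist\<close> to it is 0
  by convention.\<close>

lemma indicator_closed_limit:
  fixes C :: "'a::metric_space set"
  assumes C: "closed C" "C \<noteq> {}"
  obtains \<phi> :: "nat \<Rightarrow> 'a \<Rightarrow> real" where
    "\<And>n. \<phi> n \<in> bcontfun" "\<And>n t. \<bar>\<phi> n t\<bar> \<le> 1" "\<And>t. (\<lambda>n. \<phi> n t) \<longlonglongrightarrow> indicator C t"
proof
  define \<phi> where "\<phi> n t = max 0 (1 - real n * infdist t C)" for n t
  show "(\<lambda>n. \<phi> n t) \<longlonglongrightarrow> indicator C t" for t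
  proof (cases "t \<in> C")
    case True
    then show ?thesis by (simp add: \<phi>_def)
  next
    case False
    then have "infdist t C > 0"
      using in_closed_iff_infdist_zero[OF C] infdist_nonneg[of t C] by fastforce
    then obtain n0 where n0: "1 < real n0 * infdist t C"
      using reals_Archimedean3[of "infdist t C"] by blast
    have "\<phi> n t = 0" if "n \<ge> n0" for n
    proof -
      have "real n0 * infdist t C \<le> real n * infdist t C"
        using that by (intro mult_right_mono) (auto simp: infdist_nonneg)
      with n0 show ?thesis unfolding \<phi>_def by simp
    qed
    then have "\<forall>\<^sub>F n in sequentially. \<phi> n t = 0" by (auto simp: eventually_sequentially)
    with False show ?thesis by (simp add: tendsto_eventually)
  qed
  show b: "\<bar>\<phi> n t\<bar> \<le> 1" for n t unfolding \<phi>_def by (auto simp: infdist_nonneg)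
  have c: "continuous_on UNIV (\<phi> n)" for n unfolding \<phi>_def by (intro continuous_intros)
  show "\<phi> n \<in> bcontfun" for n
    unfolding bcontfun_def bounded_iff using b c by auto
qed

section \<open>Continuity, measurability and bounds of the exponent Q\<close>

locale L2_model = finite_measure L for L :: "'w measure" +
  fixes rep :: "'e::{real_inner,second_countable_topology} \<Rightarrow> 'w \<Rightarrow> real"
  assumes is_L2: "is_L2_space L rep"
begin

lemma rep_measurable [measurable]: "rep h \<in> borel_measurable L"
  using is_L2 unfolding is_L2_space_def L2_def by blast

lemma norm_diff_eq:
  "(norm (h - k))\<^sup>2 = (\<integral>\<omega>. (rep h \<omega> - rep k \<omega>)\<^sup>2 \<partial>L)"
    and integrable_diff_sq: "integrable L (\<lambda>\<omega>. (rep h \<omega> - rep k \<omega>)\<^sup>2)"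
proof -
  \<comment> \<open>\<open>rep\<close> is linear only up to null sets, separately for sums and
    multiples, so the difference is split accordingly.\<close>
  have "AE \<omega> in L. rep (h + (-1) *\<^sub>R k) \<omega> = rep h \<omega> + rep ((-1) *\<^sub>R k) \<omega>"
    "AE \<omega> in L. rep ((-1) *\<^sub>R k) \<omega> = (-1) * rep k \<omega>"
    using is_L2 unfolding is_L2_space_def by blast+
  then have *: "AE \<omega> in L. rep (h - k) \<omega> = rep h \<omega> - rep k \<omega>"
    by eventually_elim simp
  have "integrable L (\<lambda>\<omega>. (rep (h - k) \<omega>)\<^sup>2)"
    using is_L2 unfolding is_L2_space_def L2_def by blast
  then show "integrable L (\<lambda>\<omega>. (rep h \<omega> - rep k \<omega>)\<^sup>2)"
    by (subst integrable_cong_AE[where g = "\<lambda>\<omega>. (rep (h - k) \<omega>)\<^sup>2"]) (use * in auto)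
  have "(norm (h - k))\<^sup>2 = (\<integral>\<omega>. rep (h - k) \<omega> * rep (h - k) \<omega> \<partial>L)"
    using is_L2 unfolding is_L2_space_def power2_norm_eq_inner by blast
  also have "\<dots> = (\<integral>\<omega>. (rep h \<omega> - rep k \<omega>)\<^sup>2 \<partial>L)"
    by (intro integral_cong_AE) (use * in \<open>auto simp: power2_eq_square\<close>)
  finally show "(norm (h - k))\<^sup>2 = (\<integral>\<omega>. (rep h \<omega> - rep k \<omega>)\<^sup>2 \<partial>L)" .
qed

text \<open>Norm convergence is L2 convergence of representatives, hence almost sure convergence
  along a subsequence, and dominated convergence applies. Continuity of \<open>f\<close> matters
  only at the values of the limit \<open>k\<close>; the approximating functions may well take values
  at jumps.\<close>

lemma Q_functional_tendsto:
  assumes f [measurable]: "f \<in> borel_measurable borel" and bdd: "\<And>t. \<bar>f t\<bar> \<le> B"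
    and conv: "h \<longlonglongrightarrow> k" and cont: "AE \<omega> in L. isCont f (rep k \<omega>)"
  shows "(\<lambda>n. Q_functional L rep f (h n)) \<longlonglongrightarrow> Q_functional L rep f k"
proof (rule LIMSEQ_if_subsubseq)
  fix r :: "nat \<Rightarrow> nat" assume r: "strict_mono r"
  have "(\<lambda>n. h (r n)) \<longlonglongrightarrow> k"
    using LIMSEQ_subseq_LIMSEQ[OF conv r] by (simp add: o_def)
  then have "(\<lambda>n. (norm (h (r n) - k))\<^sup>2) \<longlonglongrightarrow> 0\<^sup>2"
    by (intro tendsto_intros) (simp add: LIM_zero tendsto_norm_zero)
  then have "(\<lambda>n. \<integral>\<omega>. norm ((rep (h (r n)) \<omega> - rep k \<omega>)\<^sup>2) \<partial>L) \<longlonglongrightarrow> 0"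
    by (simp add: norm_diff_eq)
  from tendsto_L1_AE_subseq[OF integrable_diff_sq this]
  obtain s where s: "strict_mono s"
    and ae: "AE \<omega> in L. (\<lambda>n. (rep (h (r (s n))) \<omega> - rep k \<omega>)\<^sup>2) \<longlonglongrightarrow> 0" by blast
  have "AE \<omega> in L. (\<lambda>n. f (rep (h (r (s n))) \<omega>)) \<longlonglongrightarrow> f (rep k \<omega>)"
    using ae cont
  proof eventually_elim
    case (elim \<omega>)
    have "(\<lambda>n. \<bar>rep (h (r (s n))) \<omega> - rep k \<omega>\<bar>) \<longlonglongrightarrow> 0"
      using tendsto_real_sqrt[OF elim(1)] by simp
    then have "(\<lambda>n. rep (h (r (s n))) \<omega>) \<longlonglongrightarrow> rep k \<omega>"
      by (rule LIM_zero_cancel[OF tendsto_rabs_zero_cancel])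
    then show ?case by (rule isCont_tendsto_compose[OF elim(2)])
  qed
  then have "(\<lambda>n. \<integral>\<omega>. f (rep (h (r (s n))) \<omega>) \<partial>L) \<longlonglongrightarrow> (\<integral>\<omega>. f (rep k \<omega>) \<partial>L)"
    by (intro integral_dominated_convergence[where w = "\<lambda>_. B"]) (use bdd in auto)
  with s show "\<exists>s. strict_mono s \<and>
      (\<lambda>n. Q_functional L rep f (h (r (s n)))) \<longlonglongrightarrow> Q_functional L rep f k"
    unfolding Q_functional_def by blast
qed

lemma Q_functional_measurable_continuous:
  assumes cont: "continuous_on UNIV f" and bdd: "\<And>t. \<bar>f t\<bar> \<le> B"
  shows "Q_functional L rep f \<in> borel_measurable borel"
proof (rule borel_measurable_continuous_onI)
  have "isCont (Q_functional L rep f) k" for k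
    unfolding continuous_at_sequentially
  proof (intro allI impI)
    fix h assume "h \<longlonglongrightarrow> k"
    then show "(Q_functional L rep f \<circ> h) \<longlonglongrightarrow> Q_functional L rep f k"
      unfolding o_def
      by (intro Q_functional_tendsto[OF _ bdd])
         (use cont in \<open>auto simp: continuous_on_eq_continuous_at intro: borel_measurable_continuous_onI\<close>)
  qed
  then show "continuous_on UNIV (Q_functional L rep f)"
    by (simp add: continuous_on_eq_continuous_at)
qed

lemma measurable_emeasure_rep:
  assumes "A \<in> sets borel"
  shows "(\<lambda>h. emeasure L (rep h -` A \<inter> space L)) \<in> borel_measurable borel"
proof -
  have stable: "Int_stable {C::real set. closed C}" "{C::real set. closed C} \<subseteq> Pow UNIV"
    by (auto simp: Int_stable_def)
  have "sets (borel :: real measure) = sigma_sets UNIV {C. closed C}"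
    unfolding borel_eq_closed by (rule sets_measure_of) simp
  with assms have "A \<in> sigma_sets UNIV {C. closed C}" by (rule back_subst[of "(\<in>) A"])
  then have "A \<in> sets borel \<and> (\<lambda>h. emeasure L (rep h -` A \<inter> space L)) \<in> borel_measurable borel"
  proof (rule sigma_sets_induct_disjoint[OF stable, where P = "\<lambda>A. A \<in> sets borel \<and>
      (\<lambda>h. emeasure L (rep h -` A \<inter> space L)) \<in> borel_measurable borel"], goal_cases)
    case (1 C)
    then have basic: "closed C" by simp
    have C [measurable]: "C \<in> sets borel" using basic by auto
    have "(\<lambda>h. measure L (rep h -` C \<inter> space L)) \<in> borel_measurable borel" if ne: "C \<noteq> {}"
    proof -
      obtain \<phi> :: "nat \<Rightarrow> real \<Rightarrow> real" where \<phi>: "\<And>n. \<phi> n \<in> bcontfun" "\<And>n t. \<bar>\<phi> n t\<bar> \<le> 1"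
        "\<And>t. (\<lambda>n. \<phi> n t) \<longlonglongrightarrow> indicator C t"
        using indicator_closed_limit[OF basic ne] by metis
      have c: "continuous_on UNIV (\<phi> n)" for n using \<phi>(1) by (simp add: bcontfun_def)
      have [measurable]: "\<phi> n \<in> borel_measurable borel" for n
        by (rule borel_measurable_continuous_onI[OF c])
      show ?thesis
      proof (rule borel_measurable_LIMSEQ_real)
        show "Q_functional L rep (\<phi> n) \<in> borel_measurable borel" for n
          by (rule Q_functional_measurable_continuous[OF c \<phi>(2)])
        fix h
        have "(\<lambda>n. \<integral>\<omega>. \<phi> n (rep h \<omega>) \<partial>L) \<longlonglongrightarrow> (\<integral>\<omega>. indicator C (rep h \<omega>) \<partial>L)"
          by (intro integral_dominated_convergence[where w = "\<lambda>_. 1"]) (use \<phi> in auto)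
        moreover have "(\<integral>\<omega>. indicat_real C (rep h \<omega>) \<partial>L) = (\<integral>\<omega>. indicat_real (rep h -` C \<inter> space L) \<omega> \<partial>L)"
          by (intro Bochner_Integration.integral_cong) (auto split: split_indicator)
        ultimately show "(\<lambda>n. Q_functional L rep (\<phi> n) h) \<longlonglongrightarrow> measure L (rep h -` C \<inter> space L)"
          unfolding Q_functional_def by simp
      qed
    qed
    then show ?case using C by (cases "C = {}") (auto simp: emeasure_eq_measure)
  next
    case 2
    then show ?case by simp
  next
    case (3 A)
    then have [measurable]: "A \<in> sets borel" and
      m [measurable]: "(\<lambda>h. emeasure L (rep h -` A \<inter> space L)) \<in> borel_measurable borel" by auto
    have "emeasure L (rep h -` (UNIV - A) \<inter> space L)
        = emeasure L (space L) - emeasure L (rep h -` A \<inter> space L)" for h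
    proof -
      have "rep h -` (UNIV - A) \<inter> space L = space L - (rep h -` A \<inter> space L)" by auto
      then show ?thesis by (simp add: emeasure_Diff)
    qed
    then show ?case by simp
  next
    case (4 A)
    then have [measurable]: "\<And>i. A i \<in> sets borel" and
      m [measurable]: "\<And>i. (\<lambda>h. emeasure L (rep h -` A i \<inter> space L)) \<in> borel_measurable borel" by auto
    have "emeasure L (rep h -` (\<Union>i. A i) \<inter> space L) = (\<Sum>i. emeasure L (rep h -` A i \<inter> space L))" for h
    proof -
      have "rep h -` (\<Union>i. A i) \<inter> space L = (\<Union>i. rep h -` A i \<inter> space L)" by auto
      moreover have "disjoint_family (\<lambda>i. rep h -` A i \<inter> space L)"
        using 4(1) unfolding disjoint_family_on_def by blast
      ultimately show ?thesis by (simp add: suminf_emeasure image_subset_iff)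
    qed
    then show ?case by simp
  qed
  then show ?thesis by simp
qed

lemma measurable_nn_integral_rep:
  fixes g :: "real \<Rightarrow> ennreal"
  assumes "g \<in> borel_measurable borel"
  shows "(\<lambda>h. \<integral>\<^sup>+\<omega>. g (rep h \<omega>) \<partial>L) \<in> borel_measurable borel"
  using assms
proof (induction rule: borel_measurable_induct)
  case (cong f g)
  then show ?case by simp
next
  case (set A)
  have [measurable]: "A \<in> sets borel" by (rule set)
  have "(\<integral>\<^sup>+\<omega>. indicator A (rep h \<omega>) \<partial>L) = emeasure L (rep h -` A \<inter> space L)" for h
  proof -
    have "(\<integral>\<^sup>+\<omega>. indicator A (rep h \<omega>) \<partial>L) = (\<integral>\<^sup>+\<omega>. indicator (rep h -` A \<inter> space L) \<omega> \<partial>L)"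
      by (intro nn_integral_cong) (auto split: split_indicator)
    then show ?thesis by simp
  qed
  then show ?case using measurable_emeasure_rep[OF set] by simp
next
  case (mult u c)
  then show ?case by (simp add: nn_integral_cmult)
next
  case (add u v)
  then show ?case by (simp add: nn_integral_add)
next
  case (seq U)
  have "(\<integral>\<^sup>+\<omega>. (SUP i. U i) (rep h \<omega>) \<partial>L) = (SUP i. \<integral>\<^sup>+\<omega>. U i (rep h \<omega>) \<partial>L)" for h
    unfolding SUP_apply
    by (rule nn_integral_monotone_convergence_SUP)
       (use seq in \<open>auto simp: incseq_def le_fun_def\<close>)
  then show ?case using seq by simp
qed

lemma Q_functional_measurable:
  assumes f [measurable]: "f \<in> borel_measurable borel" and bdd: "\<And>t. \<bar>f t\<bar> \<le> B"
  shows "Q_functional L rep f \<in> borel_measurable borel"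
proof -
  \<comment> \<open>Adding B makes the integrand nonnegative, so that the integral becomes a
    nonnegative one; finiteness of \<open>L\<close> allows the constant to be subtracted
    again.\<close>
  have *: "Q_functional L rep f h = enn2real (\<integral>\<^sup>+\<omega>. ennreal (f (rep h \<omega>) + B) \<partial>L) - B * measure L (space L)" for h
  proof -
    have i: "integrable L (\<lambda>\<omega>. f (rep h \<omega>))"
      by (rule integrable_const_bound[where B = B]) (use bdd in auto)
    have "0 \<le> f t + B" for t using bdd[of t] by linarith
    then have "enn2real (\<integral>\<^sup>+\<omega>. ennreal (f (rep h \<omega>) + B) \<partial>L) = (\<integral>\<omega>. f (rep h \<omega>) + B \<partial>L)"
      by (subst integral_eq_nn_integral) auto
    also have "\<dots> = Q_functional L rep f h + B * measure L (space L)"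
      unfolding Q_functional_def using i by simp
    finally show ?thesis by simp
  qed
  have "(\<lambda>h. \<integral>\<^sup>+\<omega>. ennreal (f (rep h \<omega>) + B) \<partial>L) \<in> borel_measurable borel"
    by (rule measurable_nn_integral_rep) simp
  then show ?thesis
    unfolding *[abs_def] by simp
qed

lemma Q_functional_bounded:
  assumes f [measurable]: "f \<in> borel_measurable borel" and bdd: "\<And>t. \<bar>f t\<bar> \<le> B"
  shows "\<bar>Q_functional L rep f h\<bar> \<le> B * measure L (space L)"
proof -
  have "\<bar>Q_functional L rep f h\<bar> \<le> (\<integral>\<omega>. \<bar>f (rep h \<omega>)\<bar> \<partial>L)"
    unfolding Q_functional_def by (rule integral_abs_bound)
  also have "\<dots> \<le> (\<integral>\<omega>. B \<partial>L)"
    by (intro integral_mono integrable_const_bound[where B = B]) (use bdd order_trans[OF abs_ge_zero bdd[of 0]] in auto)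
  finally show ?thesis by (simp add: mult.commute)
qed

end

section \<open>Symmetric forms and smallest closed extensions\<close>

text \<open>Here a, b, c play the roles of \<open>E u u\<close>, \<open>E v v\<close>,
  \<open>E u v\<close>, and the hypothesis is nonnegativity of the form at \<open>s u + t v\<close>.
  Both inequalities are thus available for every nonnegative quadratic form, definite or
  not.\<close>

lemma sqrt_triangle_quadratic:
  fixes a b c :: real
  assumes "\<And>s t. 0 \<le> s\<^sup>2 * a + 2 * s * t * c + t\<^sup>2 * b"
  shows "\<bar>c\<bar> \<le> sqrt a * sqrt b" and "sqrt (a + 2 * c + b) \<le> sqrt a + sqrt b"
proof -
  have nn: "0 \<le> a" "0 \<le> b" using assms[of 1 0] assms[of 0 1] by auto
  \<comment> \<open>The choices (s, t) = (c, -a) and (-b, c) turn the quadratic expression into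
    \<open>a\<close> or \<open>b\<close> times the discriminant.\<close>
  have "0 \<le> a * (a * b - c\<^sup>2)" "0 \<le> b * (a * b - c\<^sup>2)"
    using assms[of c "- a"] assms[of "- b" c] by (auto simp: power2_eq_square algebra_simps)
  then have "c\<^sup>2 \<le> a * b" if "a > 0 \<or> b > 0"
    using that by (auto simp: zero_le_mult_iff)
  \<comment> \<open>In the degenerate case these products vanish and say nothing; the signs t = 1
    and t = -1 force c = 0.\<close>
  moreover have "c = 0" if "a = 0" "b = 0"
    using assms[of 1 1] assms[of 1 "-1"] that by simp
  ultimately have c: "c\<^sup>2 \<le> a * b" using nn by (cases "a > 0 \<or> b > 0") auto
  then show "\<bar>c\<bar> \<le> sqrt a * sqrt b"
    by (metis real_sqrt_abs real_sqrt_le_iff real_sqrt_mult)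
  then have "a + 2 * c + b \<le> (sqrt a + sqrt b)\<^sup>2"
    using nn by (simp add: power2_sum)
  then show "sqrt (a + 2 * c + b) \<le> sqrt a + sqrt b"
    using nn by (intro real_le_lsqrt) auto
qed

locale sym_form =
  fixes M :: "'a measure" and D :: "('a \<Rightarrow> real) set" and E
  assumes form: "symmetric_form M D E"
begin

lemma in_L2: "u \<in> D \<Longrightarrow> u \<in> L2 M"
  and zero: "(\<lambda>x. 0) \<in> D"
  and add: "u \<in> D \<Longrightarrow> v \<in> D \<Longrightarrow> (\<lambda>x. u x + v x) \<in> D"
  and scale: "u \<in> D \<Longrightarrow> (\<lambda>x. c * u x) \<in> D"
  and add_left: "u \<in> D \<Longrightarrow> v \<in> D \<Longrightarrow> w \<in> D \<Longrightarrow> E (\<lambda>x. u x + v x) w = E u w + E v w"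
  and scale_left: "u \<in> D \<Longrightarrow> w \<in> D \<Longrightarrow> E (\<lambda>x. c * u x) w = c * E u w"
  and sym: "u \<in> D \<Longrightarrow> v \<in> D \<Longrightarrow> E u v = E v u"
  and nonneg: "u \<in> D \<Longrightarrow> 0 \<le> E u u"
  using form unfolding symmetric_form_def by auto

lemma AE_closed: "u \<in> D \<Longrightarrow> v \<in> L2 M \<Longrightarrow> AE x in M. u x = v x \<Longrightarrow> v \<in> D"
  and AE_left: "u \<in> D \<Longrightarrow> v \<in> L2 M \<Longrightarrow> AE x in M. u x = v x \<Longrightarrow> w \<in> D \<Longrightarrow> E u w = E v w"
  using form unfolding symmetric_form_def by blast+

lemma diff: "u \<in> D \<Longrightarrow> v \<in> D \<Longrightarrow> (\<lambda>x. u x - v x) \<in> D"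
  using add[OF _ scale[of v "-1"]] by simp

lemma quadratic:
  assumes "u \<in> D" "v \<in> D"
  shows "E (\<lambda>x. s * u x + t * v x) (\<lambda>x. s * u x + t * v x)
    = s\<^sup>2 * E u u + 2 * s * t * E u v + t\<^sup>2 * E v v"
proof -
  let ?w = "\<lambda>x. s * u x + t * v x"
  have su: "(\<lambda>x. s * u x) \<in> D" and tv: "(\<lambda>x. t * v x) \<in> D" and w: "?w \<in> D"
    using assms by (auto intro: add scale)
  have *: "E ?w z = s * E u z + t * E v z" if "z \<in> D" for z
    using assms su tv that by (simp add: add_left scale_left)
  have "E u ?w = s * E u u + t * E u v" "E v ?w = s * E u v + t * E v v"
    using assms * sym[OF _ w] sym[of v u] by auto
  with *[OF w] show ?thesis by (simp add: power2_eq_square algebra_simps)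
qed

lemma quadratic_nonneg:
  assumes "u \<in> D" "v \<in> D"
  shows "0 \<le> s\<^sup>2 * E u u + 2 * s * t * E u v + t\<^sup>2 * E v v"
  unfolding quadratic[OF assms, symmetric] using assms by (intro nonneg add scale)

lemma Cauchy_Schwarz: "u \<in> D \<Longrightarrow> v \<in> D \<Longrightarrow> \<bar>E u v\<bar> \<le> sqrt (E u u) * sqrt (E v v)"
  by (rule sqrt_triangle_quadratic(1)[OF quadratic_nonneg])

lemma add_self: "u \<in> D \<Longrightarrow> v \<in> D \<Longrightarrow>
    E (\<lambda>x. u x + v x) (\<lambda>x. u x + v x) = E u u + 2 * E u v + E v v"
  using quadratic[of u v 1 1] by simp

lemma diff_self: "u \<in> D \<Longrightarrow> v \<in> D \<Longrightarrow>
    E (\<lambda>x. u x - v x) (\<lambda>x. u x - v x) = E u u - 2 * E u v + E v v"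
  using quadratic[of u v 1 "-1"] by simp

lemma triangle: "u \<in> D \<Longrightarrow> v \<in> D \<Longrightarrow>
    sqrt (E (\<lambda>x. u x + v x) (\<lambda>x. u x + v x)) \<le> sqrt (E u u) + sqrt (E v v)"
  unfolding add_self by (rule sqrt_triangle_quadratic(2)[OF quadratic_nonneg])

lemma triangle_diff:
  assumes "u \<in> D" "v \<in> D"
  shows "\<bar>sqrt (E u u) - sqrt (E v v)\<bar> \<le> sqrt (E (\<lambda>x. u x - v x) (\<lambda>x. u x - v x))"
proof -
  have *: "E (\<lambda>x. v x - u x) (\<lambda>x. v x - u x) = E (\<lambda>x. u x - v x) (\<lambda>x. u x - v x)"
    unfolding diff_self[OF assms] diff_self[OF assms(2,1)] using sym[OF assms] by simp
  have "sqrt (E u u) \<le> sqrt (E (\<lambda>x. u x - v x) (\<lambda>x. u x - v x)) + sqrt (E v v)"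
    using triangle[OF diff[OF assms] assms(2)] by simp
  moreover have "sqrt (E v v) \<le> sqrt (E (\<lambda>x. u x - v x) (\<lambda>x. u x - v x)) + sqrt (E u u)"
    using triangle[OF diff[OF assms(2,1)] assms(1)] unfolding * by simp
  ultimately show ?thesis by linarith
qed

lemma diff_triangle:
  assumes "u \<in> D" "v \<in> D" "w \<in> D"
  shows "sqrt (E (\<lambda>x. u x - w x) (\<lambda>x. u x - w x))
    \<le> sqrt (E (\<lambda>x. u x - v x) (\<lambda>x. u x - v x)) + sqrt (E (\<lambda>x. v x - w x) (\<lambda>x. v x - w x))"
  using triangle[OF diff[OF assms(1,2)] diff[OF assms(2,3)]] by simp

lemma AE_self:
  assumes "u \<in> D" "v \<in> L2 M" "AE x in M. u x = v x"
  shows "E u u = E v v"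
  using AE_left[OF assms assms(1)] AE_left[OF assms AE_closed[OF assms]]
    sym[OF assms(1) AE_closed[OF assms]] by simp

lemma AE_diff_self:
  assumes "u \<in> D" "v \<in> D" "AE x in M. u x = v x"
  shows "E (\<lambda>x. u x - v x) (\<lambda>x. u x - v x) = 0"
proof -
  have "E (\<lambda>x. u x - v x) (\<lambda>x. u x - v x) = E (\<lambda>x. 0) (\<lambda>x. 0)"
    by (rule AE_self) (use assms in_L2[OF zero] in \<open>auto intro: diff\<close>)
  also have "\<dots> = 0" using scale_left[OF zero zero, of 0] by simp
  finally show ?thesis .
qed

end

section \<open>The L2 inner product and the form norm as symmetric forms\<close>

lemma L2_integrable_mult:
  assumes "u \<in> L2 M" "v \<in> L2 M"
  shows "integrable M (\<lambda>x. u x * v x)"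
proof (rule Bochner_Integration.integrable_bound)
  show "integrable M (\<lambda>x. (u x)\<^sup>2 + (v x)\<^sup>2)"
    and "(\<lambda>x. u x * v x) \<in> borel_measurable M"
    using assms unfolding L2_def by auto
  have "\<bar>a * b\<bar> \<le> a\<^sup>2 + b\<^sup>2" for a b :: real
  proof -
    have "2 * \<bar>a * b\<bar> \<le> a\<^sup>2 + b\<^sup>2"
      using sum_squares_bound[of "\<bar>a\<bar>" "\<bar>b\<bar>"] by (simp add: abs_mult mult.assoc)
    then show ?thesis by linarith
  qed
  then show "AE x in M. norm (u x * v x) \<le> norm ((u x)\<^sup>2 + (v x)\<^sup>2)" by simp
qed

lemma L2_zero: "(\<lambda>x. 0) \<in> L2 M"
  and L2_scale: "u \<in> L2 M \<Longrightarrow> (\<lambda>x. c * u x) \<in> L2 M"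
  by (auto simp: L2_def power_mult_distrib)

lemma L2_add:
  assumes "u \<in> L2 M" "v \<in> L2 M"
  shows "(\<lambda>x. u x + v x) \<in> L2 M"
proof -
  have "integrable M (\<lambda>x. (u x)\<^sup>2 + 2 * (u x * v x) + (v x)\<^sup>2)"
    using L2_integrable_mult[OF assms] assms by (auto simp: L2_def)
  then show ?thesis using assms by (auto simp: L2_def power2_sum ac_simps)
qed

lemma (in finite_measure) L2_bounded:
  assumes "u \<in> borel_measurable M" "\<And>x. x \<in> space M \<Longrightarrow> \<bar>u x\<bar> \<le> K"
  shows "u \<in> L2 M"
proof -
  have "(u x)\<^sup>2 \<le> K\<^sup>2" if "x \<in> space M" for x
    using assms(2)[OF that] by (metis abs_ge_zero power2_abs power_mono)
  then have "integrable M (\<lambda>x. (u x)\<^sup>2)"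
    by (intro integrable_const_bound[where B = "K\<^sup>2"]) (use assms in auto)
  then show ?thesis using assms by (simp add: L2_def)
qed

lemma L2_diff: "u \<in> L2 M \<Longrightarrow> v \<in> L2 M \<Longrightarrow> (\<lambda>x. u x - v x) \<in> L2 M"
  using L2_add[OF _ L2_scale[of v M "-1"]] by simp

text \<open>With this, every inequality proved for \<open>sym_form\<close> holds for the form norm
  as well, and, starting from the zero form, for the plain L2 norm.\<close>

lemma symmetric_form_add_L2:
  assumes "symmetric_form M D E"
  shows "symmetric_form M D (\<lambda>u v. E u v + (\<integral>x. u x * v x \<partial>M))"
proof -
  interpret sym_form M D E by unfold_locales (rule assms)
  note i = L2_integrable_mult[OF in_L2 in_L2]
  have cong: "(\<integral>x. u x * w x \<partial>M) = (\<integral>x. v x * w x \<partial>M)"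
    if "u \<in> D" "v \<in> L2 M" "AE x in M. u x = v x" "w \<in> D" for u v w
    using that in_L2[of u] in_L2[of w] by (intro integral_cong_AE) (auto simp: L2_def)
  show ?thesis
    unfolding symmetric_form_def
  proof (intro conjI ballI allI impI)
    fix u v w assume "u \<in> D" "v \<in> D" "w \<in> D"
    then show "E (\<lambda>x. u x + v x) w + (\<integral>x. (u x + v x) * w x \<partial>M)
      = E u w + (\<integral>x. u x * w x \<partial>M) + (E v w + (\<integral>x. v x * w x \<partial>M))"
      by (simp add: add_left distrib_right i)
  next
    fix c u w assume "u \<in> D" "w \<in> D"
    then show "E (\<lambda>x. c * u x) w + (\<integral>x. c * u x * w x \<partial>M) = c * (E u w + (\<integral>x. u x * w x \<partial>M))"
      by (simp add: scale_left mult.assoc algebra_simps)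
  next
    fix u v assume "u \<in> D" "v \<in> D"
    then show "E u v + (\<integral>x. u x * v x \<partial>M) = E v u + (\<integral>x. v x * u x \<partial>M)"
      by (simp add: sym mult.commute)
  next
    fix u assume "u \<in> D"
    then show "0 \<le> E u u + (\<integral>x. u x * u x \<partial>M)" by (simp add: nonneg)
  next
    fix u v assume "u \<in> D" "v \<in> L2 M" "AE x in M. u x = v x"
    then show "v \<in> D" by (rule AE_closed)
  next
    fix u v w assume "u \<in> D" "v \<in> L2 M" "AE x in M. u x = v x" "w \<in> D"
    then show "E u w + (\<integral>x. u x * w x \<partial>M) = E v w + (\<integral>x. v x * w x \<partial>M)"
      using AE_left cong by simp
  qed (use in_L2 in \<open>auto intro: zero add scale\<close>)
qed

lemma symmetric_form_L2: "symmetric_form M (L2 M) (\<lambda>u v. \<integral>x. u x * v x \<partial>M)"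
proof -
  have "symmetric_form M (L2 M) (\<lambda>u v. 0)"
    by (auto simp: symmetric_form_def L2_zero L2_add L2_scale)
  from symmetric_form_add_L2[OF this] show ?thesis by simp
qed

lemma L2norm_sq: "(L2norm M u)\<^sup>2 = (\<integral>x. (u x)\<^sup>2 \<partial>M)"
  and L2norm_nonneg: "0 \<le> L2norm M u"
  by (auto simp: L2norm_def)

interpretation L2: sym_form M "L2 M" "\<lambda>u v. \<integral>x. u x * v x \<partial>M" for M
  by unfold_locales (rule symmetric_form_L2)

lemma L2norm_eq: "L2norm M u = sqrt (\<integral>x. u x * u x \<partial>M)"
  by (simp add: L2norm_def power2_eq_square)

lemma L2_Cauchy_Schwarz:
  "u \<in> L2 M \<Longrightarrow> v \<in> L2 M \<Longrightarrow> \<bar>\<integral>x. u x * v x \<partial>M\<bar> \<le> L2norm M u * L2norm M v"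
  unfolding L2norm_eq by (rule L2.Cauchy_Schwarz)

lemma L2norm_triangle_diff:
  "u \<in> L2 M \<Longrightarrow> v \<in> L2 M \<Longrightarrow> \<bar>L2norm M u - L2norm M v\<bar> \<le> L2norm M (\<lambda>x. u x - v x)"
  unfolding L2norm_eq by (rule L2.triangle_diff)

lemma L2norm_triangle_minus:
  "u \<in> L2 M \<Longrightarrow> v \<in> L2 M \<Longrightarrow> L2norm M (\<lambda>x. u x - v x) \<le> L2norm M u + L2norm M v"
  unfolding L2norm_eq using L2.diff_triangle[of u M "\<lambda>x. 0" v] L2_zero[of M] by simp

context sym_form
begin

interpretation E1: sym_form M D "\<lambda>u v. E u v + (\<integral>x. u x * v x \<partial>M)"
  by unfold_locales (rule symmetric_form_add_L2[OF form])

lemma form_norm_sq_eq: "form_norm_sq M E u = E u u + (\<integral>x. u x * u x \<partial>M)"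
  by (simp add: form_norm_sq_def power2_eq_square)

lemma form_norm_nonneg: "u \<in> D \<Longrightarrow> 0 \<le> form_norm_sq M E u"
  unfolding form_norm_sq_eq by (rule E1.nonneg)

lemma form_norm_triangle: "u \<in> D \<Longrightarrow> v \<in> D \<Longrightarrow>
    sqrt (form_norm_sq M E (\<lambda>x. u x + v x)) \<le> sqrt (form_norm_sq M E u) + sqrt (form_norm_sq M E v)"
  unfolding form_norm_sq_eq by (rule E1.triangle)

lemma form_norm_diff_triangle: "u \<in> D \<Longrightarrow> v \<in> D \<Longrightarrow> w \<in> D \<Longrightarrow>
    sqrt (form_norm_sq M E (\<lambda>x. u x - w x))
      \<le> sqrt (form_norm_sq M E (\<lambda>x. u x - v x)) + sqrt (form_norm_sq M E (\<lambda>x. v x - w x))"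
  unfolding form_norm_sq_eq by (rule E1.diff_triangle)

lemma form_norm_AE: "u \<in> D \<Longrightarrow> v \<in> L2 M \<Longrightarrow> AE x in M. u x = v x \<Longrightarrow> form_norm_sq M E u = form_norm_sq M E v"
  unfolding form_norm_sq_eq by (rule E1.AE_self)

lemma form_norm_AE_diff: "u \<in> D \<Longrightarrow> v \<in> D \<Longrightarrow> AE x in M. u x = v x \<Longrightarrow>
    form_norm_sq M E (\<lambda>x. u x - v x) = 0"
  unfolding form_norm_sq_eq by (rule E1.AE_diff_self)

lemma form_norm_scale: "u \<in> D \<Longrightarrow> form_norm_sq M E (\<lambda>x. c * u x) = c\<^sup>2 * form_norm_sq M E u"
  unfolding form_norm_sq_eq using E1.quadratic[of u u c 0] by simp

lemma form_norm_ge: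
  assumes "u \<in> D"
  shows "E u u \<le> form_norm_sq M E u" "(\<integral>x. (u x)\<^sup>2 \<partial>M) \<le> form_norm_sq M E u"
  using nonneg[OF assms] by (auto simp: form_norm_sq_def)

lemma form_norm_parallelogram:
  assumes "u \<in> D" "v \<in> D"
  shows "form_norm_sq M E (\<lambda>x. u x - v x)
    = 2 * form_norm_sq M E u + 2 * form_norm_sq M E v - 4 * form_norm_sq M E (\<lambda>x. 1 / 2 * u x + 1 / 2 * v x)"
proof -
  have "form_norm_sq M E (\<lambda>x. 1 / 2 * u x + 1 / 2 * v x)
      = 1 / 4 * form_norm_sq M E u + 1 / 2 * (E u v + (\<integral>x. u x * v x \<partial>M)) + 1 / 4 * form_norm_sq M E v"
    unfolding form_norm_sq_eq by (rule trans[OF E1.quadratic[OF assms]]) (simp add: power2_eq_square)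
  moreover have "form_norm_sq M E (\<lambda>x. u x - v x)
      = form_norm_sq M E u - 2 * (E u v + (\<integral>x. u x * v x \<partial>M)) + form_norm_sq M E v"
    unfolding form_norm_sq_eq by (rule E1.diff_self[OF assms])
  ultimately show ?thesis by linarith
qed

text \<open>The form norm dominates both the energy and the L2 norm of the difference; the reverse
  triangle inequality for the square root of the energy does the rest.\<close>

lemma form_tendsto:
  assumes y: "\<And>k. y k \<in> D" and w: "w \<in> D"
    and lim: "(\<lambda>k. form_norm_sq M E (\<lambda>x. y k x - w x)) \<longlonglongrightarrow> 0"
  shows "(\<lambda>k. E (y k) (y k)) \<longlonglongrightarrow> E w w" and "(\<lambda>k. L2norm M (\<lambda>x. y k x - w x)) \<longlonglongrightarrow> 0"
proof -
  have d: "(\<lambda>x. y k x - w x) \<in> D" for k by (rule diff[OF y w])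
  have "(\<lambda>k. sqrt (form_norm_sq M E (\<lambda>x. y k x - w x))) \<longlonglongrightarrow> sqrt 0"
    by (rule tendsto_real_sqrt[OF lim])
  then have s: "(\<lambda>k. sqrt (form_norm_sq M E (\<lambda>x. y k x - w x))) \<longlonglongrightarrow> 0" by simp
  have "\<bar>sqrt (E (y k) (y k)) - sqrt (E w w)\<bar> \<le> sqrt (form_norm_sq M E (\<lambda>x. y k x - w x))" for k
    using triangle_diff[OF y w] form_norm_ge(1)[OF d] real_sqrt_le_mono order_trans by blast
  then have "(\<lambda>k. sqrt (E (y k) (y k)) - sqrt (E w w)) \<longlonglongrightarrow> 0"
    by (intro Lim_null_comparison[OF _ s]) simp
  then have "(\<lambda>k. (sqrt (E (y k) (y k)))\<^sup>2) \<longlonglongrightarrow> (sqrt (E w w))\<^sup>2"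
    by (rule tendsto_power[OF LIM_zero_cancel])
  then show "(\<lambda>k. E (y k) (y k)) \<longlonglongrightarrow> E w w" by (simp add: nonneg y w)
  show "(\<lambda>k. L2norm M (\<lambda>x. y k x - w x)) \<longlonglongrightarrow> 0"
    by (rule Lim_null_comparison[OF _ s])
       (auto simp: L2norm_def intro!: always_eventually form_norm_ge(2) d)
qed

end

text \<open>Minimality can be exploited only against another closed form. The closure of
  \<open>S\<close> in the form norm, taken inside \<open>D\<close> and with \<open>E\<close>
  restricted to it, is closed and still extends the preform, so it must contain all of
  \<open>D\<close>.\<close>

lemma smallest_closed_extension_dense:
  assumes sce: "smallest_closed_extension M B D E"
    and S: "S \<subseteq> D" "(\<lambda>x. 0) \<in> S" "\<And>u v. u \<in> S \<Longrightarrow> v \<in> S \<Longrightarrow> (\<lambda>x. u x + v x) \<in> S"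
      "\<And>u c. u \<in> S \<Longrightarrow> (\<lambda>x. c * u x) \<in> S"
    and pre: "\<And>u v e. B u v e \<Longrightarrow> (\<exists>F\<in>S. AE x in M. u x = F x) \<and> (\<exists>F\<in>S. AE x in M. v x = F x)"
    and u: "u \<in> D" "\<epsilon> > 0"
  shows "\<exists>F\<in>S. form_norm_sq M E (\<lambda>x. u x - F x) < \<epsilon>"
proof -
  have closed: "closed_form M D E" and ext: "extends_preform B D E"
    and least: "\<And>D' E'. closed_form M D' E' \<Longrightarrow> extends_preform B D' E' \<Longrightarrow> D \<subseteq> D'"
    using sce unfolding smallest_closed_extension_def by blast+
  interpret sym_form M D E
    using closed by unfold_locales (simp add: closed_form_def)
  define n where "n v = sqrt (form_norm_sq M E v)" for v
  define D0 where "D0 = {u \<in> D. \<forall>\<epsilon>>0. \<exists>F\<in>S. n (\<lambda>x. u x - F x) < \<epsilon>}"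
  have n_small: "n v < sqrt \<epsilon> \<longleftrightarrow> form_norm_sq M E v < \<epsilon>" for v \<epsilon>
    unfolding n_def by simp
  have D0_D: "D0 \<subseteq> D" unfolding D0_def by blast
  have D0E: "\<exists>F\<in>S. n (\<lambda>x. u x - F x) < \<epsilon>" if "u \<in> D0" "\<epsilon> > 0" for u \<epsilon>
    using that unfolding D0_def by blast
  have S_D: "F \<in> S \<Longrightarrow> F \<in> D" for F using S(1) by blast
  \<comment> \<open>The preform sees functions that merely agree almost everywhere with members of
    \<open>S\<close>; they are at form distance 0 from \<open>S\<close>.\<close>
  have AE_D0: "v \<in> D0" if "v \<in> D" "F \<in> S" "AE x in M. v x = F x" for v F
  proof -
    have "n (\<lambda>x. v x - F x) = 0"
      unfolding n_def using form_norm_AE_diff[OF that(1) S_D[OF that(2)] that(3)] by simp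
    with that show ?thesis unfolding D0_def by (auto intro!: bexI[of _ F])
  qed
  have "closed_form M D0 E"
    unfolding closed_form_def
  proof (intro conjI allI impI)
    show "symmetric_form M D0 E"
      unfolding symmetric_form_def
    proof (intro conjI ballI allI impI)
      show "D0 \<subseteq> L2 M" using D0_D in_L2 by blast
      show "(\<lambda>x. 0) \<in> D0" by (rule AE_D0[OF zero S(2)]) simp
    next
      fix u v assume u: "u \<in> D0" and v: "v \<in> D0"
      show "(\<lambda>x. u x + v x) \<in> D0"
        unfolding D0_def
      proof (intro CollectI conjI allI impI)
        show "(\<lambda>x. u x + v x) \<in> D" using u v D0_D by (auto intro: add)
        fix \<epsilon> :: real assume "\<epsilon> > 0"
        then have "\<epsilon> / 2 > 0" by simp
        obtain F where F: "F \<in> S" "n (\<lambda>x. u x - F x) < \<epsilon> / 2"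
          using D0E[OF u \<open>\<epsilon> / 2 > 0\<close>] by blast
        obtain G where G: "G \<in> S" "n (\<lambda>x. v x - G x) < \<epsilon> / 2"
          using D0E[OF v \<open>\<epsilon> / 2 > 0\<close>] by blast
        have "n (\<lambda>x. (u x - F x) + (v x - G x)) \<le> n (\<lambda>x. u x - F x) + n (\<lambda>x. v x - G x)"
          unfolding n_def by (intro form_norm_triangle diff) (use u v D0_D F G S_D in auto)
        also have "\<dots> < \<epsilon>" using F G by linarith
        finally have "n (\<lambda>x. (u x + v x) - (F x + G x)) < \<epsilon>" by (simp add: algebra_simps)
        then show "\<exists>F\<in>S. n (\<lambda>x. u x + v x - F x) < \<epsilon>"
          by (rule bexI[OF _ S(3)[OF F(1) G(1)]])
      qed
    next
      fix c u assume u: "u \<in> D0"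
      show "(\<lambda>x. c * u x) \<in> D0"
        unfolding D0_def
      proof (intro CollectI conjI allI impI)
        show "(\<lambda>x. c * u x) \<in> D" using u D0_D by (auto intro: scale)
        fix \<epsilon> :: real assume "\<epsilon> > 0"
        \<comment> \<open>The summand 1 keeps the quotient meaningful for c = 0.\<close>
        then have "\<epsilon> / (\<bar>c\<bar> + 1) > 0" by simp
        then obtain F where F: "F \<in> S" "n (\<lambda>x. u x - F x) < \<epsilon> / (\<bar>c\<bar> + 1)"
          using D0E[OF u] by blast
        have d: "(\<lambda>x. u x - F x) \<in> D" using u D0_D F S_D by (auto intro: diff)
        have "n (\<lambda>x. c * (u x - F x)) = \<bar>c\<bar> * n (\<lambda>x. u x - F x)"
          unfolding n_def form_norm_scale[OF d] by (simp add: real_sqrt_mult)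
        also have "\<dots> \<le> (\<bar>c\<bar> + 1) * n (\<lambda>x. u x - F x)"
          by (intro mult_right_mono) (auto simp: n_def form_norm_nonneg[OF d])
        also have "\<dots> < \<epsilon>" using F by (simp add: pos_less_divide_eq mult.commute)
        finally have "n (\<lambda>x. c * u x - c * F x) < \<epsilon>" by (simp add: algebra_simps)
        then show "\<exists>F\<in>S. n (\<lambda>x. c * u x - F x) < \<epsilon>"
          by (rule bexI[OF _ S(4)[OF F(1)]])
      qed
    next
      fix u v assume u: "u \<in> D0" and v: "v \<in> L2 M" "AE x in M. u x = v x"
      have uD: "u \<in> D" using u D0_D by auto
      have vD: "v \<in> D" by (rule AE_closed[OF uD v])
      have "n (\<lambda>x. u x - F x) = n (\<lambda>x. v x - F x)" if "F \<in> S" for F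
        unfolding n_def using v uD vD S_D[OF that]
        by (subst form_norm_AE) (auto intro: diff in_L2)
      with u vD show "v \<in> D0" unfolding D0_def by auto
    qed (use D0_D in \<open>auto intro: add_left scale_left sym nonneg AE_left\<close>)
  next
    fix w :: "nat \<Rightarrow> 'a \<Rightarrow> real"
    assume w: "(\<forall>n. w n \<in> D0) \<and>
      (\<forall>\<epsilon>>0. \<exists>n0. \<forall>m\<ge>n0. \<forall>n\<ge>n0. form_norm_sq M E (\<lambda>x. w m x - w n x) < \<epsilon>)"
    then have wD: "\<And>k. w k \<in> D" using D0_D by blast
    \<comment> \<open>The limit exists in the larger domain \<open>D\<close>; it lies in
      \<open>D0\<close> because some \<open>w k\<close> is near it and an element of
      \<open>S\<close> is near that \<open>w k\<close>.\<close>
    obtain z where z: "z \<in> D" "(\<lambda>n. form_norm_sq M E (\<lambda>x. w n x - z x)) \<longlonglongrightarrow> 0"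
      using closed w wD unfolding closed_form_def by blast
    have "z \<in> D0"
      unfolding D0_def
    proof (intro CollectI conjI allI impI)
      fix \<epsilon> :: real assume "\<epsilon> > 0"
      have "(\<lambda>k. n (\<lambda>x. w k x - z x)) \<longlonglongrightarrow> 0"
        unfolding n_def using tendsto_real_sqrt[OF z(2)] by simp
      then have "\<forall>\<^sub>F k in sequentially. n (\<lambda>x. w k x - z x) < \<epsilon> / 2"
        by (rule order_tendstoD) (use \<open>\<epsilon> > 0\<close> in simp)
      then obtain k where k: "n (\<lambda>x. w k x - z x) < \<epsilon> / 2"
        by (meson eventually_sequentially order_refl)
      have wk: "w k \<in> D0" using w by blast
      obtain F where F: "F \<in> S" "n (\<lambda>x. w k x - F x) < \<epsilon> / 2"
        using D0E[OF wk half_gt_zero[OF \<open>\<epsilon> > 0\<close>]] by blast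
      have "n (\<lambda>x. z x - F x) \<le> n (\<lambda>x. z x - w k x) + n (\<lambda>x. w k x - F x)"
        unfolding n_def by (intro form_norm_diff_triangle z wD S_D F)
      also have "n (\<lambda>x. z x - w k x) = n (\<lambda>x. w k x - z x)"
        unfolding n_def using form_norm_scale[OF diff[OF wD[of k] z(1)], of "-1"] by simp
      finally show "\<exists>F\<in>S. n (\<lambda>x. z x - F x) < \<epsilon>" using F k by (intro bexI[OF _ F(1)]) linarith
    qed (rule z)
    with z show "\<exists>z\<in>D0. (\<lambda>n. form_norm_sq M E (\<lambda>x. w n x - z x)) \<longlonglongrightarrow> 0" by blast
  qed
  moreover have "extends_preform B D0 E"
    unfolding extends_preform_def
  proof (intro allI impI)
    fix u v e assume B: "B u v e"
    then have "u \<in> D" "v \<in> D" "E u v = e" using ext unfolding extends_preform_def by blast+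
    then show "u \<in> D0 \<and> v \<in> D0 \<and> E u v = e" using pre[OF B] AE_D0 by blast
  qed
  ultimately have "u \<in> D0" using least u by blast
  then have "\<exists>F\<in>S. n (\<lambda>x. u x - F x) < sqrt \<epsilon>" using u unfolding D0_def by simp
  then show ?thesis unfolding n_small .
qed

text \<open>Near-minimisers of \<open>q\<close> on decreasing midpoint-convex sets form a Cauchy sequence; this
  replaces weak compactness together with Mazur's lemma.\<close>

lemma decreasing_sets_Cauchy_selection:
  fixes C :: "nat \<Rightarrow> 'p set" and q :: "'p \<Rightarrow> real"
  assumes dec: "decseq C"
    and bdd: "\<And>k. \<exists>y\<in>C k. q y \<le> K"
    and nonneg: "\<And>y. y \<in> C 0 \<Longrightarrow> 0 \<le> q y"
    and mid: "\<And>k x y. x \<in> C k \<Longrightarrow> y \<in> C k \<Longrightarrow> mid x y \<in> C k"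
    and parallelogram: "\<And>x y. x \<in> C 0 \<Longrightarrow> y \<in> C 0 \<Longrightarrow> d x y = 2 * q x + 2 * q y - 4 * q (mid x y)"
  shows "\<exists>y. (\<forall>k. y k \<in> C k) \<and> (\<forall>\<epsilon>>0. \<exists>n. \<forall>i\<ge>n. \<forall>j\<ge>n. d (y i) (y j) < \<epsilon>)"
proof -
  define m where "m k = Inf (q ` C k)" for k
  have C0: "C k \<subseteq> C 0" for k using dec by (simp add: decseqD)
  have bb: "bdd_below (q ` C k)" for k
    using nonneg C0 by (intro bdd_belowI2[of _ 0]) auto
  have ne: "q ` C k \<noteq> {}" for k using bdd by auto
  have lower: "m k \<le> q y" if "y \<in> C k" for k y
    unfolding m_def using that by (intro cInf_lower bb) auto
  have "incseq m"
    unfolding m_def incseq_def using dec by (auto intro!: cInf_superset_mono[OF ne bb] image_mono dest: decseqD)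
  moreover have "m k \<le> K" for k using lower bdd by (meson order_trans)
  ultimately obtain l where l: "m \<longlonglongrightarrow> l" "\<And>k. m k \<le> l"
    using incseq_convergent[of m K] by blast
  have "\<exists>y\<in>C k. q y < m k + 1 / Suc k" for k
    using cInf_lessD[OF ne, of k "m k + 1 / Suc k"] unfolding m_def by auto
  then obtain y where y: "\<And>k. y k \<in> C k" "\<And>k. q (y k) < m k + 1 / Suc k" by metis
  have "\<exists>n. \<forall>i\<ge>n. \<forall>j\<ge>n. d (y i) (y j) < \<epsilon>" if "\<epsilon> > 0" for \<epsilon>
  proof -
    \<comment> \<open>This is the bound for \<open>d (y i) (y j)\<close> with i, j at least n: both
      values of \<open>q\<close> are at most \<open>l + 1 / Suc n\<close>, and the midpoint, still
      in \<open>C n\<close>, has \<open>q\<close> at least \<open>m n\<close>. Inserting this in the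
      parallelogram identity gives the factor 4 twice.\<close>
    have "(\<lambda>n. 4 * (l - m n) + 4 * (1 / Suc n)) \<longlonglongrightarrow> 4 * (l - l) + 4 * 0"
      by (intro tendsto_intros l) (use LIMSEQ_Suc[OF lim_1_over_n] in simp)
    then have "\<forall>\<^sub>F n in sequentially. 4 * (l - m n) + 4 * (1 / Suc n) < \<epsilon>"
      by (rule order_tendstoD) (use that in simp)
    then obtain n where n: "4 * (l - m n) + 4 * (1 / Suc n) < \<epsilon>"
      by (meson eventually_sequentially order_refl)
    have "d (y i) (y j) < \<epsilon>" if ij: "i \<ge> n" "j \<ge> n" for i j
    proof -
      have q: "q (y i) \<le> l + 1 / Suc n" if "i \<ge> n" for i
      proof -
        have "1 / real (Suc i) \<le> 1 / Suc n" using that by (simp add: frac_le)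
        then show ?thesis using y(2)[of i] l(2)[of i] by linarith
      qed
      have "y i \<in> C n" "y j \<in> C n" using y(1) decseqD[OF dec ij(1)] decseqD[OF dec ij(2)] by blast+
      then have "m n \<le> q (mid (y i) (y j))" and "d (y i) (y j) = 2 * q (y i) + 2 * q (y j) - 4 * q (mid (y i) (y j))"
        using lower mid parallelogram C0 by blast+
      then show ?thesis using q[OF ij(1)] q[OF ij(2)] n by argo
    qed
    then show ?thesis by blast
  qed
  with y(1) show ?thesis by blast
qed

lemma diagonal_index:
  assumes "\<And>k. eventually (R k) sequentially"
  shows "\<exists>\<kappa>::nat \<Rightarrow> nat. filterlim \<kappa> at_top sequentially \<and> (\<forall>N. \<kappa> N = 0 \<or> R (\<kappa> N) N)"
proof -
  define A where "A N = {k. k \<le> N \<and> (k = 0 \<or> R k N)}" for N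
  define \<kappa> where "\<kappa> N = Max (A N)" for N
  have fin: "finite (A N)" for N unfolding A_def by simp
  have "\<kappa> N \<in> A N" for N
    unfolding \<kappa>_def by (rule Max_in[OF fin]) (auto simp: A_def)
  moreover have "filterlim \<kappa> at_top sequentially"
    unfolding filterlim_at_top
  proof
    fix K
    show "\<forall>\<^sub>F N in sequentially. K \<le> \<kappa> N"
      using assms[of K] eventually_ge_at_top[of K]
    proof eventually_elim
      case (elim N)
      then show ?case unfolding \<kappa>_def by (intro Max_ge[OF fin]) (auto simp: A_def)
    qed
  qed
  ultimately show ?thesis unfolding A_def by blast
qed

text \<open>On a finite measure space h is integrable, so \<open>h M\<close> is a finite signed
  measure. It vanishes on closed sets by approximation of their indicators, hence on all Borel sets,
  in particular on the sets where h has a fixed sign. This is what identifies an L2 function from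
  its pairings with test functions.\<close>

lemma AE_0_if_orthogonal_bcontfun:
  fixes M :: "'e::metric_space measure"
  assumes "finite_measure M" and sets: "sets M = sets borel" and h: "h \<in> L2 M"
    and orth: "\<And>\<phi>. \<phi> \<in> bcontfun \<Longrightarrow> (\<integral>x. h x * \<phi> x \<partial>M) = 0"
  shows "AE x in M. h x = 0"
proof -
  interpret finite_measure M by fact
  have sp [simp]: "space M = UNIV" using sets_eq_imp_space_eq[OF sets] by simp
  note [measurable_cong] = sets
  have [measurable]: "h \<in> borel_measurable M" using h by (simp add: L2_def)
  have i: "integrable M h"
    using L2_integrable_mult[OF h L2_bounded[of "\<lambda>_. 1" 1]] by simp
  have stable: "Int_stable {C::'e set. closed C}" "{C::'e set. closed C} \<subseteq> Pow UNIV"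
    by (auto simp: Int_stable_def)
  have si: "set_integrable M A h" if "A \<in> sets borel" for A
    using integrable_mult_indicator[OF _ i, of A] that sets by (simp add: set_integrable_def)
  have zero: "A \<in> sets borel \<and> set_lebesgue_integral M A h = 0" if "A \<in> sets borel" for A
  proof -
    have "sets (borel :: 'e measure) = sigma_sets UNIV {C. closed C}"
      unfolding borel_eq_closed by (rule sets_measure_of) simp
    with that have "A \<in> sigma_sets UNIV {C. closed C}" by (rule back_subst[of "(\<in>) A"])
    then show ?thesis
    proof (rule sigma_sets_induct_disjoint[OF stable, where P = "\<lambda>A. A \<in> sets borel \<and>
        set_lebesgue_integral M A h = 0"], goal_cases)
      case (1 C)
      then have C: "closed C" by simp
      then have [measurable]: "C \<in> sets borel" by simp
      have "set_lebesgue_integral M C h = 0" if ne: "C \<noteq> {}"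
      proof -
        obtain \<phi> :: "nat \<Rightarrow> 'e \<Rightarrow> real" where \<phi>: "\<And>n. \<phi> n \<in> bcontfun" "\<And>n t. \<bar>\<phi> n t\<bar> \<le> 1"
          "\<And>t. (\<lambda>n. \<phi> n t) \<longlonglongrightarrow> indicator C t"
          using indicator_closed_limit[OF C ne] by metis
        have "(\<integral>x. h x * \<phi> n x \<partial>M) = 0" for n by (rule orth[OF \<phi>(1)])
        moreover have [measurable]: "\<phi> n \<in> borel_measurable borel" for n
          using \<phi>(1) by (auto simp: bcontfun_def intro: borel_measurable_continuous_onI)
        have "(\<lambda>n. \<integral>x. h x * \<phi> n x \<partial>M) \<longlonglongrightarrow> (\<integral>x. h x * indicator C x \<partial>M)"
        proof (rule integral_dominated_convergence[where w = "\<lambda>x. \<bar>h x\<bar>"])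
          show "AE x in M. norm (h x * \<phi> n x) \<le> \<bar>h x\<bar>" for n
            using \<phi>(2) by (simp add: abs_mult mult_left_le)
          show "AE x in M. (\<lambda>n. h x * \<phi> n x) \<longlonglongrightarrow> h x * indicator C x"
            by (intro AE_I2 tendsto_intros \<phi>(3))
        qed (use i in auto)
        ultimately have "(\<integral>x. h x * indicator C x \<partial>M) = 0"
          by (simp add: LIMSEQ_const_iff)
        then show ?thesis by (simp add: set_lebesgue_integral_def mult.commute)
      qed
      then show ?case by (cases "C = {}") (auto simp: set_lebesgue_integral_def)
    next
      case 2
      then show ?case by (simp add: set_lebesgue_integral_def)
    next
      case (3 A)
      then have A: "A \<in> sets borel" "set_lebesgue_integral M A h = 0" by auto
      have "(\<integral>x. h x \<partial>M) = 0" using orth[of "\<lambda>_. 1"] by (simp add: const_bcontfun)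
      moreover have "set_lebesgue_integral M (UNIV - A) h = (\<integral>x. h x - indicator A x *\<^sub>R h x \<partial>M)"
        unfolding set_lebesgue_integral_def
        by (intro Bochner_Integration.integral_cong) (auto split: split_indicator)
      ultimately show ?case
        using A i si[OF A(1)] by (auto simp: set_integrable_def set_lebesgue_integral_def)
    next
      case (4 A)
      then have A: "\<And>i. A i \<in> sets borel" "\<And>i. set_lebesgue_integral M (A i) h = 0" by auto
      have "set_lebesgue_integral M (\<Union>i. A i) h = (\<Sum>i. set_lebesgue_integral M (A i) h)"
        by (rule lebesgue_integral_countable_add)
           (use A 4(1) sets in \<open>auto simp: disjoint_family_on_def intro!: si\<close>)
      then show ?case using A by auto
    qed
  qed
  \<comment> \<open>s is the sign of h on A, so that the integrand with vanishing integral is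
    nonnegative.\<close>
  have half: "AE x in M. indicator A x * h x = 0"
    if A: "A \<in> sets borel" and s: "\<And>x. 0 \<le> s * (indicator A x * h x)" and "s \<noteq> 0" for A and s :: real
  proof -
    have "(\<integral>x. s * (indicator A x * h x) \<partial>M) = 0"
      using zero[OF A] by (simp add: set_lebesgue_integral_def)
    moreover have "integrable M (\<lambda>x. s * (indicator A x * h x))"
      using si[OF A] by (simp add: set_integrable_def)
    ultimately have "AE x in M. s * (indicator A x * h x) = 0"
      using s by (subst (asm) integral_nonneg_eq_0_iff_AE) auto
    then show ?thesis using \<open>s \<noteq> 0\<close> by simp
  qed
  have hb: "h \<in> borel_measurable borel" using sets by (simp cong: measurable_cong_sets)
  have "AE x in M. indicator {x. 0 \<le> h x} x * h x = 0"
    by (rule half[where s = 1]) (use hb in \<open>auto split: split_indicator\<close>)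
  moreover have "AE x in M. indicator {x. h x < 0} x * h x = 0"
    by (rule half[where s = "-1"]) (use hb in \<open>auto split: split_indicator\<close>)
  ultimately show ?thesis
    by eventually_elim (auto split: split_indicator_asm)
qed

section \<open>Cylinder functions\<close>

lemma inner_bcontfun:
  fixes G G' :: "'a::topological_space \<Rightarrow> 'b::real_inner"
  assumes "G \<in> bcontfun" "G' \<in> bcontfun"
  shows "(\<lambda>z. inner (G z) (G' z)) \<in> bcontfun"
proof -
  obtain K K' where K: "\<And>x. norm (G x) \<le> K" "\<And>x. norm (G' x) \<le> K'"
    using assms by (auto simp: bcontfun_def bounded_iff)
  have "continuous_on UNIV (\<lambda>z. inner (G z) (G' z))"
    using assms by (auto simp: bcontfun_def intro!: continuous_intros)
  moreover have "\<bar>inner (G z) (G' z)\<bar> \<le> K * K'" for z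
    using order_trans[OF Cauchy_Schwarz_ineq2 mult_mono[OF K(1) K(2)]] norm_ge_zero order_trans[OF norm_ge_zero K(1)]
    by blast
  ultimately show ?thesis by (intro bcontfun_normI[where b = "K * K'"]) auto
qed

lemma mult_bcontfun:
  fixes f g :: "'a::topological_space \<Rightarrow> real"
  shows "f \<in> bcontfun \<Longrightarrow> g \<in> bcontfun \<Longrightarrow> (\<lambda>z. f z * g z) \<in> bcontfun"
  using inner_bcontfun[of f g] by simp

lemma smooth_partial_deriv:
  assumes "g \<in> Cb_infinity m"
  shows "g \<in> bcontfun" and "i < m \<Longrightarrow> partial_deriv i g \<in> bcontfun"
    and "\<And>x y. (\<And>i. i < m \<Longrightarrow> x i = y i) \<Longrightarrow> g x = g y"
    and "\<And>x y. i < m \<Longrightarrow> (\<And>j. j < m \<Longrightarrow> x j = y j) \<Longrightarrow> partial_deriv i g x = partial_deriv i g y"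
proof -
  have *: "set is \<subseteq> {..<m} \<Longrightarrow> foldr partial_deriv is g \<in> bcontfun" for "is"
    using assms unfolding Cb_infinity_def by blast
  show "g \<in> bcontfun" using *[of "[]"] by simp
  show "i < m \<Longrightarrow> partial_deriv i g \<in> bcontfun" using *[of "[i]"] by simp
  show dep: "g x = g y" if "\<And>i. i < m \<Longrightarrow> x i = y i" for x y
    using assms that unfolding Cb_infinity_def by blast
  show "partial_deriv i g x = partial_deriv i g y" if "i < m" "\<And>j. j < m \<Longrightarrow> x j = y j" for x y
  proof -
    have "(\<lambda>t. g (x(i := t))) = (\<lambda>t. g (y(i := t)))"
      by (intro ext dep) (simp add: that)
    then show ?thesis unfolding partial_deriv_def using that by simp
  qed
qed

lemma bcontfun_compose_inner:
  fixes l :: "nat \<Rightarrow> 'e::real_inner" and g :: "(nat \<Rightarrow> real) \<Rightarrow> real"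
  assumes "g \<in> bcontfun"
  shows "(\<lambda>z. g (\<lambda>i. inner (l i) z)) \<in> bcontfun"
proof -
  obtain K where K: "\<And>x. norm (g x) \<le> K" and c: "continuous_on UNIV g"
    using assms by (auto simp: bcontfun_def bounded_iff)
  \<comment> \<open>Sequences carry the product topology, for which continuity is
    coordinatewise.\<close>
  have "continuous_on UNIV (\<lambda>z. \<lambda>i. inner (l i) z)"
    by (intro continuous_on_coordinatewise_then_product continuous_intros)
  then show ?thesis
    by (intro bcontfun_normI[where b = K] K continuous_on_compose2[OF c]) auto
qed

lemma cylinder_bcontfun:
  assumes "cylinder V F G"
  shows "F \<in> bcontfun" "G \<in> bcontfun"
proof -
  obtain m g l where g: "g \<in> Cb_infinity m" and F: "F = (\<lambda>z. g (\<lambda>i. inner (l i) z))"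
    and G: "G = (\<lambda>z. \<Sum>i<m. partial_deriv i g (\<lambda>j. inner (l j) z) *\<^sub>R l i)"
    using assms unfolding cylinder_def by blast
  show "F \<in> bcontfun"
    unfolding F by (intro bcontfun_compose_inner smooth_partial_deriv(1)[OF g])
  have d: "(\<lambda>z. partial_deriv i g (\<lambda>j. inner (l j) z)) \<in> bcontfun" if "i < m" for i
    by (intro bcontfun_compose_inner smooth_partial_deriv(2)[OF g that])
  then have "\<exists>K. \<forall>i\<in>{..<m}. \<forall>z. \<bar>partial_deriv i g (\<lambda>j. inner (l j) z)\<bar> \<le> K i"
    by (intro bchoice) (auto simp: bcontfun_def bounded_iff)
  then obtain K where K: "\<And>i z. i < m \<Longrightarrow> \<bar>partial_deriv i g (\<lambda>j. inner (l j) z)\<bar> \<le> K i" by blast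
  show "G \<in> bcontfun"
    unfolding G
  proof (rule bcontfun_normI)
    show "continuous_on UNIV (\<lambda>z. \<Sum>i<m. partial_deriv i g (\<lambda>j. inner (l j) z) *\<^sub>R l i)"
      using d by (intro continuous_intros) (auto simp: bcontfun_def)
    show "norm (\<Sum>i<m. partial_deriv i g (\<lambda>j. inner (l j) z) *\<^sub>R l i) \<le> (\<Sum>i<m. K i * norm (l i))" for z
      by (intro sum_norm_le) (auto intro: mult_right_mono K)
  qed
qed

section \<open>Orthogonal projections onto subspaces\<close>

locale orthogonal_projection =
  fixes V :: "'e::real_inner set" and P
  assumes subspace: "subspace V" and projection: "is_orthogonal_projection V P"
begin

lemma P_in: "P x \<in> V"
  and orthogonal: "v \<in> V \<Longrightarrow> inner v (x - P x) = 0"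
  using projection unfolding is_orthogonal_projection_def by (auto simp: inner_commute)

text \<open>\<open>is_orthogonal_projection\<close> does not mention linearity; it follows, as does
  \<open>P x = x\<close> on \<open>V\<close>, from uniqueness of the foot point.\<close>

lemma P_unique:
  assumes "y \<in> V" "\<And>v. v \<in> V \<Longrightarrow> inner v (x - y) = 0"
  shows "P x = y"
proof -
  let ?d = "P x - y"
  have "?d \<in> V" using subspace_diff[OF subspace P_in assms(1)] .
  then have "inner ?d ?d = 0"
    using orthogonal[of ?d x] assms(2)[of ?d] by (simp add: inner_diff_right)
  then show ?thesis by simp
qed

lemma P_fixed: "x \<in> V \<Longrightarrow> P x = x"
  by (rule P_unique) auto

lemma inner_P: "v \<in> V \<Longrightarrow> inner v (P x) = inner v x"
  using orthogonal[of v x] by (simp add: inner_diff_right)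

lemma P_adjoint: "inner (P x) y = inner x (P y)"
  using inner_P[OF P_in, of x y] inner_P[OF P_in, of y x] by (simp add: inner_commute)

lemma P_add: "P (x + y) = P x + P y"
  by (rule P_unique) (auto intro: subspace_add[OF subspace] P_in simp: inner_P inner_simps)

lemma P_scale: "P (a *\<^sub>R x) = a *\<^sub>R P x"
  by (rule P_unique) (auto intro: subspace_scale[OF subspace] P_in simp: inner_P inner_simps)

lemma linear_P: "linear P"
  by (rule linearI) (auto simp: P_add P_scale)

lemma norm_P_le: "norm (P x) \<le> norm x"
proof (cases "P x = 0")
  case False
  have "norm (P x) * norm (P x) = inner (P x) x"
    using inner_P[OF P_in, of x x] by (simp flip: power2_norm_eq_inner add: power2_eq_square)
  also have "\<dots> \<le> norm (P x) * norm x" by (rule norm_cauchy_schwarz)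
  finally show ?thesis using False by simp
qed simp

lemma continuous_P: "continuous_on UNIV P"
proof (rule linear_continuous_on)
  show "bounded_linear P"
    by (rule bounded_linear_intro[where K = 1]) (auto simp: P_add P_scale norm_P_le)
qed

text \<open>Pythagoras. The nearest-point property is what turns density of the union of the
  subspaces into convergence of the projections.\<close>

lemma dist_P_le:
  assumes "v \<in> V"
  shows "norm (x - P x) \<le> norm (x - v)"
proof -
  have o: "inner (P x - v) (x - P x) = 0"
    by (rule orthogonal[OF subspace_diff[OF subspace P_in assms]])
  have "(norm (x - v))\<^sup>2 = (norm ((x - P x) + (P x - v)))\<^sup>2" by simp
  also have "\<dots> = (norm (x - P x))\<^sup>2 + (norm (P x - v))\<^sup>2"
    using o unfolding power2_norm_eq_inner by (simp add: inner_simps inner_commute)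
  finally have "(norm (x - P x))\<^sup>2 \<le> (norm (x - v))\<^sup>2" by simp
  then show ?thesis by (rule power2_le_imp_le) simp
qed

end

section \<open>Linear combinations of cylinder functions\<close>

text \<open>The sum of two cylinder functions is again one, but closing up under linear combinations
  avoids merging their coordinate vectors.\<close>

inductive cyl_span :: "'e::real_inner set \<Rightarrow> ('e \<Rightarrow> real) \<Rightarrow> ('e \<Rightarrow> 'e) \<Rightarrow> bool"
  for V where
  cyl: "cylinder V F G \<Longrightarrow> cyl_span V F G"
| add: "cyl_span V F G \<Longrightarrow> cyl_span V F' G' \<Longrightarrow> cyl_span V (\<lambda>z. F z + F' z) (\<lambda>z. G z + G' z)"
| scale: "cyl_span V F G \<Longrightarrow> cyl_span V (\<lambda>z. a * F z) (\<lambda>z. a *\<^sub>R G z)"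

lemma cyl_span_bcontfun:
  assumes "cyl_span V F G"
  shows "F \<in> bcontfun" "G \<in> bcontfun"
proof -
  have "F \<in> bcontfun \<and> G \<in> bcontfun"
    using assms
  proof (induction rule: cyl_span.induct)
    case (scale F G a)
    then show ?case using scaleR_cont[of F a] by (auto intro: scaleR_cont)
  qed (auto intro: plus_cont dest: cylinder_bcontfun)
  then show "F \<in> bcontfun" "G \<in> bcontfun" by auto
qed

lemma cyl_span_diff:
  "cyl_span V F G \<Longrightarrow> cyl_span V F' G' \<Longrightarrow> cyl_span V (\<lambda>z. F z - F' z) (\<lambda>z. G z - G' z)"
  using cyl_span.add[OF _ cyl_span.scale[of V F' G' "-1"]] by simp

lemma cyl_span_zero: "cyl_span V (\<lambda>z. 0) (\<lambda>z. 0)"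
proof (rule cyl_span.cyl)
  show "cylinder V (\<lambda>z. 0) (\<lambda>z. 0)"
    unfolding cylinder_def
    by (rule exI[of _ 0], rule exI[of _ "\<lambda>_. 0"]) (auto simp: Cb_infinity_def const_bcontfun)
qed

lemma cyl_span_mono:
  assumes "V \<subseteq> V'" "cyl_span V F G"
  shows "cyl_span V' F G"
  using assms(2)
proof (induction rule: cyl_span.induct)
  case (cyl F G)
  then have "cylinder V' F G" unfolding cylinder_def using assms(1) by blast
  then show ?case by (rule cyl_span.cyl)
qed (auto intro: cyl_span.intros)

context orthogonal_projection
begin

lemma cyl_span_P:
  assumes "cyl_span V F G"
  shows "F (P z) = F z \<and> G (P z) = G z"
  using assms
proof (induction rule: cyl_span.induct)
  case (cyl F G)
  then obtain m g l where g: "g \<in> Cb_infinity m" and l: "\<And>i. i < m \<Longrightarrow> l i \<in> V"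
    and F: "F = (\<lambda>z. g (\<lambda>i. inner (l i) z))"
    and G: "G = (\<lambda>z. \<Sum>i<m. partial_deriv i g (\<lambda>j. inner (l j) z) *\<^sub>R l i)"
    unfolding cylinder_def by blast
  have "F (P z) = F z" unfolding F by (intro smooth_partial_deriv(3)[OF g] inner_P l)
  moreover have "G (P z) = G z"
    unfolding G by (intro sum.cong arg_cong2[where f = scaleR] refl smooth_partial_deriv(4)[OF g] inner_P l) auto
  ultimately show ?case ..
qed auto

text \<open>Self-adjointness moves P from the argument onto the coordinate vectors, which thereby
  land in \<open>V\<close>. The outer P in the gradient is the chain rule. These compositions are
  the recovery sequence for (M2).\<close>

lemma cyl_span_compose_P:
  assumes "cyl_span UNIV F G"
  shows "cyl_span V (\<lambda>z. F (P z)) (\<lambda>z. P (G (P z)))"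
  using assms
proof (induction rule: cyl_span.induct)
  case (cyl F G)
  then obtain m g l where g: "g \<in> Cb_infinity m"
    and F: "F = (\<lambda>z. g (\<lambda>i. inner (l i) z))"
    and G: "G = (\<lambda>z. \<Sum>i<m. partial_deriv i g (\<lambda>j. inner (l j) z) *\<^sub>R l i)"
    unfolding cylinder_def by blast
  have "cylinder V (\<lambda>z. F (P z)) (\<lambda>z. P (G (P z)))"
    unfolding cylinder_def
    by (rule exI[of _ m], rule exI[of _ g], rule exI[of _ "\<lambda>i. P (l i)"])
       (auto simp: g F G P_in P_adjoint linear_sum[OF linear_P] P_scale)
  then show ?case by (rule cyl_span.cyl)
next
  case (add F G F' G')
  then show ?case using cyl_span.add by (fastforce simp: P_add)
next
  case (scale F G a)
  then show ?case using cyl_span.scale by (fastforce simp: P_scale)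
qed

end

text \<open>The measure may live on a subspace with the trace sigma-algebra.
  \<open>id_measurable\<close> is what makes continuous functions on the whole space measurable for
  it, so that the forms for all \<open>N\<close> and the limit form are treated alike.\<close>

locale cylinder_form = finite_measure M
  for M :: "'e::{real_inner,second_countable_topology} measure" +
  fixes V D E
  assumes id_measurable [measurable]: "(\<lambda>x. x) \<in> M \<rightarrow>\<^sub>M borel"
    and smallest: "smallest_closed_extension M (gradient_preform V M) D E"
begin

lemma closed: "closed_form M D E"
  and extends: "gradient_preform V M u v e \<Longrightarrow> u \<in> D \<and> v \<in> D \<and> E u v = e"
  using smallest unfolding smallest_closed_extension_def extends_preform_def by blast+

sublocale sym_form M D E
  using closed by unfold_locales (simp add: closed_form_def)

lemma bcontfun_measurable: "F \<in> bcontfun \<Longrightarrow> F \<in> borel_measurable M"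
  unfolding bcontfun_def using borel_measurable_continuous_on[OF _ id_measurable, of F] by simp

lemma bcontfun_L2:
  fixes F :: "'e \<Rightarrow> real"
  assumes "F \<in> bcontfun"
  shows "F \<in> L2 M"
proof -
  obtain K where "\<And>x. \<bar>F x\<bar> \<le> K" using assms by (auto simp: bcontfun_def bounded_iff)
  then show ?thesis using bcontfun_measurable[OF assms] by (intro L2_bounded)
qed

lemma integrable_inner_bcontfun:
  fixes G G' :: "'e \<Rightarrow> 'e"
  assumes "G \<in> bcontfun" "G' \<in> bcontfun"
  shows "integrable M (\<lambda>z. inner (G z) (G' z))"
  using L2_integrable_mult[OF bcontfun_L2[OF inner_bcontfun[OF assms]] bcontfun_L2[OF const_bcontfun[of 1]]]
  by simp

lemma cylinder_form_eq:
  assumes "cylinder V F G" "cylinder V F' G'"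
  shows "F \<in> D" "E F F' = (\<integral>z. inner (G z) (G' z) \<partial>M)"
proof -
  have "gradient_preform V M F F' (\<integral>z. inner (G z) (G' z) \<partial>M)"
    unfolding gradient_preform_def
    by (intro conjI exI[of _ F] exI[of _ F'] exI[of _ G] exI[of _ G'] assms bcontfun_L2 AE_I2 refl
        cylinder_bcontfun[OF assms(1)] cylinder_bcontfun[OF assms(2)])
  from extends[OF this] show "F \<in> D" "E F F' = (\<integral>z. inner (G z) (G' z) \<partial>M)" by auto
qed

lemma cyl_span_D: "cyl_span V F G \<Longrightarrow> F \<in> D"
  by (induction rule: cyl_span.induct) (auto intro: cylinder_form_eq add scale)

lemma cyl_span_form:
  assumes "cyl_span V F G" "cyl_span V F' G'"
  shows "E F F' = (\<integral>z. inner (G z) (G' z) \<partial>M)"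
proof -
  \<comment> \<open>The case facts of the inductions below shadow the closure rules of the
    domain.\<close>
  note addD = add and scaleD = scale
  note i = integrable_inner_bcontfun[OF cyl_span_bcontfun(2) cyl_span_bcontfun(2)]
  \<comment> \<open>Bilinearity is used one argument at a time: first the second argument varies
    with a genuine cylinder function in the first, then the first one varies.\<close>
  have *: "E F F' = (\<integral>z. inner (G z) (G' z) \<partial>M)" if "cylinder V F G" "cyl_span V F' G'" for F G F' G'
    using that(2)
  proof (induction rule: cyl_span.induct)
    case (cyl F' G')
    with that(1) show ?case by (rule cylinder_form_eq)
  next
    case (add F1 G1 F2 G2)
    have F: "F \<in> D" "cyl_span V F G" using that(1) cyl_span.cyl cyl_span_D by blast+
    show ?case
      using F add cyl_span_D[OF add(1)] cyl_span_D[OF add(2)]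
      by (simp add: sym[OF F(1)] add_left inner_add_right i addD)
  next
    case (scale F1 G1 a)
    have F: "F \<in> D" using that(1) cyl_span.cyl cyl_span_D by blast
    show ?case
      using F scale cyl_span_D[OF scale(1)] by (simp add: sym[OF F] scale_left scaleD)
  qed
  show ?thesis
    using assms(1)
  proof (induction rule: cyl_span.induct)
    case (cyl F G)
    then show ?case using * assms(2) by blast
  next
    case (add F1 G1 F2 G2)
    then show ?case
      using cyl_span_D[OF add(1)] cyl_span_D[OF add(2)] cyl_span_D[OF assms(2)]
      by (simp add: add_left inner_add_left i[OF _ assms(2)])
  next
    case (scale F1 G1 a)
    then show ?case
      using cyl_span_D[OF scale(1)] cyl_span_D[OF assms(2)] by (simp add: scale_left)
  qed
qed

lemma cyl_span_dense:
  assumes "u \<in> D" "\<epsilon> > 0"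
  shows "\<exists>F G. cyl_span V F G \<and> form_norm_sq M E (\<lambda>x. u x - F x) < \<epsilon>"
proof -
  have "\<exists>F\<in>{F. \<exists>G. cyl_span V F G}. form_norm_sq M E (\<lambda>x. u x - F x) < \<epsilon>"
  proof (rule smallest_closed_extension_dense[OF smallest _ _ _ _ _ assms])
    show "{F. \<exists>G. cyl_span V F G} \<subseteq> D" using cyl_span_D by blast
    show "(\<lambda>x. 0) \<in> {F. \<exists>G. cyl_span V F G}" using cyl_span_zero by blast
    show "(\<lambda>x. u x + v x) \<in> {F. \<exists>G. cyl_span V F G}"
      if "u \<in> {F. \<exists>G. cyl_span V F G}" "v \<in> {F. \<exists>G. cyl_span V F G}" for u v
      using that by (auto intro: cyl_span.add)
    show "(\<lambda>x. c * u x) \<in> {F. \<exists>G. cyl_span V F G}" if "u \<in> {F. \<exists>G. cyl_span V F G}" for u c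
      using that by (auto intro: cyl_span.scale)
    show "(\<exists>F\<in>{F. \<exists>G. cyl_span V F G}. AE x in M. u x = F x) \<and>
        (\<exists>F\<in>{F. \<exists>G. cyl_span V F G}. AE x in M. v x = F x)"
      if "gradient_preform V M u v e" for u v e
      using that cyl_span.cyl unfolding gradient_preform_def by blast
  qed
  then show ?thesis by blast
qed

lemma cyl_span_approx_below:
  assumes u: "u \<in> D" "E u u < b" and "\<delta> > 0"
  shows "\<exists>F G. cyl_span V F G \<and> E F F < b \<and> L2norm M (\<lambda>x. u x - F x) < \<delta>"
proof -
  \<comment> \<open>By the triangle inequality \<open>sqrt (E F F)\<close> exceeds
    \<open>sqrt (E u u)\<close> by less than \<eta>, so the strict bound by b survives; this is why
    the hypothesis on the energy is strict.\<close>
  define \<eta> where "\<eta> = min \<delta> (sqrt b - sqrt (E u u))"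
  have "\<eta> > 0" unfolding \<eta>_def using assms by simp
  obtain F G where F: "cyl_span V F G" and n: "form_norm_sq M E (\<lambda>x. u x - F x) < \<eta>\<^sup>2"
    using cyl_span_dense[OF u(1), of "\<eta>\<^sup>2"] \<open>\<eta> > 0\<close> by auto
  have FD: "F \<in> D" by (rule cyl_span_D[OF F])
  have d: "E (\<lambda>x. u x - F x) (\<lambda>x. u x - F x) < \<eta>\<^sup>2" "(\<integral>x. (u x - F x)\<^sup>2 \<partial>M) < \<eta>\<^sup>2"
    using form_norm_ge[OF diff[OF u(1) FD]] n by auto
  then have s: "sqrt (E (\<lambda>x. u x - F x) (\<lambda>x. u x - F x)) < \<eta>" "L2norm M (\<lambda>x. u x - F x) < \<eta>"
    unfolding L2norm_def using \<open>\<eta> > 0\<close> by (auto intro!: real_less_lsqrt)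
  have "sqrt (E F F) < sqrt b"
    using triangle_diff[OF u(1) FD] s(1) unfolding \<eta>_def by linarith
  then show ?thesis using F s(2) unfolding \<eta>_def by auto
qed

end

section \<open>Projected weighted measures\<close>

text \<open>Measurability refers to the whole space and not to one measure, since the same function
  is integrated against \<mu>, the limit measure and the measures on the subspaces. The class is
  stable under the operations needed, which discharges integrability by introduction rules.\<close>

definition bounded_borel :: "('a::topological_space \<Rightarrow> real) \<Rightarrow> bool" where
  "bounded_borel h \<longleftrightarrow> h \<in> borel_measurable borel \<and> (\<exists>K. \<forall>x. \<bar>h x\<bar> \<le> K)"

lemma bounded_borelI: "h \<in> borel_measurable borel \<Longrightarrow> (\<And>x. \<bar>h x\<bar> \<le> K) \<Longrightarrow> bounded_borel h"
  unfolding bounded_borel_def by blast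

lemma bounded_borel_measurable: "bounded_borel h \<Longrightarrow> h \<in> borel_measurable borel"
  unfolding bounded_borel_def by blast

named_theorems bounded_borel_intros

lemma bounded_borel_bcontfun: "h \<in> bcontfun \<Longrightarrow> bounded_borel h"
  unfolding bounded_borel_def bcontfun_def bounded_iff
  by (auto intro: borel_measurable_continuous_onI)

lemma bounded_borel_const [bounded_borel_intros]: "bounded_borel (\<lambda>x. a)"
  by (rule bounded_borelI[where K = "\<bar>a\<bar>"]) auto

lemma bounded_borel_add [bounded_borel_intros]:
  assumes "bounded_borel f" "bounded_borel g"
  shows "bounded_borel (\<lambda>x. f x + g x)"
proof -
  obtain K K' where K: "\<And>x. \<bar>f x\<bar> \<le> K" "\<And>x. \<bar>g x\<bar> \<le> K'"
    and [measurable]: "f \<in> borel_measurable borel" "g \<in> borel_measurable borel"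
    using assms unfolding bounded_borel_def by blast
  show ?thesis
    by (rule bounded_borelI[where K = "K + K'"])
       (auto intro: order_trans[OF abs_triangle_ineq add_mono[OF K]])
qed

lemma bounded_borel_mult [bounded_borel_intros]:
  assumes "bounded_borel f" "bounded_borel g"
  shows "bounded_borel (\<lambda>x. f x * g x)"
proof -
  obtain K K' where K: "\<And>x. \<bar>f x\<bar> \<le> K" "\<And>x. \<bar>g x\<bar> \<le> K'"
    and [measurable]: "f \<in> borel_measurable borel" "g \<in> borel_measurable borel"
    using assms unfolding bounded_borel_def by blast
  have "\<bar>f x * g x\<bar> \<le> K * K'" for x
    unfolding abs_mult using K(1)[of x] K(2)[of x] by (intro mult_mono) auto
  then show ?thesis by (intro bounded_borelI[where K = "K * K'"]) auto
qed

lemma bounded_borel_diff [bounded_borel_intros]: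
  assumes "bounded_borel f" "bounded_borel g"
  shows "bounded_borel (\<lambda>x. f x - g x)"
  using bounded_borel_add[OF assms(1) bounded_borel_mult[OF bounded_borel_const[of "-1"] assms(2)]] by simp

lemma bounded_borel_power2 [bounded_borel_intros]:
  "bounded_borel f \<Longrightarrow> bounded_borel (\<lambda>x. (f x)\<^sup>2)"
  unfolding power2_eq_square by (rule bounded_borel_mult)

lemma bounded_borel_compose:
  "bounded_borel f \<Longrightarrow> g \<in> borel_measurable borel \<Longrightarrow> bounded_borel (\<lambda>x. f (g x))"
  unfolding bounded_borel_def by (auto intro: measurable_compose)

lemma bounded_borel_L2:
  assumes "finite_measure M" "(\<lambda>x. x) \<in> M \<rightarrow>\<^sub>M borel" "bounded_borel h"
  shows "h \<in> L2 M"
proof -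
  interpret finite_measure M by fact
  obtain K where "\<And>x. \<bar>h x\<bar> \<le> K" "h \<in> borel_measurable borel"
    using assms(3) unfolding bounded_borel_def by blast
  then show ?thesis using measurable_compose[OF assms(2)] by (intro L2_bounded) auto
qed

text \<open>A sequence of norms that is unbounded along the record values is ruled out by testing
  with \<open>u N / (a N * sqrt (m N))\<close>, where \<open>a N\<close> is the norm of \<open>u N\<close> and \<open>m N\<close> its running maximum.\<close>

lemma weakly_converges_bounded:
  fixes M :: "nat \<Rightarrow> 'e::topological_space measure"
  assumes weak: "weakly_converges M Minf u uinf"
    and conv: "converging_L2_spaces M Minf"
    and L2: "\<And>N (\<phi> :: 'e \<Rightarrow> real). \<phi> \<in> bcontfun \<Longrightarrow> \<phi> \<in> L2 (M N)"
  shows "\<exists>K. \<forall>N. L2norm (M N) (u N) \<le> K"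
proof (rule ccontr)
  assume unb: "\<nexists>K. \<forall>N. L2norm (M N) (u N) \<le> K"
  define a where "a N = L2norm (M N) (u N)" for N
  define m where "m N = Max (a ` {..N})" for N
  have a0: "0 \<le> a N" for N unfolding a_def by (rule L2norm_nonneg)
  have am: "a i \<le> m N" if "i \<le> N" for i N unfolding m_def using that by (intro Max_ge) auto
  have ex: "\<exists>N. a N > K" for K using unb unfolding a_def by (meson not_le)
  have m_top: "filterlim m at_top sequentially"
    unfolding filterlim_at_top
  proof
    fix K obtain N where "a N > K" using ex by blast
    then have "K \<le> m n" if "n \<ge> N" for n using am[OF that] by linarith
    then show "\<forall>\<^sub>F N in sequentially. K \<le> m N" by (auto simp: eventually_sequentially)
  qed
  define s where "s N = 1 / (a N * sqrt (m N))" for N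
  define v where "v N x = s N * u N x" for N x
  have u2: "u N \<in> L2 (M N)" for N using weak unfolding weakly_converges_def by blast
  have v2: "v N \<in> L2 (M N)" for N unfolding v_def[abs_def] by (rule L2_scale[OF u2])
  have m0: "0 \<le> m N" for N using order_trans[OF a0 am[OF order_refl]] .
  have normv: "L2norm (M N) (v N) \<le> 1 / sqrt (m N)" for N
  proof -
    have "L2norm (M N) (v N) = \<bar>s N\<bar> * a N"
      unfolding L2norm_def v_def a_def by (simp add: power_mult_distrib real_sqrt_mult)
    also have "\<dots> \<le> 1 / sqrt (m N)"
      \<comment> \<open>If \<open>a N = 0\<close>, division by zero makes \<open>s N = 0\<close> and
        the bound is trivial.\<close>
      unfolding s_def using a0[of N] m0[of N] by (cases "a N = 0") (auto simp: abs_mult)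
    finally show ?thesis .
  qed
  have "filterlim (\<lambda>N. sqrt (m N)) at_top sequentially"
    by (rule filterlim_compose[OF sqrt_at_top m_top])
  then have inv: "(\<lambda>N. 1 / sqrt (m N)) \<longlonglongrightarrow> 0"
    by (intro real_tendsto_divide_at_top[OF tendsto_const])
  have v0: "(\<lambda>N. L2norm (M N) (v N)) \<longlonglongrightarrow> 0"
    by (rule tendsto_sandwich[OF _ _ tendsto_const inv]) (auto simp: normv L2norm_nonneg)
  have "strongly_converges M Minf v (\<lambda>x. 0)"
    unfolding strongly_converges_def
  proof (intro conjI ballI allI)
    fix \<phi> :: "'e \<Rightarrow> real" assume \<phi>: "\<phi> \<in> bcontfun"
    have "(\<lambda>N. L2norm (M N) (v N) * L2norm (M N) \<phi>) \<longlonglongrightarrow> 0 * L2norm Minf \<phi>"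
      using conv \<phi> unfolding converging_L2_spaces_def by (intro tendsto_mult v0) blast
    then have lim: "(\<lambda>N. L2norm (M N) (v N) * L2norm (M N) \<phi>) \<longlonglongrightarrow> 0" by simp
    have "(\<lambda>N. \<integral>z. v N z * \<phi> z \<partial>M N) \<longlonglongrightarrow> 0"
      by (rule Lim_null_comparison[OF _ lim]) (simp add: L2_Cauchy_Schwarz[OF v2 L2[OF \<phi>]])
    then show "(\<lambda>N. \<integral>z. v N z * \<phi> z \<partial>M N) \<longlonglongrightarrow> (\<integral>z. 0 * \<phi> z \<partial>Minf)" by simp
  next
    show "(\<lambda>N. L2norm (M N) (v N)) \<longlonglongrightarrow> L2norm Minf (\<lambda>x. 0)"
      using v0 by (simp add: L2norm_def)
  qed (auto intro: v2 L2_zero)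
  then have "(\<lambda>N. \<integral>z. u N z * v N z \<partial>M N) \<longlonglongrightarrow> (\<integral>z. uinf z * 0 \<partial>Minf)"
    using weak unfolding weakly_converges_def by blast
  moreover have "(\<integral>z. u N z * v N z \<partial>M N) = s N * (a N)\<^sup>2" for N
  proof -
    have "(\<integral>z. u N z * v N z \<partial>M N) = (\<integral>z. s N * (u N z)\<^sup>2 \<partial>M N)"
      unfolding v_def by (simp add: power2_eq_square ac_simps)
    then show ?thesis unfolding a_def L2norm_sq by simp
  qed
  ultimately have "(\<lambda>N. s N * (a N)\<^sup>2) \<longlonglongrightarrow> 0" by simp
  then have "\<forall>\<^sub>F N in sequentially. s N * (a N)\<^sup>2 < 1" by (rule order_tendstoD) simp
  then obtain n0 where n0: "\<And>N. N \<ge> n0 \<Longrightarrow> s N * (a N)\<^sup>2 < 1"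
    by (auto simp: eventually_sequentially)
  \<comment> \<open>N is the first index at which the norms exceed K. Since K is at least
    \<open>m n0\<close>, this index is not below \<open>n0\<close>; being the first, it is a record,
    so \<open>m N = a N\<close> and the pairing equals \<open>sqrt (a N)\<close>. As K is at least
    1, that exceeds 1, against the choice of \<open>n0\<close>.\<close>
  define K where "K = max 1 (m n0)"
  define N where "N = (LEAST N. a N > K)"
  have N: "a N > K" unfolding N_def using ex by (rule LeastI_ex)
  have less: "a i \<le> K" if "i < N" for i using not_less_Least[of i] that unfolding N_def by force
  have "n0 \<le> N" using am[of N n0] N unfolding K_def by fastforce
  have "m N = a N"
    unfolding m_def
  proof (intro Max_eqI)
    fix y assume "y \<in> a ` {..N}"
    then obtain i where "y = a i" "i \<le> N" by blast
    then show "y \<le> a N" using less[of i] N by (cases "i = N") auto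
  qed auto
  moreover have "a N > 1" using N unfolding K_def by simp
  ultimately have "s N * (a N)\<^sup>2 = sqrt (a N)"
    unfolding s_def by (simp add: field_simps power2_eq_square)
  then show False using n0[OF \<open>n0 \<le> N\<close>] \<open>a N > 1\<close> by simp
qed

text \<open>What the convergence proof uses of the density, with \<open>W\<close> in place of
  \<open>exp (- Q)\<close>: two-sided bounds and almost sure convergence along the
  projections.\<close>

locale weighted_projections = prob_space \<mu>
  for \<mu> :: "'e::{real_inner,second_countable_topology} measure" +
  fixes W :: "'e \<Rightarrow> real" and V :: "nat \<Rightarrow> 'e set" and P :: "nat \<Rightarrow> 'e \<Rightarrow> 'e" and c C :: real
  assumes sets_\<mu> [measurable_cong]: "sets \<mu> = sets borel"
    and W_measurable [measurable]: "W \<in> borel_measurable borel"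
    and c_pos: "0 < c" and c_le: "\<And>x. c \<le> W x" and le_C: "\<And>x. W x \<le> C"
    and proj: "\<And>N. orthogonal_projection (V N) (P N)"
    and P_tendsto: "\<And>z. (\<lambda>N. P N z) \<longlonglongrightarrow> z"
    and W_tendsto: "AE z in \<mu>. (\<lambda>N. W (P N z)) \<longlonglongrightarrow> W z"
begin

sublocale proj: orthogonal_projection "V N" "P N" for N
  by (rule proj)

definition MN :: "nat \<Rightarrow> 'e measure" where
  "MN N = density (distr \<mu> (restrict_space borel (V N)) (P N)) (\<lambda>x. ennreal (W x))"

definition Minf :: "'e measure" where
  "Minf = density \<mu> (\<lambda>x. ennreal (W x))"

lemma P_measurable [measurable]: "P N \<in> borel \<rightarrow>\<^sub>M borel"
  by (rule borel_measurable_continuous_onI[OF proj.continuous_P])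

lemma P_measurable_restrict: "P N \<in> \<mu> \<rightarrow>\<^sub>M restrict_space borel (V N)"
  by (rule measurable_restrict_space2) (auto simp: proj.P_in)

lemma W_nonneg: "0 \<le> W x" and W_pos: "0 < W x" and C_pos: "0 < C"
  using c_pos c_le[of x] le_C[of x] by linarith+

lemma bounded_borel_W [bounded_borel_intros]: "bounded_borel W"
  using W_nonneg le_C by (intro bounded_borelI[where K = C]) auto

lemmas bounded_borel_compose_P = bounded_borel_compose[OF _ P_measurable]
  and bounded_borel_W_P [bounded_borel_intros] = bounded_borel_compose[OF bounded_borel_W P_measurable]

lemma restrict_borel: "(\<lambda>x. x) \<in> restrict_space borel (V N) \<rightarrow>\<^sub>M borel"
  by (rule measurable_restrict_space1) simp

lemma id_MN: "(\<lambda>x. x) \<in> MN N \<rightarrow>\<^sub>M borel"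
  using restrict_borel[of N] unfolding MN_def by simp

lemma id_Minf: "(\<lambda>x. x) \<in> Minf \<rightarrow>\<^sub>M borel"
  unfolding Minf_def by simp

lemma sets_Minf: "sets Minf = sets borel"
  unfolding Minf_def by (simp add: sets_\<mu>)

lemma space_MN: "space (MN N) = V N"
  unfolding MN_def by (simp add: space_restrict_space)

text \<open>Change of variables to the fixed measure \<mu>, where the dependence on N is only
  through \<open>P N\<close>.\<close>

lemma integral_MN:
  assumes "h \<in> borel_measurable borel"
  shows "(\<integral>z. h z \<partial>MN N) = (\<integral>z. W (P N z) * h (P N z) \<partial>\<mu>)"
proof -
  have m: "g \<in> borel_measurable (restrict_space borel (V N))" if "g \<in> borel_measurable borel" for g :: "'e \<Rightarrow> real"
    using measurable_compose[OF restrict_borel that] .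
  have "(\<integral>z. h z \<partial>MN N) = (\<integral>z. W z *\<^sub>R h z \<partial>distr \<mu> (restrict_space borel (V N)) (P N))"
    unfolding MN_def
    by (rule integral_density) (use m[OF assms] m[OF W_measurable] W_nonneg in auto)
  also have "\<dots> = (\<integral>z. W (P N z) *\<^sub>R h (P N z) \<partial>\<mu>)"
    by (rule integral_distr[OF P_measurable_restrict]) (rule m, use assms in simp)
  finally show ?thesis by simp
qed

lemma integral_Minf:
  assumes [measurable]: "h \<in> borel_measurable borel"
  shows "(\<integral>z. h z \<partial>Minf) = (\<integral>z. W z * h z \<partial>\<mu>)"
  unfolding Minf_def by (subst integral_density) (auto simp: W_nonneg)

lemma finite_MN: "finite_measure (MN N)"
proof (rule finite_measureI)
  let ?M = "distr \<mu> (restrict_space borel (V N)) (P N)"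
  interpret p: prob_space ?M by (rule prob_space_distr[OF P_measurable_restrict])
  have "W \<in> borel_measurable ?M"
    using measurable_compose[OF restrict_borel W_measurable] by simp
  then have "emeasure (MN N) (space (MN N)) = (\<integral>\<^sup>+x. ennreal (W x) * indicator (space ?M) x \<partial>?M)"
    unfolding MN_def by (subst emeasure_density) auto
  also have "\<dots> \<le> (\<integral>\<^sup>+x. ennreal C \<partial>?M)"
    by (intro nn_integral_mono) (auto split: split_indicator simp: le_C ennreal_leI)
  also have "\<dots> < \<infinity>" using p.emeasure_space_1 by simp
  finally show "emeasure (MN N) (space (MN N)) \<noteq> \<infinity>" by simp
qed

lemma finite_Minf: "finite_measure Minf"
proof (rule finite_measureI)
  have "emeasure Minf (space Minf) = (\<integral>\<^sup>+x. ennreal (W x) * indicator (space \<mu>) x \<partial>\<mu>)"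
    unfolding Minf_def by (subst emeasure_density) auto
  also have "\<dots> \<le> (\<integral>\<^sup>+x. ennreal C \<partial>\<mu>)"
    by (intro nn_integral_mono) (auto split: split_indicator simp: le_C ennreal_leI)
  also have "\<dots> < \<infinity>" using emeasure_space_1 by simp
  finally show "emeasure Minf (space Minf) \<noteq> \<infinity>" by simp
qed

lemmas bounded_borel_L2_MN = bounded_borel_L2[OF finite_MN id_MN]
  and bounded_borel_L2_Minf = bounded_borel_L2[OF finite_Minf id_Minf]

lemma id_\<mu>: "(\<lambda>x. x) \<in> \<mu> \<rightarrow>\<^sub>M borel"
  by simp

lemmas bounded_borel_L2_\<mu> = bounded_borel_L2[OF finite_measure_axioms id_\<mu>]

lemma bounded_borel_integrable:
  assumes "bounded_borel h"
  shows "integrable \<mu> h"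
proof -
  obtain K where "\<And>x. \<bar>h x\<bar> \<le> K" and [measurable]: "h \<in> borel_measurable borel"
    using assms unfolding bounded_borel_def by blast
  then show ?thesis by (intro integrable_const_bound[where B = K]) auto
qed

text \<open>Dominated convergence on \<mu>. The integrand may vary with N so that the gradients of
  composed functions, which contain \<open>P N\<close>, are covered.\<close>

lemma integral_MN_tendsto:
  fixes h :: "nat \<Rightarrow> 'e \<Rightarrow> real" and h' :: "'e \<Rightarrow> real"
  assumes h: "\<And>N. h N \<in> borel_measurable borel" "h' \<in> borel_measurable borel"
    and K: "\<And>N z. \<bar>h N z\<bar> \<le> K" and lim: "\<And>z. (\<lambda>N. h N (P N z)) \<longlonglongrightarrow> h' z"
  shows "(\<lambda>N. \<integral>z. h N z \<partial>MN N) \<longlonglongrightarrow> (\<integral>z. h' z \<partial>Minf)"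
  unfolding integral_MN[OF h(1)] integral_Minf[OF h(2)]
proof (rule integral_dominated_convergence[where w = "\<lambda>_. C * K"])
  note [measurable] = h
  show "(\<lambda>z. W z * h' z) \<in> borel_measurable \<mu>" "(\<lambda>z. W (P N z) * h N (P N z)) \<in> borel_measurable \<mu>" for N
    by measurable
  show "AE z in \<mu>. (\<lambda>N. W (P N z) * h N (P N z)) \<longlonglongrightarrow> W z * h' z"
    using W_tendsto by eventually_elim (intro tendsto_mult lim)
  show "AE z in \<mu>. norm (W (P N z) * h N (P N z)) \<le> C * K" for N
    using W_nonneg le_C K order_trans[OF abs_ge_zero K] C_pos by (auto simp: abs_mult intro!: mult_mono)
qed simp

lemma bcontfun_P_tendsto:
  fixes h :: "'e \<Rightarrow> 'b::metric_space"
  assumes "h \<in> bcontfun"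
  shows "(\<lambda>N. h (P N z)) \<longlonglongrightarrow> h z"
  using assms P_tendsto unfolding bcontfun_def
  by (auto simp: continuous_on_eq_continuous_at intro: isCont_tendsto_compose)

lemma bcontfun_integral_tendsto:
  fixes h :: "'e \<Rightarrow> real"
  assumes h: "h \<in> bcontfun"
  shows "(\<lambda>N. \<integral>z. h z \<partial>MN N) \<longlonglongrightarrow> (\<integral>z. h z \<partial>Minf)"
proof -
  obtain K where "\<And>x. \<bar>h x\<bar> \<le> K" using h by (auto simp: bcontfun_def bounded_iff)
  then show ?thesis
    using bounded_borel_measurable[OF bounded_borel_bcontfun[OF h]] bcontfun_P_tendsto[OF h]
    by (intro integral_MN_tendsto)
qed

lemma bcontfun_norm_tendsto:
  fixes h :: "'e \<Rightarrow> real"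
  assumes h: "h \<in> bcontfun"
  shows "(\<lambda>N. L2norm (MN N) h) \<longlonglongrightarrow> L2norm Minf h"
  unfolding L2norm_def power2_eq_square
  by (intro tendsto_real_sqrt bcontfun_integral_tendsto mult_bcontfun h)

lemma converging: "converging_L2_spaces MN Minf"
  unfolding converging_L2_spaces_def using bcontfun_norm_tendsto by blast

text \<open>A bounded continuous function, restricted to every subspace, converges strongly to
  itself. So it suffices that \<open>u\<close> and \<open>w\<close> are simultaneously close to one
  such function, which does not depend on N.\<close>

lemma strongly_convergesI:
  assumes u: "\<And>N. u N \<in> L2 (MN N)" and w: "w \<in> L2 Minf"
    and approx: "\<And>\<delta>. \<delta> > 0 \<Longrightarrow> \<exists>F\<in>bcontfun. L2norm Minf (\<lambda>z. w z - F z) \<le> \<delta> \<and>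
      (\<forall>\<^sub>F N in sequentially. L2norm (MN N) (\<lambda>z. u N z - F z) \<le> \<delta>)"
  shows "strongly_converges MN Minf u w"
proof -
  have F2: "F \<in> L2 (MN N)" "F \<in> L2 Minf" if "F \<in> bcontfun" for F and N
    using bounded_borel_bcontfun[OF that] bounded_borel_L2_MN bounded_borel_L2_Minf by blast+
  have "(\<lambda>N. \<integral>z. u N z * \<phi> z \<partial>MN N) \<longlonglongrightarrow> (\<integral>z. w z * \<phi> z \<partial>Minf)"
    if \<phi>: "\<phi> \<in> bcontfun" for \<phi>
  proof (rule LIMSEQ_I)
    fix \<epsilon> :: real assume "\<epsilon> > 0"
    \<comment> \<open>B eventually bounds the norms of \<phi> for all the measures at once. With
      \<delta> = \<epsilon> / (4 B) the two Cauchy-Schwarz errors are at most \<epsilon> / 4 each,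
      and the integrals of \<open>F \<phi>\<close> contribute a third such error.\<close>
    define B where "B = L2norm Minf \<phi> + 1"
    have "B > 0" unfolding B_def using L2norm_nonneg[of Minf \<phi>] by linarith
    define \<delta> where "\<delta> = \<epsilon> / (4 * B)"
    have "\<delta> > 0" unfolding \<delta>_def using \<open>\<epsilon> > 0\<close> \<open>B > 0\<close> by simp
    have \<delta>B: "\<delta> * B = \<epsilon> / 4" unfolding \<delta>_def using \<open>B > 0\<close> by simp
    obtain F where F: "F \<in> bcontfun" "L2norm Minf (\<lambda>z. w z - F z) \<le> \<delta>"
      and ev: "\<forall>\<^sub>F N in sequentially. L2norm (MN N) (\<lambda>z. u N z - F z) \<le> \<delta>"
      using approx[OF \<open>\<delta> > 0\<close>] by blast
    have "\<forall>\<^sub>F N in sequentially. L2norm (MN N) \<phi> < B"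
      by (rule order_tendstoD(2)[OF bcontfun_norm_tendsto[OF \<phi>]]) (simp add: B_def)
    moreover have "\<forall>\<^sub>F N in sequentially. \<bar>(\<integral>z. F z * \<phi> z \<partial>MN N) - (\<integral>z. F z * \<phi> z \<partial>Minf)\<bar> < \<epsilon> / 4"
      using tendstoD[OF bcontfun_integral_tendsto[OF mult_bcontfun[OF F(1) \<phi>]], of "\<epsilon> / 4"] \<open>\<epsilon> > 0\<close>
      by (simp add: dist_real_def)
    ultimately have "\<forall>\<^sub>F N in sequentially. norm ((\<integral>z. u N z * \<phi> z \<partial>MN N) - (\<integral>z. w z * \<phi> z \<partial>Minf)) < \<epsilon>"
      using ev
    proof eventually_elim
      case (elim N)
      have "\<bar>\<integral>z. (u N z - F z) * \<phi> z \<partial>MN N\<bar> \<le> L2norm (MN N) (\<lambda>z. u N z - F z) * L2norm (MN N) \<phi>"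
        by (intro L2_Cauchy_Schwarz L2_diff u F2 F \<phi>)
      also have "\<dots> \<le> \<delta> * B" using elim \<open>\<delta> > 0\<close> by (intro mult_mono) (auto simp: L2norm_nonneg)
      finally have 1: "\<bar>\<integral>z. (u N z - F z) * \<phi> z \<partial>MN N\<bar> \<le> \<epsilon> / 4" unfolding \<delta>B .
      have "\<bar>\<integral>z. (w z - F z) * \<phi> z \<partial>Minf\<bar> \<le> L2norm Minf (\<lambda>z. w z - F z) * L2norm Minf \<phi>"
        by (intro L2_Cauchy_Schwarz L2_diff w F2 F \<phi>)
      also have "\<dots> \<le> \<delta> * B" using F(2) \<open>\<delta> > 0\<close> by (intro mult_mono) (auto simp: L2norm_nonneg B_def)
      finally have 2: "\<bar>\<integral>z. (w z - F z) * \<phi> z \<partial>Minf\<bar> \<le> \<epsilon> / 4" unfolding \<delta>B .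
      have "(\<integral>z. (u N z - F z) * \<phi> z \<partial>MN N) = (\<integral>z. u N z * \<phi> z \<partial>MN N) - (\<integral>z. F z * \<phi> z \<partial>MN N)"
        using L2_integrable_mult[OF u F2(1)[OF \<phi>]] L2_integrable_mult[OF F2(1)[OF F(1)] F2(1)[OF \<phi>]]
        by (simp add: left_diff_distrib)
      moreover have "(\<integral>z. (w z - F z) * \<phi> z \<partial>Minf) = (\<integral>z. w z * \<phi> z \<partial>Minf) - (\<integral>z. F z * \<phi> z \<partial>Minf)"
        using L2_integrable_mult[OF w F2(2)[OF \<phi>]] L2_integrable_mult[OF F2(2)[OF F(1)] F2(2)[OF \<phi>]]
        by (simp add: left_diff_distrib)
      ultimately show ?case using 1 2 elim(2) \<open>\<epsilon> > 0\<close> unfolding real_norm_def by linarith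
    qed
    then show "\<exists>n0. \<forall>n\<ge>n0. norm ((\<integral>z. u n z * \<phi> z \<partial>MN n) - (\<integral>z. w z * \<phi> z \<partial>Minf)) < \<epsilon>"
      by (simp add: eventually_sequentially)
  qed
  moreover have "(\<lambda>N. L2norm (MN N) (u N)) \<longlonglongrightarrow> L2norm Minf w"
  proof (rule LIMSEQ_I)
    fix \<epsilon> :: real assume "\<epsilon> > 0"
    then have "\<epsilon> / 4 > 0" by simp
    obtain F where F: "F \<in> bcontfun" "L2norm Minf (\<lambda>z. w z - F z) \<le> \<epsilon> / 4"
      and ev: "\<forall>\<^sub>F N in sequentially. L2norm (MN N) (\<lambda>z. u N z - F z) \<le> \<epsilon> / 4"
      using approx[OF \<open>\<epsilon> / 4 > 0\<close>] by blast
    have "\<forall>\<^sub>F N in sequentially. \<bar>L2norm (MN N) F - L2norm Minf F\<bar> < \<epsilon> / 4"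
      using tendstoD[OF bcontfun_norm_tendsto[OF F(1)] \<open>\<epsilon> / 4 > 0\<close>] by (simp add: dist_real_def)
    with ev have "\<forall>\<^sub>F N in sequentially. norm (L2norm (MN N) (u N) - L2norm Minf w) < \<epsilon>"
    proof eventually_elim
      case (elim N)
      have "\<bar>L2norm (MN N) (u N) - L2norm (MN N) F\<bar> \<le> \<epsilon> / 4"
        using L2norm_triangle_diff[OF u F2(1)[OF F(1)]] elim(1) by (rule order_trans)
      moreover have "\<bar>L2norm Minf w - L2norm Minf F\<bar> \<le> \<epsilon> / 4"
        using L2norm_triangle_diff[OF w F2(2)[OF F(1)]] F(2) by (rule order_trans)
      ultimately show ?case using elim(2) \<open>\<epsilon> > 0\<close> unfolding real_norm_def by linarith
    qed
    then show "\<exists>n0. \<forall>n\<ge>n0. norm (L2norm (MN n) (u n) - L2norm Minf w) < \<epsilon>"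
      by (simp add: eventually_sequentially)
  qed
  ultimately show ?thesis using u w unfolding strongly_converges_def by blast
qed

text \<open>The minimum with \<open>W z\<close> gives \<open>low n \<le> W\<close> everywhere,
  including the null set on which the weights \<open>W (P N z)\<close> fail to converge to
  \<open>W z\<close>.\<close>

definition low :: "nat \<Rightarrow> 'e \<Rightarrow> real" where
  "low n z = min (W z) (INF m. W (P (n + m) z))"

lemma low_le: "low n z \<le> W z"
  unfolding low_def by simp

lemma bdd_below_W: "bdd_below (range (\<lambda>m. W (P (n + m) z)))"
  using c_le by (auto intro!: bdd_belowI2)

lemma low_le_P:
  assumes "n \<le> m"
  shows "low n z \<le> W (P m z)"
proof -
  have "(INF m. W (P (n + m) z)) \<le> W (P (n + (m - n)) z)"
    by (rule cINF_lower[OF bdd_below_W]) simp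
  then show ?thesis unfolding low_def using assms by simp
qed

lemma low_pos: "0 < low n z"
proof -
  have "c \<le> (INF m. W (P (n + m) z))" by (rule cINF_greatest) (auto simp: c_le)
  then show ?thesis unfolding low_def using c_pos W_pos[of z] by simp
qed

lemma low_measurable [measurable]: "low n \<in> borel_measurable borel"
  unfolding low_def[abs_def] by measurable

lemma bounded_borel_low [bounded_borel_intros]: "bounded_borel (low n)"
proof (rule bounded_borelI[where K = C])
  show "\<bar>low n z\<bar> \<le> C" for z using low_pos[of n z] order_trans[OF low_le le_C, of n z] by simp
qed simp

lemma low_tendsto: "AE z in \<mu>. (\<lambda>n. low n z) \<longlonglongrightarrow> W z"
  using W_tendsto
proof eventually_elim
  case (elim z)
  show ?case
  proof (rule LIMSEQ_I)
    fix \<epsilon> :: real assume "\<epsilon> > 0"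
    obtain n0 where n0: "\<And>n. n \<ge> n0 \<Longrightarrow> norm (W (P n z) - W z) < \<epsilon> / 2"
      using LIMSEQ_D[OF elim, of "\<epsilon> / 2"] \<open>\<epsilon> > 0\<close> by auto
    have "norm (low n z - W z) < \<epsilon>" if "n \<ge> n0" for n
    proof -
      have "W z - \<epsilon> / 2 \<le> (INF m. W (P (n + m) z))"
      proof (rule cINF_greatest)
        fix m show "W z - \<epsilon> / 2 \<le> W (P (n + m) z)" using n0[of "n + m"] that unfolding real_norm_def by linarith
      qed simp
      then have "W z - \<epsilon> / 2 \<le> low n z" unfolding low_def using \<open>\<epsilon> > 0\<close> by simp
      then show ?thesis using low_le[of n z] \<open>\<epsilon> > 0\<close> by simp
    qed
    then show "\<exists>n0. \<forall>n\<ge>n0. norm (low n z - W z) < \<epsilon>" by blast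
  qed
qed

end

section \<open>Mosco convergence\<close>

locale projected_forms = weighted_projections \<mu> W V P c C
  for \<mu> :: "'e::{real_inner,second_countable_topology} measure" and W V P c C +
  fixes D :: "nat \<Rightarrow> ('e \<Rightarrow> real) set" and E and Dinf :: "('e \<Rightarrow> real) set" and Einf
  assumes smallest_N: "\<And>N. smallest_closed_extension (MN N) (gradient_preform (V N) (MN N)) (D N) (E N)"
    and smallest_inf: "smallest_closed_extension Minf (gradient_preform UNIV Minf) Dinf Einf"
begin

sublocale N: cylinder_form "MN N" "V N" "D N" "E N" for N
proof -
  interpret finite_measure "MN N" by (rule finite_MN)
  show "cylinder_form (MN N) (V N) (D N) (E N)"
    by unfold_locales (rule id_MN smallest_N)+
qed

sublocale inf: cylinder_form Minf UNIV Dinf Einf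
proof -
  interpret finite_measure Minf by (rule finite_Minf)
  show "cylinder_form Minf UNIV Dinf Einf"
    by unfold_locales (rule id_Minf smallest_inf)+
qed

section \<open>The lower bound (M1)\<close>

lemma compare_integrals:
  assumes h: "bounded_borel h" "\<And>z. 0 \<le> h z" "\<And>z. h (P N z) = h z"
  shows "c * (\<integral>z. h z \<partial>\<mu>) \<le> (\<integral>z. h z \<partial>MN N)"
    and "(\<integral>z. h z \<partial>Minf) \<le> C / c * (\<integral>z. h z \<partial>MN N)"
proof -
  \<comment> \<open>By invariance of h both integrals are \<mu>-integrals of the same function, with
    weights between c and C; this is the source of the factor \<open>C / c\<close>.\<close>
  have N: "(\<integral>z. h z \<partial>MN N) = (\<integral>z. W (P N z) * h z \<partial>\<mu>)"
    using integral_MN[OF bounded_borel_measurable[OF h(1)]] h(3) by simp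
  have "(\<integral>z. c * h z \<partial>\<mu>) \<le> (\<integral>z. h z \<partial>MN N)"
    unfolding N by (intro integral_mono bounded_borel_integrable bounded_borel_intros h mult_right_mono c_le)
  then show *: "c * (\<integral>z. h z \<partial>\<mu>) \<le> (\<integral>z. h z \<partial>MN N)" by simp
  have "(\<integral>z. h z \<partial>Minf) \<le> (\<integral>z. C * h z \<partial>\<mu>)"
    unfolding integral_Minf[OF bounded_borel_measurable[OF h(1)]]
    by (intro integral_mono bounded_borel_integrable bounded_borel_intros h mult_right_mono le_C)
  also have "\<dots> = C / c * (c * (\<integral>z. h z \<partial>\<mu>))" using c_pos by simp
  also have "\<dots> \<le> C / c * (\<integral>z. h z \<partial>MN N)"
    by (intro mult_left_mono *) (use c_pos C_pos in simp)
  finally show "(\<integral>z. h z \<partial>Minf) \<le> C / c * (\<integral>z. h z \<partial>MN N)" .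
qed

lemma cyl_span_bounded_borel:
  assumes "cyl_span U F G"
  shows "bounded_borel F" and "bounded_borel (\<lambda>z. inner (G z) (G z))"
  using cyl_span_bcontfun[OF assms] by (auto intro: bounded_borel_bcontfun inner_bcontfun)

text \<open>Weak convergence speaks of \<open>u (r k)\<close> under the measures
  \<open>MN (r k)\<close>, while the limit form needs \<open>F k\<close> under the single measure
  \<open>Minf\<close>. First \<open>u\<close> is exchanged for its approximant, then the measure is
  changed.\<close>

lemma test_tendsto:
  assumes weak: "weakly_converges MN Minf u uinf" and K: "\<And>N. L2norm (MN N) (u N) \<le> K"
    and r: "strict_mono r" and F: "\<And>k. cyl_span (V (r k)) (F k) (G k)"
    and close: "\<And>k. L2norm (MN (r k)) (\<lambda>x. u (r k) x - F k x) < 1 / Suc k"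
    and \<phi>: "\<phi> \<in> bcontfun"
  shows "(\<lambda>k. \<integral>z. F k z * \<phi> z \<partial>Minf) \<longlonglongrightarrow> (\<integral>z. uinf z * \<phi> z \<partial>Minf)"
proof -
  have u2: "u N \<in> L2 (MN N)" for N using weak unfolding weakly_converges_def by blast
  have F2: "F k \<in> L2 (MN (r k))" for k by (rule N.in_L2[OF N.cyl_span_D[OF F]])
  have \<phi>2: "\<phi> \<in> L2 (MN N)" for N by (rule N.bcontfun_L2[OF \<phi>])
  note Fb = cyl_span_bounded_borel(1)[OF F] and \<phi>b = bounded_borel_bcontfun[OF \<phi>]
  have "strongly_converges MN Minf (\<lambda>N. \<phi>) \<phi>"
    unfolding strongly_converges_def
    using \<phi>2 inf.bcontfun_L2[OF \<phi>] bcontfun_integral_tendsto[OF mult_bcontfun[OF \<phi>]] bcontfun_norm_tendsto[OF \<phi>]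
    by blast
  then have "(\<lambda>N. \<integral>z. u N z * \<phi> z \<partial>MN N) \<longlonglongrightarrow> (\<integral>z. uinf z * \<phi> z \<partial>Minf)"
    using weak unfolding weakly_converges_def by blast
  then have a: "(\<lambda>k. \<integral>z. u (r k) z * \<phi> z \<partial>MN (r k)) \<longlonglongrightarrow> (\<integral>z. uinf z * \<phi> z \<partial>Minf)"
    using LIMSEQ_subseq_LIMSEQ[OF _ r] by (simp add: o_def)
  have "(\<lambda>k. 1 / Suc k * L2norm (MN (r k)) \<phi>) \<longlonglongrightarrow> 0 * L2norm Minf \<phi>"
    using LIMSEQ_subseq_LIMSEQ[OF bcontfun_norm_tendsto[OF \<phi>] r] LIMSEQ_Suc[OF lim_1_over_n]
    by (intro tendsto_mult) (simp_all add: o_def)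
  then have "(\<lambda>k. 1 / Suc k * L2norm (MN (r k)) \<phi>) \<longlonglongrightarrow> 0" by simp
  then have "(\<lambda>k. \<integral>z. (u (r k) z - F k z) * \<phi> z \<partial>MN (r k)) \<longlonglongrightarrow> 0"
  proof (rule Lim_null_comparison[rotated], intro always_eventually allI)
    fix k
    have "norm (\<integral>z. (u (r k) z - F k z) * \<phi> z \<partial>MN (r k))
        \<le> L2norm (MN (r k)) (\<lambda>x. u (r k) x - F k x) * L2norm (MN (r k)) \<phi>"
      unfolding real_norm_def by (intro L2_Cauchy_Schwarz L2_diff u2 F2 \<phi>2)
    also have "\<dots> \<le> 1 / Suc k * L2norm (MN (r k)) \<phi>"
      by (intro mult_right_mono less_imp_le close L2norm_nonneg)
    finally show "norm (\<integral>z. (u (r k) z - F k z) * \<phi> z \<partial>MN (r k)) \<le> 1 / Suc k * L2norm (MN (r k)) \<phi>" .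
  qed
  moreover have "(\<integral>z. (u (r k) z - F k z) * \<phi> z \<partial>MN (r k))
      = (\<integral>z. u (r k) z * \<phi> z \<partial>MN (r k)) - (\<integral>z. F k z * \<phi> z \<partial>MN (r k))" for k
    using L2_integrable_mult[OF u2 \<phi>2] L2_integrable_mult[OF F2 \<phi>2] by (simp add: left_diff_distrib)
  ultimately have b: "(\<lambda>k. \<integral>z. F k z * \<phi> z \<partial>MN (r k)) \<longlonglongrightarrow> (\<integral>z. uinf z * \<phi> z \<partial>Minf)"
    using tendsto_diff[OF a] by fastforce
  \<comment> \<open>Since \<open>F k\<close> is invariant under the projection, the change of
    measure costs exactly the \<mu>-integral of \<open>F k\<close> times \<open>\<psi> k\<close>.
    The first factor is bounded in L2(\<mu>), the second tends to 0 there.\<close>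
  define \<psi> where "\<psi> k z = W (P (r k) z) * \<phi> (P (r k) z) - W z * \<phi> z" for k z
  have \<psi>b: "bounded_borel (\<psi> k)" for k
    unfolding \<psi>_def[abs_def] by (intro bounded_borel_intros \<phi>b bounded_borel_compose_P[OF \<phi>b])
  obtain B where B: "\<And>z. \<bar>\<phi> z\<bar> \<le> B" using \<phi>b unfolding bounded_borel_def by blast
  have "B \<ge> 0" using order_trans[OF abs_ge_zero B] .
  have W\<phi>: "\<bar>W x * \<phi> x\<bar> \<le> C * B" for x
    unfolding abs_mult using W_nonneg le_C B \<open>B \<ge> 0\<close> C_pos by (intro mult_mono) auto
  have "(\<lambda>k. \<integral>z. (\<psi> k z)\<^sup>2 \<partial>\<mu>) \<longlonglongrightarrow> (\<integral>z. 0 \<partial>\<mu>)"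
  proof (rule integral_dominated_convergence[where w = "\<lambda>_. (2 * (C * B))\<^sup>2"])
    show "(\<lambda>z. (\<psi> k z)\<^sup>2) \<in> borel_measurable \<mu>" for k
      by (intro borel_measurable_integrable bounded_borel_integrable bounded_borel_intros \<psi>b)
    have "\<bar>\<psi> k z\<bar> \<le> 2 * (C * B)" for k z
      unfolding \<psi>_def using W\<phi>[of z] W\<phi>[of "P (r k) z"] by linarith
    then show "AE z in \<mu>. norm ((\<psi> k z)\<^sup>2) \<le> (2 * (C * B))\<^sup>2" for k
      by (intro AE_I2) (metis abs_ge_zero norm_power power2_abs power_mono real_norm_def)
    show "AE z in \<mu>. (\<lambda>k. (\<psi> k z)\<^sup>2) \<longlonglongrightarrow> 0"
      using W_tendsto
    proof eventually_elim
      case (elim z)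
      have "(\<lambda>k. W (P k z) * \<phi> (P k z)) \<longlonglongrightarrow> W z * \<phi> z"
        by (intro tendsto_mult elim bcontfun_P_tendsto \<phi>)
      from LIMSEQ_subseq_LIMSEQ[OF this r] have "(\<lambda>k. \<psi> k z) \<longlonglongrightarrow> 0"
        unfolding \<psi>_def by (simp add: o_def LIM_zero)
      then show ?case using tendsto_power[of _ 0 _ 2] by fastforce
    qed
  qed auto
  then have "(\<lambda>k. sqrt (\<integral>z. (\<psi> k z)\<^sup>2 \<partial>\<mu>)) \<longlonglongrightarrow> sqrt 0"
    by (intro tendsto_real_sqrt) simp
  \<comment> \<open>\<open>(K + 1) / sqrt c\<close> will bound the L2(\<mu>) norm of
    \<open>F k\<close>: K comes from u, 1 from the approximation error, and the division from the
    lower bound of the weight.\<close>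
  then have "(\<lambda>k. (K + 1) / sqrt c * L2norm \<mu> (\<psi> k)) \<longlonglongrightarrow> (K + 1) / sqrt c * 0"
    unfolding L2norm_def by (intro tendsto_mult tendsto_const) simp
  then have "(\<lambda>k. (K + 1) / sqrt c * L2norm \<mu> (\<psi> k)) \<longlonglongrightarrow> 0" by simp
  then have "(\<lambda>k. \<integral>z. F k z * \<psi> k z \<partial>\<mu>) \<longlonglongrightarrow> 0"
  proof (rule Lim_null_comparison[rotated], intro always_eventually allI)
    fix k
    have "L2norm (MN (r k)) (F k) \<le> K + 1"
    proof -
      have "1 / real (Suc k) \<le> 1" by simp
      then show ?thesis
        using L2norm_triangle_diff[OF u2 F2, of k] close[of k] K[of "r k"] by linarith
    qed
    then have "(L2norm (MN (r k)) (F k))\<^sup>2 \<le> (K + 1)\<^sup>2" by (intro power_mono L2norm_nonneg)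
    moreover have "c * (\<integral>z. (F k z)\<^sup>2 \<partial>\<mu>) \<le> (L2norm (MN (r k)) (F k))\<^sup>2"
      unfolding L2norm_sq using proj.cyl_span_P[OF F]
      by (intro compare_integrals(1) bounded_borel_intros Fb) auto
    ultimately have "(\<integral>z. (F k z)\<^sup>2 \<partial>\<mu>) \<le> (K + 1)\<^sup>2 / c" using c_pos by (simp add: field_simps)
    then have "L2norm \<mu> (F k) \<le> sqrt ((K + 1)\<^sup>2 / c)" unfolding L2norm_def by simp
    also have "\<dots> = (K + 1) / sqrt c"
      using order_trans[OF L2norm_nonneg K] by (simp add: real_sqrt_divide)
    finally have Fk: "L2norm \<mu> (F k) \<le> (K + 1) / sqrt c" .
    have "\<bar>\<integral>z. F k z * \<psi> k z \<partial>\<mu>\<bar> \<le> L2norm \<mu> (F k) * L2norm \<mu> (\<psi> k)"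
      by (intro L2_Cauchy_Schwarz bounded_borel_L2_\<mu> Fb \<psi>b)
    also have "\<dots> \<le> (K + 1) / sqrt c * L2norm \<mu> (\<psi> k)"
      by (intro mult_right_mono Fk L2norm_nonneg)
    finally show "norm (\<integral>z. F k z * \<psi> k z \<partial>\<mu>) \<le> (K + 1) / sqrt c * L2norm \<mu> (\<psi> k)" by simp
  qed
  moreover have "(\<integral>z. F k z * \<psi> k z \<partial>\<mu>) = (\<integral>z. F k z * \<phi> z \<partial>MN (r k)) - (\<integral>z. F k z * \<phi> z \<partial>Minf)" for k
  proof -
    have m: "(\<lambda>z. F k z * \<phi> z) \<in> borel_measurable borel"
      by (intro bounded_borel_measurable bounded_borel_intros Fb \<phi>b)
    have FP: "F k (P (r k) z) = F k z" for z using proj.cyl_span_P[OF F] by blast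
    have "(\<integral>z. F k z * \<phi> z \<partial>MN (r k)) - (\<integral>z. F k z * \<phi> z \<partial>Minf)
        = (\<integral>z. W (P (r k) z) * (F k z * \<phi> (P (r k) z)) - W z * (F k z * \<phi> z) \<partial>\<mu>)"
      unfolding integral_MN[OF m] integral_Minf[OF m] FP
      by (intro Bochner_Integration.integral_diff[symmetric] bounded_borel_integrable bounded_borel_intros Fb \<phi>b
          bounded_borel_compose_P[OF \<phi>b])
    also have "\<dots> = (\<integral>z. F k z * \<psi> k z \<partial>\<mu>)"
      unfolding \<psi>_def by (simp add: algebra_simps)
    finally show ?thesis by simp
  qed
  ultimately show ?thesis using tendsto_diff[OF b] by fastforce
qed

lemma limit_in_domain:
  assumes F: "\<And>k. cyl_span UNIV (F k) (G k)"
    and energy: "\<And>k n. n \<le> k \<Longrightarrow> (\<integral>z. low n z * inner (G k z) (G k z) \<partial>\<mu>) \<le> b"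
    and K: "\<And>k. form_norm_sq Minf Einf (F k) \<le> K"
    and test: "\<And>\<phi>. \<phi> \<in> bcontfun \<Longrightarrow> (\<lambda>k. \<integral>z. F k z * \<phi> z \<partial>Minf) \<longlonglongrightarrow> (\<integral>z. u z * \<phi> z \<partial>Minf)"
    and u: "u \<in> L2 Minf"
  shows "u \<in> Dinf" and "Einf u u \<le> b"
proof -
  define T where "T h \<phi> = (\<integral>z. h z * \<phi> z \<partial>Minf)" for h \<phi> :: "'e \<Rightarrow> real"
  \<comment> \<open>\<open>A k\<close> retains what the tail of the sequence from index k on has in
    common and what midpoints inherit: the energy bounds, convex in the gradient, and every estimate
    of the pairing error that holds along the whole tail. Pairs are used because the energy with
    weight \<open>low n\<close> is expressed by the gradient.\<close>
  define A where "A k = {p. cyl_span UNIV (fst p) (snd p) \<and>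
    (\<forall>n\<le>k. (\<integral>z. low n z * inner (snd p z) (snd p z) \<partial>\<mu>) \<le> b) \<and>
    (\<forall>\<phi>\<in>bcontfun. \<forall>\<epsilon>. (\<forall>j\<ge>k. \<bar>T (F j) \<phi> - T u \<phi>\<bar> \<le> \<epsilon>) \<longrightarrow> \<bar>T (fst p) \<phi> - T u \<phi>\<bar> \<le> \<epsilon>)}" for k
  define mid :: "('e \<Rightarrow> real) \<times> ('e \<Rightarrow> 'e) \<Rightarrow> ('e \<Rightarrow> real) \<times> ('e \<Rightarrow> 'e) \<Rightarrow> ('e \<Rightarrow> real) \<times> ('e \<Rightarrow> 'e)"
    where "mid p p' = (\<lambda>z. 1 / 2 * fst p z + 1 / 2 * fst p' z, \<lambda>z. (1 / 2) *\<^sub>R snd p z + (1 / 2) *\<^sub>R snd p' z)" for p p'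
  have A_span: "cyl_span UNIV (fst p) (snd p)" if "p \<in> A k" for p k using that unfolding A_def by blast
  have A_D: "fst p \<in> Dinf" if "p \<in> A k" for p k by (rule inf.cyl_span_D[OF A_span[OF that]])
  have "\<exists>y. (\<forall>k. y k \<in> A k) \<and>
      (\<forall>\<epsilon>>0. \<exists>n. \<forall>i\<ge>n. \<forall>j\<ge>n. form_norm_sq Minf Einf (\<lambda>x. fst (y i) x - fst (y j) x) < \<epsilon>)"
  proof (rule decreasing_sets_Cauchy_selection[where q = "\<lambda>p. form_norm_sq Minf Einf (fst p)" and mid = mid and K = K])
    show "decseq A"
      unfolding decseq_def
    proof (intro allI impI subsetI)
      fix k k' p assume "k \<le> k'" and p: "p \<in> A k'"
      show "p \<in> A k"
        unfolding A_def
      proof (intro CollectI conjI allI impI ballI)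
        show "cyl_span UNIV (fst p) (snd p)" by (rule A_span[OF p])
        show "(\<integral>z. low n z * inner (snd p z) (snd p z) \<partial>\<mu>) \<le> b" if "n \<le> k" for n
          using p that \<open>k \<le> k'\<close> unfolding A_def by auto
        show "\<bar>T (fst p) \<phi> - T u \<phi>\<bar> \<le> \<epsilon>"
          if "\<phi> \<in> bcontfun" "\<forall>j\<ge>k. \<bar>T (F j) \<phi> - T u \<phi>\<bar> \<le> \<epsilon>" for \<phi> \<epsilon>
          using p that \<open>k \<le> k'\<close> unfolding A_def by auto
      qed
    qed
    show "\<exists>p\<in>A k. form_norm_sq Minf Einf (fst p) \<le> K" for k
      by (rule bexI[of _ "(F k, G k)"]) (auto simp: A_def F K energy)
    show "0 \<le> form_norm_sq Minf Einf (fst p)" if "p \<in> A 0" for p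
      by (rule inf.form_norm_nonneg[OF A_D[OF that]])
    show "form_norm_sq Minf Einf (\<lambda>x. fst p x - fst p' x) = 2 * form_norm_sq Minf Einf (fst p)
        + 2 * form_norm_sq Minf Einf (fst p') - 4 * form_norm_sq Minf Einf (fst (mid p p'))"
      if "p \<in> A 0" "p' \<in> A 0" for p p'
      unfolding mid_def fst_conv by (rule inf.form_norm_parallelogram[OF A_D A_D]) (rule that)+
    show "mid p p' \<in> A k" if p: "p \<in> A k" and p': "p' \<in> A k" for k p p'
      unfolding A_def
    proof (intro CollectI conjI allI impI ballI)
      show "cyl_span UNIV (fst (mid p p')) (snd (mid p p'))"
        unfolding mid_def fst_conv snd_conv
        by (intro cyl_span.add cyl_span.scale A_span[OF p] A_span[OF p'])
      fix n assume "n \<le> k"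
      let ?G = "snd p" and ?G' = "snd p'"
      have bb: "bounded_borel (\<lambda>z. inner (?G z) (?G z))" "bounded_borel (\<lambda>z. inner (?G' z) (?G' z))"
        "bounded_borel (\<lambda>z. inner (snd (mid p p') z) (snd (mid p p') z))"
        using cyl_span_bounded_borel(2) A_span[OF p] A_span[OF p']
          \<open>cyl_span UNIV (fst (mid p p')) (snd (mid p p'))\<close> by blast+
      \<comment> \<open>Convexity of the squared norm; the gap is a quarter of the squared norm of a
        - d.\<close>
      have conv: "inner ((1/2) *\<^sub>R a + (1/2) *\<^sub>R d) ((1/2) *\<^sub>R a + (1/2) *\<^sub>R d) \<le> 1/2 * inner a a + 1/2 * inner d d"
        for a d :: 'e
        using inner_ge_zero[of "a - d"] by (simp add: inner_simps inner_commute)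
      have "(\<integral>z. low n z * inner (snd (mid p p') z) (snd (mid p p') z) \<partial>\<mu>)
          \<le> (\<integral>z. 1/2 * (low n z * inner (?G z) (?G z)) + 1/2 * (low n z * inner (?G' z) (?G' z)) \<partial>\<mu>)"
      proof (rule integral_mono)
        fix z
        have "low n z * inner (snd (mid p p') z) (snd (mid p p') z)
            \<le> low n z * (1/2 * inner (?G z) (?G z) + 1/2 * inner (?G' z) (?G' z))"
          using conv low_pos[of n z] unfolding mid_def snd_conv by (intro mult_left_mono) auto
        then show "low n z * inner (snd (mid p p') z) (snd (mid p p') z)
            \<le> 1/2 * (low n z * inner (?G z) (?G z)) + 1/2 * (low n z * inner (?G' z) (?G' z))"
          by (simp add: algebra_simps)
      qed (intro bounded_borel_integrable bounded_borel_intros bb)+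
      also have "\<dots> = 1/2 * (\<integral>z. low n z * inner (?G z) (?G z) \<partial>\<mu>) + 1/2 * (\<integral>z. low n z * inner (?G' z) (?G' z) \<partial>\<mu>)"
        by (subst Bochner_Integration.integral_add)
           ((intro bounded_borel_integrable bounded_borel_intros bb)+, simp)
      also have "\<dots> \<le> 1/2 * b + 1/2 * b"
        using p p' \<open>n \<le> k\<close> unfolding A_def by (intro add_mono mult_left_mono) auto
      finally show "(\<integral>z. low n z * inner (snd (mid p p') z) (snd (mid p p') z) \<partial>\<mu>) \<le> b" by simp
    next
      fix \<phi> :: "'e \<Rightarrow> real" and \<epsilon> assume \<phi>: "\<phi> \<in> bcontfun" and "\<forall>j\<ge>k. \<bar>T (F j) \<phi> - T u \<phi>\<bar> \<le> \<epsilon>"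
      then have t: "\<bar>T (fst p) \<phi> - T u \<phi>\<bar> \<le> \<epsilon>" "\<bar>T (fst p') \<phi> - T u \<phi>\<bar> \<le> \<epsilon>"
        using p p' unfolding A_def by blast+
      have i: "integrable Minf (\<lambda>z. fst p z * \<phi> z)" "integrable Minf (\<lambda>z. fst p' z * \<phi> z)"
        using L2_integrable_mult[OF inf.in_L2 inf.bcontfun_L2[OF \<phi>]] A_D[OF p] A_D[OF p'] by blast+
      have "T (fst (mid p p')) \<phi> = (\<integral>z. 1 / 2 * (fst p z * \<phi> z) + 1 / 2 * (fst p' z * \<phi> z) \<partial>Minf)"
        unfolding T_def mid_def fst_conv by (simp add: algebra_simps)
      also have "\<dots> = 1 / 2 * T (fst p) \<phi> + 1 / 2 * T (fst p') \<phi>"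
        unfolding T_def using i by simp
      finally show "\<bar>T (fst (mid p p')) \<phi> - T u \<phi>\<bar> \<le> \<epsilon>" using t by linarith
    qed
  qed
  then obtain y where y: "\<And>k. y k \<in> A k"
    and Cauchy: "\<And>\<epsilon>. \<epsilon> > 0 \<Longrightarrow> \<exists>n. \<forall>i\<ge>n. \<forall>j\<ge>n. form_norm_sq Minf Einf (\<lambda>x. fst (y i) x - fst (y j) x) < \<epsilon>"
    by blast
  have yD: "fst (y k) \<in> Dinf" for k by (rule A_D[OF y])
  obtain w where w: "w \<in> Dinf"
    and lim: "(\<lambda>k. form_norm_sq Minf Einf (\<lambda>x. fst (y k) x - w x)) \<longlonglongrightarrow> 0"
    using inf.closed yD Cauchy unfolding closed_form_def by (elim conjE allE[of _ "\<lambda>k. fst (y k)"]) blast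
  note E_lim = inf.form_tendsto(1)[OF yD w lim] and L2_lim = inf.form_tendsto(2)[OF yD w lim]
  \<comment> \<open>The form limit w of the selected sequence is the weak limit u, as both have the
    same pairing with every bounded continuous function.\<close>
  have "AE x in Minf. u x - w x = 0"
  proof (rule AE_0_if_orthogonal_bcontfun[OF finite_Minf sets_Minf])
    show "(\<lambda>x. u x - w x) \<in> L2 Minf" by (rule L2_diff[OF u inf.in_L2[OF w]])
    fix \<phi> :: "'e \<Rightarrow> real" assume \<phi>: "\<phi> \<in> bcontfun"
    note \<phi>2 = inf.bcontfun_L2[OF \<phi>]
    have "(\<lambda>k. T (fst (y k)) \<phi>) \<longlonglongrightarrow> T u \<phi>"
    proof (rule LIMSEQ_I)
      fix \<epsilon> :: real assume "\<epsilon> > 0"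
      obtain n where n: "\<And>j. j \<ge> n \<Longrightarrow> norm (T (F j) \<phi> - T u \<phi>) < \<epsilon> / 2"
        using LIMSEQ_D[OF test[OF \<phi>], of "\<epsilon> / 2"] \<open>\<epsilon> > 0\<close> unfolding T_def by auto
      have "\<bar>T (fst (y k)) \<phi> - T u \<phi>\<bar> \<le> \<epsilon> / 2" if "k \<ge> n" for k
      proof -
        have "\<forall>j\<ge>k. \<bar>T (F j) \<phi> - T u \<phi>\<bar> \<le> \<epsilon> / 2"
          using n that by (metis less_imp_le order_trans real_norm_def)
        then show ?thesis using y[of k] \<phi> unfolding A_def by blast
      qed
      then show "\<exists>n. \<forall>k\<ge>n. norm (T (fst (y k)) \<phi> - T u \<phi>) < \<epsilon>"
        using \<open>\<epsilon> > 0\<close> by (intro exI[of _ n]) fastforce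
    qed
    moreover have "(\<lambda>k. T (fst (y k)) \<phi>) \<longlonglongrightarrow> T w \<phi>"
    proof (rule LIM_zero_cancel)
      have "(\<lambda>k. L2norm Minf (\<lambda>x. fst (y k) x - w x) * L2norm Minf \<phi>) \<longlonglongrightarrow> 0 * L2norm Minf \<phi>"
        by (intro tendsto_mult L2_lim tendsto_const)
      then have "(\<lambda>k. L2norm Minf (\<lambda>x. fst (y k) x - w x) * L2norm Minf \<phi>) \<longlonglongrightarrow> 0" by simp
      then show "(\<lambda>k. T (fst (y k)) \<phi> - T w \<phi>) \<longlonglongrightarrow> 0"
      proof (rule Lim_null_comparison[rotated], intro always_eventually allI)
        fix k
        have "T (fst (y k)) \<phi> - T w \<phi> = (\<integral>x. (fst (y k) x - w x) * \<phi> x \<partial>Minf)"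
          unfolding T_def using L2_integrable_mult[OF inf.in_L2[OF yD] \<phi>2] L2_integrable_mult[OF inf.in_L2[OF w] \<phi>2]
          by (simp add: left_diff_distrib)
        then show "norm (T (fst (y k)) \<phi> - T w \<phi>) \<le> L2norm Minf (\<lambda>x. fst (y k) x - w x) * L2norm Minf \<phi>"
          using L2_Cauchy_Schwarz[OF inf.in_L2[OF inf.diff[OF yD w]] \<phi>2] by simp
      qed
    qed
    ultimately have "T u \<phi> = T w \<phi>" by (rule LIMSEQ_unique)
    then show "(\<integral>x. (u x - w x) * \<phi> x \<partial>Minf) = 0"
      unfolding T_def using L2_integrable_mult[OF u \<phi>2] L2_integrable_mult[OF inf.in_L2[OF w] \<phi>2]
      by (simp add: left_diff_distrib)
  qed
  then have ae: "AE x in Minf. w x = u x" by eventually_elim simp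
  show "u \<in> Dinf" by (rule inf.AE_closed[OF w u ae])
  \<comment> \<open>The energy bound is known only for \<open>low n\<close> in place of
    \<open>W\<close>. For k beyond a fixed j the defect \<open>W - low n\<close> is charged to the
    fixed gradient \<open>g j\<close>, so n may depend on j but not on k, and the remainder
    \<open>g k - g j\<close> is small by the Cauchy property. The two errors, doubled, amount to at
    most \<epsilon>.\<close>
  have "Einf w w \<le> b"
  proof (rule field_le_epsilon)
    fix \<epsilon> :: real assume "\<epsilon> > 0"
    then obtain j where j: "\<And>i. i \<ge> j \<Longrightarrow> form_norm_sq Minf Einf (\<lambda>x. fst (y i) x - fst (y j) x) < \<epsilon> / 4"
      using Cauchy[of "\<epsilon> / 4"] by auto
    define g where "g k = snd (y k)" for k
    have g: "cyl_span UNIV (fst (y k)) (g k)" for k unfolding g_def by (rule A_span[OF y])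
    note gb = cyl_span_bounded_borel(2)[OF g]
    obtain B where B: "\<And>z. \<bar>inner (g j z) (g j z)\<bar> \<le> B"
      using gb[of j] unfolding bounded_borel_def by blast
    have "(\<lambda>n. \<integral>z. (W z - low n z) * inner (g j z) (g j z) \<partial>\<mu>) \<longlonglongrightarrow> (\<integral>z. 0 \<partial>\<mu>)"
    proof (rule integral_dominated_convergence[where w = "\<lambda>_. C * B"])
      show "(\<lambda>z. (W z - low n z) * inner (g j z) (g j z)) \<in> borel_measurable \<mu>" for n
        by (intro borel_measurable_integrable bounded_borel_integrable bounded_borel_intros gb)
      show "AE z in \<mu>. norm ((W z - low n z) * inner (g j z) (g j z)) \<le> C * B" for n
      proof (rule AE_I2)
        fix z
        have "\<bar>W z - low n z\<bar> \<le> C" using low_le[of n z] low_pos[of n z] le_C[of z] by linarith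
        then show "norm ((W z - low n z) * inner (g j z) (g j z)) \<le> C * B"
          unfolding real_norm_def abs_mult using B C_pos by (intro mult_mono) auto
      qed
      show "AE z in \<mu>. (\<lambda>n. (W z - low n z) * inner (g j z) (g j z)) \<longlonglongrightarrow> 0"
        using low_tendsto
      proof eventually_elim
        case (elim z)
        have "(\<lambda>n. (W z - low n z) * inner (g j z) (g j z)) \<longlonglongrightarrow> (W z - W z) * inner (g j z) (g j z)"
          by (intro tendsto_intros elim)
        then show ?case by simp
      qed
    qed auto
    then have "\<forall>\<^sub>F n in sequentially. (\<integral>z. (W z - low n z) * inner (g j z) (g j z) \<partial>\<mu>) < \<epsilon> / 4"
      by (rule order_tendstoD) (use \<open>\<epsilon> > 0\<close> in simp)
    then obtain n where n: "(\<integral>z. (W z - low n z) * inner (g j z) (g j z) \<partial>\<mu>) < \<epsilon> / 4"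
      using eventually_sequentially by auto
    have "Einf (fst (y k)) (fst (y k)) \<le> b + \<epsilon>" if k: "k \<ge> max n j" for k
    proof -
      have d: "cyl_span UNIV (\<lambda>z. fst (y k) z - fst (y j) z) (\<lambda>z. g k z - g j z)"
        by (rule cyl_span_diff[OF g g])
      note db = cyl_span_bounded_borel(2)[OF d]
      have "Einf (fst (y k)) (fst (y k)) = (\<integral>z. W z * inner (g k z) (g k z) \<partial>\<mu>)"
        unfolding inf.cyl_span_form[OF g g] by (rule integral_Minf[OF bounded_borel_measurable[OF gb]])
      also have "\<dots> \<le> (\<integral>z. low n z * inner (g k z) (g k z) + (2 * ((W z - low n z) * inner (g j z) (g j z))
          + 2 * (W z * inner (g k z - g j z) (g k z - g j z))) \<partial>\<mu>)"
      proof (rule integral_mono)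
        fix z
        \<comment> \<open>The difference of the two sides is the squared norm of a - 2 e.\<close>
        have two: "inner a a \<le> 2 * inner e e + 2 * inner (a - e) (a - e)" for a e :: 'e
          using inner_ge_zero[of "a - 2 *\<^sub>R e"] by (simp add: inner_simps inner_commute)
        have "(W z - low n z) * inner (g k z) (g k z)
            \<le> (W z - low n z) * (2 * inner (g j z) (g j z) + 2 * inner (g k z - g j z) (g k z - g j z))"
          by (intro mult_left_mono two) (use low_le[of n z] in simp)
        moreover have "low n z * inner (g k z - g j z) (g k z - g j z) \<ge> 0"
          using low_pos[of n z] by simp
        ultimately show "W z * inner (g k z) (g k z) \<le> low n z * inner (g k z) (g k z)
            + (2 * ((W z - low n z) * inner (g j z) (g j z)) + 2 * (W z * inner (g k z - g j z) (g k z - g j z)))"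
          by (simp add: algebra_simps)
      qed (intro bounded_borel_integrable bounded_borel_intros gb db)+
      also have "\<dots> = (\<integral>z. low n z * inner (g k z) (g k z) \<partial>\<mu>)
          + (2 * (\<integral>z. (W z - low n z) * inner (g j z) (g j z) \<partial>\<mu>)
          + 2 * (\<integral>z. W z * inner (g k z - g j z) (g k z - g j z) \<partial>\<mu>))"
      proof -
        have i: "integrable \<mu> (\<lambda>z. low n z * inner (g k z) (g k z))"
          "integrable \<mu> (\<lambda>z. (W z - low n z) * inner (g j z) (g j z))"
          "integrable \<mu> (\<lambda>z. W z * inner (g k z - g j z) (g k z - g j z))"
          by (intro bounded_borel_integrable bounded_borel_intros gb db)+
        show ?thesis using i by (simp only: Bochner_Integration.integral_add integral_mult_right_zero
            Bochner_Integration.integrable_add integrable_mult_right)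
      qed
      also have "(\<integral>z. W z * inner (g k z - g j z) (g k z - g j z) \<partial>\<mu>)
          = Einf (\<lambda>z. fst (y k) z - fst (y j) z) (\<lambda>z. fst (y k) z - fst (y j) z)"
        unfolding inf.cyl_span_form[OF d d] by (rule integral_Minf[OF bounded_borel_measurable[OF db], symmetric])
      also have "\<dots> \<le> form_norm_sq Minf Einf (\<lambda>z. fst (y k) z - fst (y j) z)"
        by (rule inf.form_norm_ge(1)[OF inf.cyl_span_D[OF d]])
      also have "\<dots> \<le> \<epsilon> / 4" using j[of k] k by simp
      also have "(\<integral>z. low n z * inner (g k z) (g k z) \<partial>\<mu>) \<le> b"
        using y[of k] k unfolding A_def g_def by auto
      finally show ?thesis using n by linarith
    qed
    then show "Einf w w \<le> b + \<epsilon>" by (intro LIMSEQ_le_const2[OF E_lim]) blast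
  qed
  then show "Einf u u \<le> b" using inf.AE_self[OF w u ae] by simp
qed

text \<open>An energy bound along infinitely many indices is all that a liminf offers; weak
  convergence is inherited by the corresponding subsequence.\<close>

lemma mosco_lower_aux:
  assumes weak: "weakly_converges MN Minf u uinf"
    and freq: "\<exists>\<^sub>F N in sequentially. u N \<in> D N \<and> E N (u N) (u N) < b"
  shows "uinf \<in> Dinf \<and> Einf uinf uinf \<le> b"
proof -
  have "infinite {N. u N \<in> D N \<and> E N (u N) (u N) < b}"
    using freq by (simp add: cofinite_eq_sequentially[symmetric] frequently_cofinite)
  from infinite_enumerate[OF this]
  obtain r :: "nat \<Rightarrow> nat" where r: "strict_mono r" and
    rD: "\<And>k. u (r k) \<in> D (r k)" and rE: "\<And>k. E (r k) (u (r k)) (u (r k)) < b" by blast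
  obtain K where K: "\<And>N. L2norm (MN N) (u N) \<le> K"
    using weakly_converges_bounded[OF weak converging N.bcontfun_L2] by blast
  have "\<exists>F G. cyl_span (V (r k)) F G \<and> E (r k) F F < b \<and> L2norm (MN (r k)) (\<lambda>x. u (r k) x - F x) < 1 / Suc k" for k
    by (rule N.cyl_span_approx_below[OF rD rE]) simp
  then obtain F G where F: "\<And>k. cyl_span (V (r k)) (F k) (G k)" and FE: "\<And>k. E (r k) (F k) (F k) < b"
    and close: "\<And>k. L2norm (MN (r k)) (\<lambda>x. u (r k) x - F k x) < 1 / Suc k" by metis
  have Finf: "cyl_span UNIV (F k) (G k)" for k by (rule cyl_span_mono[OF subset_UNIV F])
  have u2: "uinf \<in> L2 Minf" "u N \<in> L2 (MN N)" for N using weak unfolding weakly_converges_def by blast+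
  note Gb = cyl_span_bounded_borel(2)[OF F] and Fb = cyl_span_bounded_borel(1)[OF F]
  have GN: "(\<integral>z. inner (G k z) (G k z) \<partial>MN (r k)) < b" for k
    using FE[of k] N.cyl_span_form[OF F F] by simp
  have "(\<integral>z. low n z * inner (G k z) (G k z) \<partial>\<mu>) \<le> b" if "n \<le> k" for n k
  proof -
    have "(\<integral>z. low n z * inner (G k z) (G k z) \<partial>\<mu>) \<le> (\<integral>z. W (P (r k) z) * inner (G k z) (G k z) \<partial>\<mu>)"
      \<comment> \<open>\<open>r k\<close> is at least k, hence at least n, so the envelope
        \<open>low n\<close> lies below the weight at index \<open>r k\<close>.\<close>
      using low_le_P[OF order_trans[OF that strict_mono_imp_increasing[OF r]]]
      by (intro integral_mono bounded_borel_integrable bounded_borel_intros Gb mult_right_mono) auto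
    also have "\<dots> = (\<integral>z. inner (G k z) (G k z) \<partial>MN (r k))"
      using integral_MN[OF bounded_borel_measurable[OF Gb]] proj.cyl_span_P[OF F] by simp
    finally show ?thesis using GN[of k] by simp
  qed
  \<comment> \<open>The uniform bound that makes the minimisation in \<open>limit_in_domain\<close>
    finite: energy b and squared norm \<open>(K + 1)\<^sup>2\<close>, each transported to the limit
    measure at the price of \<open>C / c\<close>.\<close>
  moreover have "form_norm_sq Minf Einf (F k) \<le> C / c * b + C / c * (K + 1)\<^sup>2" for k
  proof -
    have "L2norm (MN (r k)) (F k) \<le> K + 1"
    proof -
      have "1 / real (Suc k) \<le> 1" by simp
      then show ?thesis
        using L2norm_triangle_diff[OF u2(2) N.in_L2[OF N.cyl_span_D[OF F]], of k] close[of k] K[of "r k"] by linarith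
    qed
    then have "(L2norm (MN (r k)) (F k))\<^sup>2 \<le> (K + 1)\<^sup>2" by (intro power_mono L2norm_nonneg)
    then have "C / c * (\<integral>z. (F k z)\<^sup>2 \<partial>MN (r k)) \<le> C / c * (K + 1)\<^sup>2"
      unfolding L2norm_sq using c_pos C_pos by (intro mult_left_mono) auto
    moreover have "(\<integral>z. (F k z)\<^sup>2 \<partial>Minf) \<le> C / c * (\<integral>z. (F k z)\<^sup>2 \<partial>MN (r k))"
      using proj.cyl_span_P[OF F] by (intro compare_integrals(2) bounded_borel_intros Fb) auto
    moreover have "Einf (F k) (F k) \<le> C / c * (\<integral>z. inner (G k z) (G k z) \<partial>MN (r k))"
      unfolding inf.cyl_span_form[OF Finf Finf]
      using proj.cyl_span_P[OF F] by (intro compare_integrals(2) Gb) auto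
    moreover have "C / c * (\<integral>z. inner (G k z) (G k z) \<partial>MN (r k)) \<le> C / c * b"
      using GN[of k] c_pos C_pos by (intro mult_left_mono) auto
    ultimately show ?thesis unfolding form_norm_sq_def by linarith
  qed
  ultimately show ?thesis
    using limit_in_domain[of F G b "C / c * b + C / c * (K + 1)\<^sup>2" uinf, OF Finf _ _ test_tendsto[OF weak K r F close] u2(1)]
    by blast
qed

lemma mosco_lower:
  assumes weak: "weakly_converges MN Minf u uinf"
  shows "form_value Dinf Einf uinf \<le> liminf (\<lambda>N. form_value (D N) (E N) (u N))"
proof (rule ccontr)
  assume "\<not> ?thesis"
  then have less: "liminf (\<lambda>N. form_value (D N) (E N) (u N)) < form_value Dinf Einf uinf" by simp
  \<comment> \<open>A real b strictly in between exists even when the right-hand value is infinite,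
    so membership in the domain and the inequality are obtained at once.\<close>
  then obtain b where b: "liminf (\<lambda>N. form_value (D N) (E N) (u N)) < ereal b" "ereal b < form_value Dinf Einf uinf"
    using ereal_dense2 by blast
  have "\<exists>\<^sub>F N in sequentially. form_value (D N) (E N) (u N) < ereal b"
  proof (rule ccontr)
    assume "\<not> ?thesis"
    then have "\<forall>\<^sub>F N in sequentially. ereal b \<le> form_value (D N) (E N) (u N)"
      by (simp add: not_frequently not_less)
    then have "ereal b \<le> liminf (\<lambda>N. form_value (D N) (E N) (u N))" by (rule Liminf_bounded)
    with b show False by simp
  qed
  then have "\<exists>\<^sub>F N in sequentially. u N \<in> D N \<and> E N (u N) (u N) < b"
    by (rule frequently_elim1) (auto simp: form_value_def split: if_splits)
  from mosco_lower_aux[OF weak this] b(2) show False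
    by (simp add: form_value_def)
qed

section \<open>The recovery sequence (M2)\<close>

lemma P_tendsto_joint:
  assumes "x \<longlonglongrightarrow> z"
  shows "(\<lambda>N. P N (x N)) \<longlonglongrightarrow> z"
proof -
  have "(\<lambda>N. norm (x N - z)) \<longlonglongrightarrow> 0"
    using assms by (simp add: LIM_zero tendsto_norm_zero)
  \<comment> \<open>The projections are contractions, which upgrades pointwise convergence to
    convergence along moving arguments. This is needed since the gradient is projected both inside
    and outside.\<close>
  then have "(\<lambda>N. P N (x N - z)) \<longlonglongrightarrow> 0"
    by (rule Lim_null_comparison[rotated]) (simp add: proj.norm_P_le)
  from tendsto_add[OF this P_tendsto[of z]] have "(\<lambda>N. P N (x N - z) + P N z) \<longlonglongrightarrow> z" by simp
  then show ?thesis by (simp flip: proj.P_add)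
qed

lemma projected_energy_tendsto:
  assumes "cyl_span UNIV F G"
  shows "(\<lambda>N. \<integral>z. inner (P N (G (P N z))) (P N (G (P N z))) \<partial>MN N) \<longlonglongrightarrow> (\<integral>z. inner (G z) (G z) \<partial>Minf)"
proof -
  have G: "G \<in> bcontfun" by (rule cyl_span_bcontfun(2)[OF assms])
  then obtain K where K: "\<And>z. norm (G z) \<le> K" and Gc: "continuous_on UNIV G"
    by (auto simp: bcontfun_def bounded_iff)
  show ?thesis
  proof (rule integral_MN_tendsto[where K = "K * K"])
    have "continuous_on UNIV (\<lambda>z. P N (G (P N z)))" for N
      using continuous_on_compose2[OF proj.continuous_P continuous_on_compose2[OF Gc proj.continuous_P]] by simp
    then show "(\<lambda>z. inner (P N (G (P N z))) (P N (G (P N z)))) \<in> borel_measurable borel" for N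
      by (intro borel_measurable_continuous_onI continuous_intros)
    show "(\<lambda>z. inner (G z) (G z)) \<in> borel_measurable borel"
      by (rule bounded_borel_measurable[OF cyl_span_bounded_borel(2)[OF assms]])
    fix N z
    have "norm (P N (G (P N z))) \<le> K" using proj.norm_P_le K by (rule order_trans)
    then have "norm (P N (G (P N z))) * norm (P N (G (P N z))) \<le> K * K"
      using order_trans[OF norm_ge_zero K] by (intro mult_mono) auto
    then show "\<bar>inner (P N (G (P N z))) (P N (G (P N z)))\<bar> \<le> K * K"
      by (simp flip: power2_norm_eq_inner add: power2_eq_square)
  next
    \<comment> \<open>Under the change of variables the argument is projected once more, which
      idempotence absorbs.\<close>
    fix z
    show "(\<lambda>N. inner (P N (G (P N (P N z)))) (P N (G (P N (P N z))))) \<longlonglongrightarrow> inner (G z) (G z)"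
      using P_tendsto_joint[OF bcontfun_P_tendsto[OF G, of z]]
      by (auto simp: proj.P_fixed[OF proj.P_in] intro: tendsto_inner)
  qed
qed

lemma mosco_upper:
  assumes w: "w \<in> Dinf"
  shows "\<exists>u. (\<forall>N. u N \<in> D N) \<and> strongly_converges MN Minf u w \<and>
    (\<lambda>N. E N (u N) (u N)) \<longlonglongrightarrow> Einf w w"
proof -
  have "\<exists>F G. cyl_span UNIV F G \<and> form_norm_sq Minf Einf (\<lambda>x. w x - F x) < (1 / Suc j)\<^sup>2" for j
    by (rule inf.cyl_span_dense[OF w]) simp
  then obtain F G where F: "\<And>j. cyl_span UNIV (F j) (G j)"
    and Fw: "\<And>j. form_norm_sq Minf Einf (\<lambda>x. w x - F j x) < (1 / Suc j)\<^sup>2" by metis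
  have FD: "F j \<in> Dinf" for j by (rule inf.cyl_span_D[OF F])
  note Fbc = cyl_span_bcontfun(1)[OF F]
  have inv: "(\<lambda>j. 1 / real (Suc j)) \<longlonglongrightarrow> 0" using LIMSEQ_Suc[OF lim_1_over_n] by simp
  have sym_diff: "form_norm_sq Minf Einf (\<lambda>x. F j x - w x) = form_norm_sq Minf Einf (\<lambda>x. w x - F j x)" for j
    using inf.form_norm_scale[OF inf.diff[OF w FD[of j]], of "-1"] by simp
  have norm_w: "L2norm Minf (\<lambda>x. w x - F j x) \<le> 1 / Suc j" for j
    unfolding L2norm_def
    using order_trans[OF inf.form_norm_ge(2)[OF inf.diff[OF w FD]] less_imp_le[OF Fw]]
    by (intro real_le_lsqrt) auto
  have "(\<lambda>j. (1 / real (Suc j))\<^sup>2) \<longlonglongrightarrow> 0\<^sup>2" by (intro tendsto_power inv)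
  then have inv2: "(\<lambda>j. (1 / real (Suc j))\<^sup>2) \<longlonglongrightarrow> 0" by simp
  have "(\<lambda>j. form_norm_sq Minf Einf (\<lambda>x. F j x - w x)) \<longlonglongrightarrow> 0"
    unfolding sym_diff
    by (rule tendsto_sandwich[OF _ _ tendsto_const inv2]; intro always_eventually allI)
       (intro inf.form_norm_nonneg inf.diff w FD less_imp_le[OF Fw])+
  note E_lim = inf.form_tendsto(1)[OF FD w this]
  define R where "R k N \<longleftrightarrow> (\<forall>i\<in>{..k}. \<bar>(\<integral>z. (F k z - F i z) * (F k z - F i z) \<partial>MN N)
      - (\<integral>z. (F k z - F i z) * (F k z - F i z) \<partial>Minf)\<bar> < 1 / Suc k) \<and>
    \<bar>(\<integral>z. inner (P N (G k (P N z))) (P N (G k (P N z))) \<partial>MN N)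
      - (\<integral>z. inner (G k z) (G k z) \<partial>Minf)\<bar> < 1 / Suc k" for k N
  have "\<forall>\<^sub>F N in sequentially. R k N" for k
    unfolding R_def
  proof (intro eventually_conj eventually_ball_finite ballI)
    fix i
    have "(\<lambda>z. (F k z - F i z) * (F k z - F i z)) \<in> bcontfun"
      by (intro mult_bcontfun minus_cont Fbc)
    from tendstoD[OF bcontfun_integral_tendsto[OF this], of "1 / Suc k"]
    show "\<forall>\<^sub>F N in sequentially. \<bar>(\<integral>z. (F k z - F i z) * (F k z - F i z) \<partial>MN N)
      - (\<integral>z. (F k z - F i z) * (F k z - F i z) \<partial>Minf)\<bar> < 1 / Suc k"
      by (simp add: dist_real_def)
  next
    show "\<forall>\<^sub>F N in sequentially. \<bar>(\<integral>z. inner (P N (G k (P N z))) (P N (G k (P N z))) \<partial>MN N)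
      - (\<integral>z. inner (G k z) (G k z) \<partial>Minf)\<bar> < 1 / Suc k"
      using tendstoD[OF projected_energy_tendsto[OF F[of k]], of "1 / Suc k"] by (simp add: dist_real_def)
  qed simp
  from diagonal_index[of R, OF this] obtain \<kappa> :: "nat \<Rightarrow> nat"
    where \<kappa>: "filterlim \<kappa> at_top sequentially" and \<kappa>R: "\<And>N. \<kappa> N = 0 \<or> R (\<kappa> N) N" by blast
  \<comment> \<open>Eventually \<open>\<kappa> N\<close> is at least 1, which rules out the default
    value 0 of \<open>diagonal_index\<close>.\<close>
  have R: "\<forall>\<^sub>F N in sequentially. R (\<kappa> N) N"
    using filterlim_at_top[THEN iffD1, OF \<kappa>, rule_format, of 1]
    by eventually_elim (use \<kappa>R in \<open>metis not_one_le_zero\<close>)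
  define u where "u N z = F (\<kappa> N) (P N z)" for N z
  have u_span: "cyl_span (V N) (u N) (\<lambda>z. P N (G (\<kappa> N) (P N z)))" for N
    unfolding u_def[abs_def] by (rule proj.cyl_span_compose_P[OF F])
  have uD: "u N \<in> D N" for N by (rule N.cyl_span_D[OF u_span])
  have "strongly_converges MN Minf u w"
  proof (rule strongly_convergesI)
    show "u N \<in> L2 (MN N)" for N by (rule N.in_L2[OF uD])
    show "w \<in> L2 Minf" by (rule inf.in_L2[OF w])
    fix \<delta> :: real assume "\<delta> > 0"
    \<comment> \<open>The 5 is 4 + 1: with t = \<open>1 / Suc J\<close>, the squared distance of
      \<open>F (\<kappa> N)\<close> and \<open>F J\<close> under the limit measure is at most the
      square of 2 t, hence at most 4 t since t \<le> 1, and passing to \<open>MN N\<close> adds at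
      most t.\<close>
    have "(\<lambda>j. 5 * (1 / real (Suc j))) \<longlonglongrightarrow> 5 * 0" by (intro tendsto_mult tendsto_const inv)
    then have "\<forall>\<^sub>F j in sequentially. 5 * (1 / real (Suc j)) < \<delta>\<^sup>2"
      by (rule order_tendstoD) (use \<open>\<delta> > 0\<close> in simp)
    moreover have "\<forall>\<^sub>F j in sequentially. 1 / real (Suc j) < \<delta>"
      by (rule order_tendstoD(2)[OF inv \<open>\<delta> > 0\<close>])
    ultimately have "\<forall>\<^sub>F j in sequentially. 5 * (1 / real (Suc j)) < \<delta>\<^sup>2 \<and> 1 / real (Suc j) < \<delta>"
      by (rule eventually_conj)
    then obtain J where J: "5 * (1 / real (Suc J)) < \<delta>\<^sup>2" "1 / real (Suc J) < \<delta>"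
      by (auto simp: eventually_sequentially)
    have "\<forall>\<^sub>F N in sequentially. L2norm (MN N) (\<lambda>z. u N z - F J z) \<le> \<delta>"
      using R filterlim_at_top[THEN iffD1, OF \<kappa>, rule_format, of J]
    proof eventually_elim
      case (elim N)
      let ?k = "\<kappa> N" and ?t = "1 / real (Suc J)"
      have kJ: "1 / real (Suc ?k) \<le> ?t" using elim(2) by (simp add: frac_le)
      have "L2norm Minf (\<lambda>z. F ?k z - F J z) \<le> 2 * ?t"
      proof -
        have "L2norm Minf (\<lambda>z. F ?k z - F J z)
            = L2norm Minf (\<lambda>z. (w z - F J z) - (w z - F ?k z))" by (simp add: algebra_simps)
        also have "\<dots> \<le> L2norm Minf (\<lambda>z. w z - F J z) + L2norm Minf (\<lambda>z. w z - F ?k z)"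
          by (rule L2norm_triangle_minus) (intro inf.in_L2 inf.diff w FD)+
        also have "\<dots> \<le> 2 * ?t" using norm_w[of J] norm_w[of ?k] kJ by linarith
        finally show ?thesis .
      qed
      then have "(L2norm Minf (\<lambda>z. F ?k z - F J z))\<^sup>2 \<le> (2 * ?t)\<^sup>2"
        by (intro power_mono L2norm_nonneg)
      also have "(2 * ?t)\<^sup>2 \<le> 4 * ?t"
      proof -
        have "?t * ?t \<le> ?t" by (rule mult_left_le) simp_all
        moreover have "(2 * ?t)\<^sup>2 = 4 * (?t * ?t)" by (simp add: power2_eq_square)
        ultimately show ?thesis by linarith
      qed
      finally have "(\<integral>z. (F ?k z - F J z) * (F ?k z - F J z) \<partial>Minf) \<le> 4 * ?t"
        unfolding L2norm_sq by (simp add: power2_eq_square)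
      moreover have "\<bar>(\<integral>z. (F ?k z - F J z) * (F ?k z - F J z) \<partial>MN N)
          - (\<integral>z. (F ?k z - F J z) * (F ?k z - F J z) \<partial>Minf)\<bar> < 1 / Suc ?k"
        using elim unfolding R_def by auto
      ultimately have le: "(\<integral>z. (F ?k z - F J z) * (F ?k z - F J z) \<partial>MN N) \<le> \<delta>\<^sup>2"
        using J(1) kJ by linarith
      \<comment> \<open>The space of \<open>MN N\<close> is \<open>V N\<close>, where
        \<open>P N\<close> is the identity, so the projection inside \<open>u N\<close> disappears
        from the norm.\<close>
      have "L2norm (MN N) (\<lambda>z. u N z - F J z) = sqrt (\<integral>z. (F ?k z - F J z) * (F ?k z - F J z) \<partial>MN N)"
        unfolding L2norm_eq u_def
        by (intro arg_cong[where f = sqrt] Bochner_Integration.integral_cong) (auto simp: space_MN proj.P_fixed)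
      also have "\<dots> \<le> \<delta>" using le \<open>\<delta> > 0\<close> by (intro real_le_lsqrt) auto
      finally show ?case .
    qed
    then show "\<exists>F\<in>bcontfun. L2norm Minf (\<lambda>z. w z - F z) \<le> \<delta> \<and>
      (\<forall>\<^sub>F N in sequentially. L2norm (MN N) (\<lambda>z. u N z - F z) \<le> \<delta>)"
      using norm_w[of J] J(2) by (intro bexI[OF _ Fbc[of J]]) auto
  qed
  moreover have "(\<lambda>N. E N (u N) (u N)) \<longlonglongrightarrow> Einf w w"
  proof -
    have 1: "(\<lambda>N. Einf (F (\<kappa> N)) (F (\<kappa> N))) \<longlonglongrightarrow> Einf w w"
      by (rule filterlim_compose[OF E_lim \<kappa>])
    have 2: "(\<lambda>N. 1 / real (Suc (\<kappa> N))) \<longlonglongrightarrow> 0"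
      by (rule filterlim_compose[OF inv \<kappa>])
    have "(\<lambda>N. E N (u N) (u N) - Einf (F (\<kappa> N)) (F (\<kappa> N))) \<longlonglongrightarrow> 0"
    proof (rule Lim_null_comparison[OF _ 2])
      show "\<forall>\<^sub>F N in sequentially. norm (E N (u N) (u N) - Einf (F (\<kappa> N)) (F (\<kappa> N))) \<le> 1 / real (Suc (\<kappa> N))"
        using R
      proof eventually_elim
        case (elim N)
        then show ?case
          unfolding N.cyl_span_form[OF u_span u_span] inf.cyl_span_form[OF F F] R_def by simp
      qed
    qed
    from tendsto_add[OF this 1] show ?thesis by simp
  qed
  ultimately show ?thesis using uD by blast
qed

lemma mosco: "mosco_converges MN Minf D E Dinf Einf"
  unfolding mosco_converges_def using mosco_lower mosco_upper by blast

end

section \<open>Application to the density exp (- Q)\<close>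

lemma orthogonal_projections_tendsto:
  fixes V :: "nat \<Rightarrow> 'e::real_inner set"
  assumes proj: "\<And>N. orthogonal_projection (V N) (P N)"
    and mono: "incseq V" and dense: "closure (\<Union>N. V N) = UNIV"
  shows "(\<lambda>N. P N z) \<longlonglongrightarrow> z"
proof (rule LIMSEQ_I)
  fix \<epsilon> :: real assume "\<epsilon> > 0"
  have "z \<in> closure (\<Union>N. V N)" using dense by simp
  \<comment> \<open>A fixed v near z stays in all later subspaces, and \<open>P N z\<close> is at
    least as near to z.\<close>
  then obtain v n where v: "v \<in> V n" "dist v z < \<epsilon>"
    using \<open>\<epsilon> > 0\<close> unfolding closure_approachable by blast
  have "norm (P N z - z) < \<epsilon>" if "N \<ge> n" for N
  proof -
    interpret orthogonal_projection "V N" "P N" by (rule proj)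
    have "v \<in> V N" using incseqD[OF mono that] v(1) by blast
    from dist_P_le[OF this, of z] v(2) show ?thesis
      by (simp add: dist_norm norm_minus_commute)
  qed
  then show "\<exists>n. \<forall>N\<ge>n. norm (P N z - z) < \<epsilon>" by blast
qed

theorem theorem4p6:
  fixes L :: "'w measure"
    and rep :: "'e::{real_inner,banach,polish_space} \<Rightarrow> 'w \<Rightarrow> real"
    and \<mu> :: "'e measure"
    and V :: "nat \<Rightarrow> 'e set"
    and P :: "nat \<Rightarrow> 'e \<Rightarrow> 'e"
    and f :: "real \<Rightarrow> real"
    and D :: "nat \<Rightarrow> ('e \<Rightarrow> real) set"
    and \<E> :: "nat \<Rightarrow> ('e \<Rightarrow> real) \<Rightarrow> ('e \<Rightarrow> real) \<Rightarrow> real"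
    and Dinf :: "('e \<Rightarrow> real) set"
    and \<E>inf :: "('e \<Rightarrow> real) \<Rightarrow> ('e \<Rightarrow> real) \<Rightarrow> real"
  defines "\<mu>' \<equiv> \<lambda>N. weighted (Q_functional L rep f) (projected \<mu> (V N) (P N))"
    and "\<mu>'inf \<equiv> weighted (Q_functional L rep f) \<mu>"
  assumes "finite_measure L"
    and "is_L2_space L rep"
    and "gaussian_measure \<mu>" and "mean_zero \<mu>" and "nondegenerate \<mu>"
    and "\<And>N. subspace (V N)" and "\<And>N. closed (V N)"
    and "incseq V" and "closure (\<Union>N. V N) = UNIV"
    and "\<And>N. is_orthogonal_projection (V N) (P N)"
    and "bounded_variation f"
    and "\<And>a. \<not> isCont f a \<Longrightarrow> AE h in \<mu>. emeasure L {\<omega> \<in> space L. rep h \<omega> = a} = 0"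
    and "\<And>N. smallest_closed_extension (\<mu>' N) (gradient_preform (V N) (\<mu>' N)) (D N) (\<E> N)"
    and "smallest_closed_extension \<mu>'inf (gradient_preform UNIV \<mu>'inf) Dinf \<E>inf"
  shows "converging_L2_spaces \<mu>' \<mu>'inf \<and> mosco_converges \<mu>' \<mu>'inf D \<E> Dinf \<E>inf"
proof -
  interpret L: L2_model L rep
    using \<open>finite_measure L\<close> \<open>is_L2_space L rep\<close> by (simp add: L2_model_def L2_model_axioms_def)
  have f [measurable]: "f \<in> borel_measurable borel"
    by (rule bounded_variation_borel_measurable) fact
  obtain B where B: "\<And>t. \<bar>f t\<bar> \<le> B"
    using bounded_variation_imp_bounded[OF \<open>bounded_variation f\<close>] by (auto simp: bounded_iff)
  let ?Q = "Q_functional L rep f"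
  define K where "K = B * measure L (space L)"
  have K: "\<bar>?Q h\<bar> \<le> K" for h unfolding K_def by (rule L.Q_functional_bounded[OF f B])
  have Q [measurable]: "?Q \<in> borel_measurable borel" by (rule L.Q_functional_measurable[OF f B])
  have proj: "orthogonal_projection (V N) (P N)" for N
    using assms(8,12) by (simp add: orthogonal_projection_def)
  note P_lim = orthogonal_projections_tendsto[OF proj \<open>incseq V\<close> \<open>closure (\<Union>N. V N) = UNIV\<close>]
  note disc = bounded_variation_countable_discontinuities[OF \<open>bounded_variation f\<close>]
  \<comment> \<open>The exceptional null set of h in the hypothesis depends on the jump point a; as
    there are only countably many jumps, one null set serves them all. For each remaining h the
    preimages of the jump points under \<open>rep h\<close> then form one null set of
    \<open>L\<close>, again by countability.\<close>
  have "AE h in \<mu>. \<forall>a\<in>{a. \<not> isCont f a}. emeasure L {\<omega> \<in> space L. rep h \<omega> = a} = 0"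
    using assms(14) by (subst AE_ball_countable[OF disc]) auto
  then have lim: "AE h in \<mu>. (\<lambda>N. exp (- ?Q (P N h))) \<longlonglongrightarrow> exp (- ?Q h)"
  proof eventually_elim
    case (elim h)
    have "AE \<omega> in L. \<forall>a\<in>{a. \<not> isCont f a}. rep h \<omega> \<noteq> a"
      unfolding AE_ball_countable[OF disc]
    proof
      fix a assume "a \<in> {a. \<not> isCont f a}"
      then have "{\<omega> \<in> space L. \<not> rep h \<omega> \<noteq> a} \<in> null_sets L" using elim by (auto simp: null_sets_def)
      then show "AE \<omega> in L. rep h \<omega> \<noteq> a" by (subst AE_iff_null) (auto simp: null_sets_def)
    qed
    then have "AE \<omega> in L. isCont f (rep h \<omega>)" by eventually_elim blast
    from L.Q_functional_tendsto[OF f B P_lim this] show ?case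
      by (intro tendsto_intros)
  qed
  have wp: "weighted_projections \<mu> (\<lambda>h. exp (- ?Q h)) V P (exp (- K)) (exp K)"
    unfolding weighted_projections_def weighted_projections_axioms_def
  proof (intro conjI allI)
    show "prob_space \<mu>" "sets \<mu> = sets borel" using \<open>gaussian_measure \<mu>\<close> by (auto simp: gaussian_measure_def)
    show "exp (- K) \<le> exp (- ?Q h)" "exp (- ?Q h) \<le> exp K" for h using K[of h] by auto
  qed (use proj P_lim lim in simp_all)
  interpret weighted_projections \<mu> "\<lambda>h. exp (- ?Q h)" V P "exp (- K)" "exp K" by (rule wp)
  have MN: "MN = \<mu>'" and Minf: "Minf = \<mu>'inf"
    unfolding MN_def[abs_def] Minf_def \<mu>'_def \<mu>'inf_def weighted_def projected_def by simp_all
  interpret projected_forms \<mu> "\<lambda>h. exp (- ?Q h)" V P "exp (- K)" "exp K" D \<E> Dinf \<E>inf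
    by unfold_locales (simp_all add: MN Minf assms(15,16))
  show ?thesis using converging mosco unfolding MN Minf by blast
qed

end
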